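(* Let $\langle t\rangle=\{0,1,t,t^2,\dots\}$ be the free monoid on one generator (with absorbing element $0$). Let $\mathbb{H}_{\langle t\rangle,nil}$ be the Hall algebra of the category $\mathcal{C}^N_{\langle t\rangle,nil}$ of finite nilpotent $\langle t\rangle$-modules (with normal morphisms), and let $\mathbb{H}_K$ be Kreimer's Hopf algebra of rooted trees over $\mathbb{Q}$, with (graded) dual $\mathbb{H}_K^*$. Then $\mathbb{H}_K^*$ and $\mathbb{H}_{\langle t\rangle,nil}$ are isomorphic as Hopf algebras.
   Context: A $\langle t\rangle$-module is a pointed set $(M,* )$ with an action of the monoid $\langle t\rangle$ such that $(ab)\cdot m=a\cdot(b\cdot m)$, $1\cdot m=m$, $0\cdot m=*$; equivalently, a pointed set with a pointed self-map $t$. Morphisms are pointed maps commuting with the action; $f:M\to N$ is normal if every fibre $f^{-1}(n)$ with $n\ne *$ has at most one element. $M$ is finite if it is a finite set, with $\dim M=|M|-1$, and nilpotent if there is $n\in\mathbb{N}$ with $t^n\cdot m=*$ for all $m\in M$. A submodule $N\subset M$ is a pointed subset preserved by the action, $M/N=(M\setminus N)\cup\{*\}$ is the module obtained by collapsing $N$ to the basepoint, and $M\oplus N$ is the wedge sum (disjoint union with basepoints identified). $\overline{M}$ denotes the isomorphism class of $M$. The Hall algebra $\mathbb{H}_{\langle t\rangle,nil}$ is the $\mathbb{Q}$-vector space of finitely supported $\mathbb{Q}$-valued functions on the set of isomorphism classes of finite nilpotent $\langle t\rangle$-modules, with product $(f\star g)(\overline{M})=\sum_{N\subset M} f(\overline{M/N})\,g(\overline{N})$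 (sum over all submodules) and coproduct $\Delta(f)(\overline{M},\overline{N})=f(\overline{M\oplus N})$; the unit is the characteristic function of the class of the zero module $\{*\}$ and the counit is $f\mapsto f(\overline{\{*\}})$. It is graded by dimension and connected, hence a Hopf algebra. Kreimer's Hopf algebra $\mathbb{H}_K$: as an algebra it is the commutative polynomial algebra over $\mathbb{Q}$ on the isomorphism classes of (finite, non-empty, non-planar) rooted trees, so it has a basis of rooted forests, with product the disjoint union and unit the empty forest. An admissible cut of a rooted tree $T$ is a non-empty set $C$ of edges such that every path from a leaf to the root contains at most one edge of $C$; removing $C$ from $T$ leaves the component $R_C(T)$ containing the root and the forest $P_C(T)$ formed by the other components (each rooted at its vertex closest to the original root). The coproduct is the algebra homomorphism with $\Delta(T)=T\otimes 1+1\otimes T+\sum_{C}P_C(T)\otimes R_C(T)$, the sum over admissible cuts $C$ of $T$. $\mathbb{H}_K$ is graded by number of vertices, and $\mathbb{H}_K^*=\bigoplus_n (\mathbb{H}_K)_n^*$ is the graded dual Hopf algebra. *)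

theory Defs
  imports
    Complex_Main
    "HOL-Library.Function_Algebras"
    "HOL-Library.Multiset"
    "HOL-Library.Poly_Mapping"
    "HOL-Library.Product_Plus"
begin

section \<open>Hopf algebras over the rationals\<close>

text \<open>
  Vector spaces over \<open>\<rat>\<close> are subspaces of some function space \<open>'x \<Rightarrow> rat\<close>. For subspaces \<open>V\<close> of
  \<open>'x \<Rightarrow> rat\<close> and \<open>W\<close> of \<open>'y \<Rightarrow> rat\<close>, the canonical map from the algebraic tensor product of \<open>V\<close>
  and \<open>W\<close> to \<open>'x \<times> 'y \<Rightarrow> rat\<close> is injective; the tensor product is therefore realised as its image.
  The universal property of this realisation is \<open>tensor_lift_sum_list\<close> below.
\<close>

definition fscale :: "rat \<Rightarrow> ('x \<Rightarrow> rat) \<Rightarrow> ('x \<Rightarrow> rat)" where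
  "fscale c f = (\<lambda>x. c * f x)"

global_interpretation fun_space: vector_space fscale
  by unfold_locales (auto simp: fscale_def fun_eq_iff algebra_simps)

definition linear_on ::
  "('x \<Rightarrow> rat) set \<Rightarrow> (rat \<Rightarrow> 'w \<Rightarrow> 'w) \<Rightarrow> (('x \<Rightarrow> rat) \<Rightarrow> 'w::ab_group_add) \<Rightarrow> bool" where
  "linear_on V scale f \<longleftrightarrow>
     (\<forall>a\<in>V. \<forall>b\<in>V. f (a + b) = f a + f b) \<and> (\<forall>c. \<forall>a\<in>V. f (fscale c a) = scale c (f a))"

definition tensor :: "('x \<Rightarrow> rat) \<Rightarrow> ('y \<Rightarrow> rat) \<Rightarrow> ('x \<times> 'y \<Rightarrow> rat)"  (infixr \<open>\<otimes>\<close> 70) where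
  "a \<otimes> b = (\<lambda>(x, y). a x * b y)"

definition tensor_space :: "('x \<Rightarrow> rat) set \<Rightarrow> ('y \<Rightarrow> rat) set \<Rightarrow> ('x \<times> 'y \<Rightarrow> rat) set" where
  "tensor_space V W = fun_space.span {a \<otimes> b | a b. a \<in> V \<and> b \<in> W}"

text \<open>
  The linear map on the tensor product of \<open>V\<close> and \<open>W\<close> induced by a bilinear map \<open>B\<close>.
\<close>

definition tensor_lift ::
  "('x \<Rightarrow> rat) set \<Rightarrow> ('y \<Rightarrow> rat) set \<Rightarrow> (('x \<Rightarrow> rat) \<Rightarrow> ('y \<Rightarrow> rat) \<Rightarrow> 'w::ab_group_add)
    \<Rightarrow> ('x \<times> 'y \<Rightarrow> rat) \<Rightarrow> 'w" where
  "tensor_lift V W B u =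
     (THE w. \<exists>ps. set ps \<subseteq> V \<times> W \<and> u = (\<Sum>(a, b)\<leftarrow>ps. a \<otimes> b) \<and> w = (\<Sum>(a, b)\<leftarrow>ps. B a b))"

lemma sum_list_fun_apply: "(\<Sum>p\<leftarrow>ps. F p) x = (\<Sum>p\<leftarrow>ps. F p x)"
  by (induction ps) auto

lemma linear_on_zero:
  assumes "vector_space scale" "fun_space.subspace V" "linear_on V scale f"
  shows "f 0 = 0"
proof -
  have "f (fscale 0 0) = scale 0 (f 0)"
    using assms(2,3) fun_space.subspace_0 unfolding linear_on_def by blast
  moreover have "scale 0 (f 0) = 0"
    using vector_space.vector_space_assms(1,2,3,4) [OF assms(1)]
    by (metis add_cancel_right_right add_0)
  ultimately show ?thesis
    by simp
qed

lemma linear_on_sum_list: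
  assumes "vector_space scale" "fun_space.subspace V" "linear_on V scale f"
    and "\<And>p. p \<in> set ps \<Longrightarrow> F p \<in> V"
  shows "(\<Sum>p\<leftarrow>ps. F p) \<in> V \<and> f (\<Sum>p\<leftarrow>ps. F p) = (\<Sum>p\<leftarrow>ps. f (F p))"
  using assms(4)
proof (induction ps)
  case Nil
  then show ?case
    using linear_on_zero [OF assms(1-3)] fun_space.subspace_0 [OF assms(2)]
    by (simp only: list.map sum_list.Nil)
next
  case (Cons p ps)
  then have "F p \<in> V" "(\<Sum>p\<leftarrow>ps. F p) \<in> V" "f (\<Sum>p\<leftarrow>ps. F p) = (\<Sum>p\<leftarrow>ps. f (F p))"
    by simp_all
  then show ?case
    using assms(3) fun_space.subspace_add [OF assms(2)] unfolding linear_on_def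
    by (simp only: list.map sum_list.Cons)
qed

lemma tensor_sum_list_zero:
  fixes B :: "('x \<Rightarrow> rat) \<Rightarrow> ('y \<Rightarrow> rat) \<Rightarrow> 'w::ab_group_add"
  assumes V: "fun_space.subspace V" and W: "fun_space.subspace W"
    and sc: "vector_space scale"
    and B1: "\<And>b. b \<in> W \<Longrightarrow> linear_on V scale (\<lambda>a. B a b)"
    and B2: "\<And>a. a \<in> V \<Longrightarrow> linear_on W scale (\<lambda>b. B a b)"
  shows "set ps \<subseteq> V \<times> W \<Longrightarrow> (\<Sum>(a, b)\<leftarrow>ps. a \<otimes> b) = 0 \<Longrightarrow> (\<Sum>(a, b)\<leftarrow>ps. B a b) = 0"
proof (induction "length ps" arbitrary: ps)
  case 0
  then show ?case
    by simp
next
  case (Suc n)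
  then obtain a0 b0 qs where ps: "ps = (a0, b0) # qs"
    by (metis length_Suc_conv surj_pair)
  have a0: "a0 \<in> V" and b0: "b0 \<in> W" and qs: "set qs \<subseteq> V \<times> W" and len: "n = length qs"
    using Suc.prems Suc.hyps ps by auto
  have zero: "a0 \<otimes> b0 + (\<Sum>(a, b)\<leftarrow>qs. a \<otimes> b) = 0"
    using Suc.prems ps by simp
  show ?case
  proof (cases "b0 = 0")
    case True
    have "a0 \<otimes> b0 = 0"
      using True by (auto simp: tensor_def fun_eq_iff)
    then have "(\<Sum>(a, b)\<leftarrow>qs. B a b) = 0"
      using Suc.hyps(1) [OF len qs] zero by simp
    moreover have "B a0 b0 = 0"
      using linear_on_zero [OF sc W B2 [OF a0]] True by simp
    ultimately show ?thesis
      using ps by simp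
  next
    case False
    then obtain y where y: "b0 y \<noteq> 0"
      by (auto simp: fun_eq_iff)
    define k where "k b = - b y / b0 y" for b :: "'y \<Rightarrow> rat"
    define qs' where "qs' = map (\<lambda>(a, b). (a, b + fscale (k b) b0)) qs"
    have a0_eq: "a0 = (\<Sum>p\<leftarrow>qs. fscale (k (snd p)) (fst p))"
    proof
      fix x
      have "a0 x * b0 y + (\<Sum>p\<leftarrow>qs. fst p x * snd p y) = 0"
        using fun_cong [OF zero, of "(x, y)"]
        by (simp add: sum_list_fun_apply tensor_def case_prod_unfold)
      moreover have "(\<Sum>p\<leftarrow>qs. fscale (k (snd p)) (fst p)) x =
          - (\<Sum>p\<leftarrow>qs. fst p x * snd p y) / b0 y"
        unfolding sum_list_fun_apply
        by (induction qs) (auto simp: fscale_def k_def field_simps y)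
      ultimately show "a0 x = (\<Sum>p\<leftarrow>qs. fscale (k (snd p)) (fst p)) x"
        using y by (metis add_eq_0_iff2 eq_divide_eq)
    qed
    have mem: "fscale (k (snd p)) (fst p) \<in> V" if "p \<in> set qs" for p
      using that qs fun_space.subspace_scale [OF V] by auto
    have "(\<Sum>(a, b)\<leftarrow>qs'. a \<otimes> b) =
        (\<Sum>(a, b)\<leftarrow>qs. a \<otimes> b) + (\<Sum>p\<leftarrow>qs. fscale (k (snd p)) (fst p)) \<otimes> b0"
      unfolding qs'_def
      by (induction qs) (auto simp: tensor_def fscale_def fun_eq_iff algebra_simps)
    then have "(\<Sum>(a, b)\<leftarrow>qs'. a \<otimes> b) = 0"
      using zero a0_eq by (simp add: add.commute)
    moreover have "set qs' \<subseteq> V \<times> W"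
      using qs b0 fun_space.subspace_scale [OF W] fun_space.subspace_add [OF W]
      by (auto simp: qs'_def)
    moreover have "n = length qs'"
      by (simp add: qs'_def len)
    ultimately have IH: "(\<Sum>(a, b)\<leftarrow>qs'. B a b) = 0"
      using Suc.hyps(1) by blast
    have B_scale: "B a (b + fscale (k b) b0) = B a b + B (fscale (k b) a) b0"
      if "a \<in> V" "b \<in> W" for a b
      using that B1 [OF b0] B2 [OF \<open>a \<in> V\<close>] b0 fun_space.subspace_scale [OF W b0]
      by (simp add: linear_on_def)
    have "(\<Sum>(a, b)\<leftarrow>qs'. B a b) =
        (\<Sum>(a, b)\<leftarrow>qs. B a b) + (\<Sum>p\<leftarrow>qs. B (fscale (k (snd p)) (fst p)) b0)"
      using qs unfolding qs'_def by (induction qs) (auto simp: B_scale algebra_simps)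
    also have "(\<Sum>p\<leftarrow>qs. B (fscale (k (snd p)) (fst p)) b0) = B a0 b0"
      using linear_on_sum_list [OF sc V B1 [OF b0], of qs "\<lambda>p. fscale (k (snd p)) (fst p)"] mem
        a0_eq by simp
    finally show ?thesis
      using IH ps by (simp add: add.commute)
  qed
qed

lemma tensor_lift_sum_list:
  fixes B :: "('x \<Rightarrow> rat) \<Rightarrow> ('y \<Rightarrow> rat) \<Rightarrow> 'w::ab_group_add"
  assumes V: "fun_space.subspace V" and W: "fun_space.subspace W"
    and sc: "vector_space scale"
    and B1: "\<And>b. b \<in> W \<Longrightarrow> linear_on V scale (\<lambda>a. B a b)"
    and B2: "\<And>a. a \<in> V \<Longrightarrow> linear_on W scale (\<lambda>b. B a b)"
    and ps: "set ps \<subseteq> V \<times> W"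
  shows "tensor_lift V W B (\<Sum>(a, b)\<leftarrow>ps. a \<otimes> b) = (\<Sum>(a, b)\<leftarrow>ps. B a b)"
proof -
  have "(\<Sum>(a, b)\<leftarrow>qs. B a b) = (\<Sum>(a, b)\<leftarrow>ps. B a b)"
    if qs: "set qs \<subseteq> V \<times> W" and eq: "(\<Sum>(a, b)\<leftarrow>ps. a \<otimes> b) = (\<Sum>(a, b)\<leftarrow>qs. a \<otimes> b)" for qs
  proof -
    define rs where "rs = map (\<lambda>(a, b). (fscale (- 1) a, b)) ps"
    have "set (qs @ rs) \<subseteq> V \<times> W"
      using qs ps fun_space.subspace_neg [OF V] by (auto simp: rs_def)
    moreover have "(\<Sum>(a, b)\<leftarrow>rs. a \<otimes> b) = - (\<Sum>(a, b)\<leftarrow>ps. a \<otimes> b)"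
      unfolding rs_def by (induction ps) (auto simp: tensor_def fscale_def fun_eq_iff)
    moreover have "B (fscale (- 1) a) b = - B a b" if "a \<in> V" "b \<in> W" for a b
    proof -
      interpret sc: vector_space scale
        by (fact sc)
      show ?thesis
        using that B1 [of b] sc.scale_minus_left [of 1] sc.scale_one unfolding linear_on_def by metis
    qed
    then have "(\<Sum>(a, b)\<leftarrow>rs. B a b) = - (\<Sum>(a, b)\<leftarrow>ps. B a b)"
      using ps unfolding rs_def by (induction ps) auto
    ultimately show ?thesis
      using tensor_sum_list_zero [OF V W sc B1 B2, of "qs @ rs"] eq by simp
  qed
  then show ?thesis
    unfolding tensor_lift_def using ps by (intro the_equality) blast+
qed

record 'x bialgebra_data =
  space :: "('x \<Rightarrow> rat) set"
  mul :: "('x \<Rightarrow> rat) \<Rightarrow> ('x \<Rightarrow> rat) \<Rightarrow> ('x \<Rightarrow> rat)"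
  unit :: "'x \<Rightarrow> rat"
  comul :: "('x \<Rightarrow> rat) \<Rightarrow> ('x \<times> 'x \<Rightarrow> rat)"
  counit :: "('x \<Rightarrow> rat) \<Rightarrow> rat"

abbreviation lift2 ::
  "('x, 'm) bialgebra_data_scheme \<Rightarrow> (('x \<Rightarrow> rat) \<Rightarrow> ('x \<Rightarrow> rat) \<Rightarrow> 'w::ab_group_add)
    \<Rightarrow> ('x \<times> 'x \<Rightarrow> rat) \<Rightarrow> 'w" where
  "lift2 H \<equiv> tensor_lift (space H) (space H)"

definition tensor_mul ::
  "('x, 'm) bialgebra_data_scheme \<Rightarrow> ('x \<times> 'x \<Rightarrow> rat) \<Rightarrow> ('x \<times> 'x \<Rightarrow> rat) \<Rightarrow> ('x \<times> 'x \<Rightarrow> rat)" where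
  "tensor_mul H u v = lift2 H (\<lambda>a b. lift2 H (\<lambda>c d. mul H a c \<otimes> mul H b d) v) u"

locale bialgebra =
  fixes H :: "'x bialgebra_data"
  assumes space_subspace: "fun_space.subspace (space H)"
    and mul_closed: "a \<in> space H \<Longrightarrow> b \<in> space H \<Longrightarrow> mul H a b \<in> space H"
    and mul_linear_left: "b \<in> space H \<Longrightarrow> linear_on (space H) fscale (\<lambda>a. mul H a b)"
    and mul_linear_right: "a \<in> space H \<Longrightarrow> linear_on (space H) fscale (\<lambda>b. mul H a b)"
    and mul_assoc: "a \<in> space H \<Longrightarrow> b \<in> space H \<Longrightarrow> c \<in> space H \<Longrightarrow>
          mul H (mul H a b) c = mul H a (mul H b c)"
    and unit_closed: "unit H \<in> space H"
    and mul_unit_left: "a \<in> space H \<Longrightarrow> mul H (unit H) a = a"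
    and mul_unit_right: "a \<in> space H \<Longrightarrow> mul H a (unit H) = a"
    and comul_closed: "a \<in> space H \<Longrightarrow> comul H a \<in> tensor_space (space H) (space H)"
    and comul_linear: "linear_on (space H) fscale (comul H)"
    and comul_coassoc: "a \<in> space H \<Longrightarrow>
          (\<lambda>(x, y, z). lift2 H (\<lambda>b c. comul H b \<otimes> c) (comul H a) ((x, y), z)) =
          lift2 H (\<lambda>b c. b \<otimes> comul H c) (comul H a)"
    and counit_linear: "linear_on (space H) (*) (counit H)"
    and comul_counit_left: "a \<in> space H \<Longrightarrow> lift2 H (\<lambda>b c. fscale (counit H b) c) (comul H a) = a"
    and comul_counit_right: "a \<in> space H \<Longrightarrow> lift2 H (\<lambda>b c. fscale (counit H c) b) (comul H a) = a"
    and comul_mul: "a \<in> space H \<Longrightarrow> b \<in> space H \<Longrightarrow>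
          comul H (mul H a b) = tensor_mul H (comul H a) (comul H b)"
    and comul_unit: "comul H (unit H) = unit H \<otimes> unit H"
    and counit_mul: "a \<in> space H \<Longrightarrow> b \<in> space H \<Longrightarrow>
          counit H (mul H a b) = counit H a * counit H b"
    and counit_unit: "counit H (unit H) = 1"

definition antipode :: "'x bialgebra_data \<Rightarrow> (('x \<Rightarrow> rat) \<Rightarrow> ('x \<Rightarrow> rat)) \<Rightarrow> bool" where
  "antipode H S \<longleftrightarrow>
     S ` space H \<subseteq> space H \<and> linear_on (space H) fscale S \<and>
     (\<forall>a\<in>space H. lift2 H (\<lambda>b c. mul H (S b) c) (comul H a) = fscale (counit H a) (unit H)) \<and>
     (\<forall>a\<in>space H. lift2 H (\<lambda>b c. mul H b (S c)) (comul H a) = fscale (counit H a) (unit H))"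

locale hopf_algebra = bialgebra +
  assumes antipode_exists: "\<exists>S. antipode H S"

locale hopf_isomorphism = source: hopf_algebra H + target: hopf_algebra K
  for H :: "'x bialgebra_data" and K :: "'y bialgebra_data" +
  fixes \<phi> :: "('x \<Rightarrow> rat) \<Rightarrow> ('y \<Rightarrow> rat)"
  assumes iso_bij: "bij_betw \<phi> (space H) (space K)"
    and iso_linear: "linear_on (space H) fscale \<phi>"
    and iso_mul: "a \<in> space H \<Longrightarrow> b \<in> space H \<Longrightarrow> \<phi> (mul H a b) = mul K (\<phi> a) (\<phi> b)"
    and iso_unit: "\<phi> (unit H) = unit K"
    and iso_comul: "a \<in> space H \<Longrightarrow> comul K (\<phi> a) = lift2 H (\<lambda>b c. \<phi> b \<otimes> \<phi> c) (comul H a)"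
    and iso_counit: "a \<in> space H \<Longrightarrow> counit K (\<phi> a) = counit H a"
    and iso_antipode: "antipode H S \<Longrightarrow> antipode K S' \<Longrightarrow> a \<in> space H \<Longrightarrow> \<phi> (S a) = S' (\<phi> a)"

definition hopf_isomorphic :: "'x bialgebra_data \<Rightarrow> 'y bialgebra_data \<Rightarrow> bool" where
  "hopf_isomorphic H K \<longleftrightarrow> (\<exists>\<phi>. hopf_isomorphism H K \<phi>)"


section \<open>Modules over the free monoid on one generator\<close>

text \<open>The monoid \<open>\<langle>t\<rangle> = {0, 1, t, t\<^sup>2, \<dots>}\<close>, where \<open>TPow n\<close> is \<open>t\<^sup>n\<close>.\<close>

datatype tmonoid = TZero | TPow nat

instantiation tmonoid :: "{monoid_mult, mult_zero}"
begin

definition zero_tmonoid :: tmonoid where "0 = TZero"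

definition one_tmonoid :: tmonoid where "1 = TPow 0"

fun times_tmonoid :: "tmonoid \<Rightarrow> tmonoid \<Rightarrow> tmonoid" where
  "TPow m * TPow n = TPow (m + n)"
| "TZero * _ = TZero"
| "_ * TZero = TZero"

instance
proof
  fix a b c :: tmonoid
  show "a * b * c = a * (b * c)"
    by (cases a; cases b; cases c) simp_all
  show "1 * a = a" "a * 1 = a" "0 * a = 0" "a * 0 = 0"
    by (cases a; simp add: one_tmonoid_def zero_tmonoid_def)+
qed

end

definition tgen :: tmonoid where
  "tgen = TPow 1"

record 'a tmod =
  carrier :: "'a set"
  base :: 'a
  act :: "tmonoid \<Rightarrow> 'a \<Rightarrow> 'a"

definition tmodule :: "'a tmod \<Rightarrow> bool" where
  "tmodule M \<longleftrightarrow>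
     base M \<in> carrier M \<and>
     (\<forall>a. \<forall>m\<in>carrier M. act M a m \<in> carrier M) \<and>
     (\<forall>a b. \<forall>m\<in>carrier M. act M (a * b) m = act M a (act M b m)) \<and>
     (\<forall>m\<in>carrier M. act M 1 m = m) \<and>
     (\<forall>m\<in>carrier M. act M 0 m = base M)"

definition nilpotent :: "'a tmod \<Rightarrow> bool" where
  "nilpotent M \<longleftrightarrow> (\<exists>n. \<forall>m\<in>carrier M. act M (tgen ^ n) m = base M)"

definition fin_nil_tmodule :: "'a tmod \<Rightarrow> bool" where
  "fin_nil_tmodule M \<longleftrightarrow> tmodule M \<and> finite (carrier M) \<and> nilpotent M"

definition tmod_hom :: "'a tmod \<Rightarrow> 'b tmod \<Rightarrow> ('a \<Rightarrow> 'b) \<Rightarrow> bool" where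
  "tmod_hom M N f \<longleftrightarrow>
     f ` carrier M \<subseteq> carrier N \<and> f (base M) = base N \<and>
     (\<forall>a. \<forall>m\<in>carrier M. f (act M a m) = act N a (f m))"

definition normal_hom :: "'a tmod \<Rightarrow> 'b tmod \<Rightarrow> ('a \<Rightarrow> 'b) \<Rightarrow> bool" where
  "normal_hom M N f \<longleftrightarrow>
     tmod_hom M N f \<and>
     (\<forall>n\<in>carrier N - {base N}. \<forall>x\<in>carrier M. \<forall>y\<in>carrier M. f x = n \<longrightarrow> f y = n \<longrightarrow> x = y)"

definition tmod_iso :: "'a tmod \<Rightarrow> 'b tmod \<Rightarrow> bool" where
  "tmod_iso M N \<longleftrightarrow>
     (\<exists>f g. normal_hom M N f \<and> normal_hom N M g \<and>
        (\<forall>m\<in>carrier M. g (f m) = m) \<and> (\<forall>n\<in>carrier N. f (g n) = n))"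

definition submodule :: "'a tmod \<Rightarrow> 'a set \<Rightarrow> bool" where
  "submodule M N \<longleftrightarrow>
     N \<subseteq> carrier M \<and> base M \<in> N \<and> (\<forall>a. \<forall>n\<in>N. act M a n \<in> N)"

definition restrict_tmod :: "'a tmod \<Rightarrow> 'a set \<Rightarrow> 'a tmod" where
  "restrict_tmod M N = M\<lparr>carrier := N\<rparr>"

definition quotient_tmod :: "'a tmod \<Rightarrow> 'a set \<Rightarrow> 'a tmod" where
  "quotient_tmod M N =
     \<lparr>carrier = (carrier M - N) \<union> {base M}, base = base M,
      act = (\<lambda>a m. if act M a m \<in> N then base M else act M a m)\<rparr>"

text \<open>The wedge sum; the common base point is \<open>Inl (base M)\<close>.\<close>

definition wedge_tmod :: "'a tmod \<Rightarrow> 'b tmod \<Rightarrow> ('a + 'b) tmod" where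
  "wedge_tmod M N =
     \<lparr>carrier = Inl ` carrier M \<union> Inr ` (carrier N - {base N}), base = Inl (base M),
      act = (\<lambda>a s. case s of
          Inl m \<Rightarrow> Inl (act M a m)
        | Inr n \<Rightarrow> if act N a n = base N then Inl (base M) else Inr (act N a n))\<rparr>"

definition zero_tmod :: "nat tmod" where
  "zero_tmod = \<lparr>carrier = {0}, base = 0, act = (\<lambda>_ _. 0)\<rparr>"

text \<open>
  Every finite module is isomorphic to one with carrier in \<open>nat\<close>, so that the isomorphism class of
  a finite module (on any type) is represented by the set of its isomorphic copies on \<open>nat\<close>.
\<close>

definition tmod_copies :: "'a tmod \<Rightarrow> nat tmod set" where
  "tmod_copies M = {M'. tmodule M' \<and> tmod_iso M M'}"

typedef tmod_class = "{tmod_copies M | M :: nat tmod. fin_nil_tmodule M}"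
  morphisms copies_of_tmod_class Abs_tmod_class
proof -
  have "fin_nil_tmodule zero_tmod"
    by (simp add: fin_nil_tmodule_def tmodule_def nilpotent_def zero_tmod_def)
  then show ?thesis
    by blast
qed

definition tmod_class :: "'a tmod \<Rightarrow> tmod_class" where
  "tmod_class M = Abs_tmod_class (tmod_copies M)"

definition tmod_rep :: "tmod_class \<Rightarrow> nat tmod" where
  "tmod_rep c = (SOME M. M \<in> copies_of_tmod_class c)"


section \<open>The Hall algebra\<close>

definition hall_mul :: "(tmod_class \<Rightarrow> rat) \<Rightarrow> (tmod_class \<Rightarrow> rat) \<Rightarrow> (tmod_class \<Rightarrow> rat)" where
  "hall_mul f g = (\<lambda>c. let M = tmod_rep c in
     \<Sum>N | submodule M N. f (tmod_class (quotient_tmod M N)) * g (tmod_class (restrict_tmod M N)))"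

definition hall_comul :: "(tmod_class \<Rightarrow> rat) \<Rightarrow> (tmod_class \<times> tmod_class \<Rightarrow> rat)" where
  "hall_comul f = (\<lambda>(c, d). f (tmod_class (wedge_tmod (tmod_rep c) (tmod_rep d))))"

definition hall_algebra :: "tmod_class bialgebra_data" where
  "hall_algebra =
     \<lparr>space = {f. finite {c. f c \<noteq> 0}},
      mul = hall_mul,
      unit = (\<lambda>c. if c = tmod_class zero_tmod then 1 else 0),
      comul = hall_comul,
      counit = (\<lambda>f. f (tmod_class zero_tmod))\<rparr>"


section \<open>Rooted trees\<close>

text \<open>Edges are oriented towards the root: \<open>(v, w) \<in> edges T\<close> means that \<open>w\<close> is the parent of \<open>v\<close>.\<close>

record 'v tree =
  verts :: "'v set"
  edges :: "('v \<times> 'v) set"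
  root_vertex :: 'v

definition rooted_tree :: "'v tree \<Rightarrow> bool" where
  "rooted_tree T \<longleftrightarrow>
     finite (verts T) \<and> root_vertex T \<in> verts T \<and> edges T \<subseteq> verts T \<times> verts T \<and>
     (\<forall>w. (root_vertex T, w) \<notin> edges T) \<and>
     (\<forall>v\<in>verts T - {root_vertex T}. \<exists>!w. (v, w) \<in> edges T) \<and>
     (\<forall>v\<in>verts T. (v, root_vertex T) \<in> (edges T)\<^sup>*)"

definition tree_iso :: "'v tree \<Rightarrow> 'w tree \<Rightarrow> bool" where
  "tree_iso S T \<longleftrightarrow>
     (\<exists>f. bij_betw f (verts S) (verts T) \<and> f (root_vertex S) = root_vertex T \<and>
        (\<forall>u\<in>verts S. \<forall>v\<in>verts S. (u, v) \<in> edges S \<longleftrightarrow> (f u, f v) \<in> edges T))"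

definition leaf :: "'v tree \<Rightarrow> 'v \<Rightarrow> bool" where
  "leaf T v \<longleftrightarrow> v \<in> verts T \<and> (\<forall>u. (u, v) \<notin> edges T)"

definition leaf_root_path :: "'v tree \<Rightarrow> 'v list \<Rightarrow> bool" where
  "leaf_root_path T vs \<longleftrightarrow>
     vs \<noteq> [] \<and> leaf T (hd vs) \<and> last vs = root_vertex T \<and> successively (\<lambda>u v. (u, v) \<in> edges T) vs"

definition path_edges :: "'v list \<Rightarrow> ('v \<times> 'v) set" where
  "path_edges vs = set (zip vs (tl vs))"

definition admissible_cut :: "'v tree \<Rightarrow> ('v \<times> 'v) set \<Rightarrow> bool" where
  "admissible_cut T C \<longleftrightarrow>
     C \<noteq> {} \<and> C \<subseteq> edges T \<and> (\<forall>vs. leaf_root_path T vs \<longrightarrow> card (path_edges vs \<inter> C) \<le> 1)"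

text \<open>Vertex set of the connected component of \<open>v\<close> after removal of the edges in \<open>C\<close>.\<close>

definition component :: "'v tree \<Rightarrow> ('v \<times> 'v) set \<Rightarrow> 'v \<Rightarrow> 'v set" where
  "component T C v = {w \<in> verts T. (v, w) \<in> ((edges T - C) \<union> (edges T - C)\<inverse>)\<^sup>*}"

definition root_distance :: "'v tree \<Rightarrow> 'v \<Rightarrow> nat" where
  "root_distance T v = (LEAST n. (v, root_vertex T) \<in> edges T ^^ n)"

definition component_tree :: "'v tree \<Rightarrow> ('v \<times> 'v) set \<Rightarrow> 'v set \<Rightarrow> 'v tree" where
  "component_tree T C K =
     \<lparr>verts = K, edges = (edges T - C) \<inter> K \<times> K, root_vertex = arg_min_on (root_distance T) K\<rparr>"

definition tree_copies :: "'v tree \<Rightarrow> nat tree set" where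
  "tree_copies T = {T'. rooted_tree T' \<and> tree_iso T T'}"

typedef tree_class = "{tree_copies T | T :: nat tree. rooted_tree T}"
  morphisms copies_of_tree_class Abs_tree_class
proof -
  have "rooted_tree \<lparr>verts = {0::nat}, edges = {}, root_vertex = 0\<rparr>"
    by (simp add: rooted_tree_def)
  then show ?thesis
    by blast
qed

definition tree_class :: "'v tree \<Rightarrow> tree_class" where
  "tree_class T = Abs_tree_class (tree_copies T)"

definition tree_rep :: "tree_class \<Rightarrow> nat tree" where
  "tree_rep c = (SOME T. T \<in> copies_of_tree_class c)"

type_synonym forest = "tree_class multiset"

definition cut_root :: "'v tree \<Rightarrow> ('v \<times> 'v) set \<Rightarrow> tree_class" where
  "cut_root T C = tree_class (component_tree T C (component T C (root_vertex T)))"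

definition cut_pruned :: "'v tree \<Rightarrow> ('v \<times> 'v) set \<Rightarrow> forest" where
  "cut_pruned T C =
     image_mset (\<lambda>K. tree_class (component_tree T C K))
       (mset_set (component T C ` verts T - {component T C (root_vertex T)}))"


section \<open>Kreimer's Hopf algebra and its graded dual\<close>

text \<open>
  The polynomial algebra on the isomorphism classes of trees is the monoid algebra of the free
  commutative monoid of forests. Likewise, its tensor square is the monoid algebra of pairs of
  forests, \<open>F \<otimes> G\<close> being \<open>Poly_Mapping.single (F, G) 1\<close>.
\<close>

type_synonym kreimer = "forest \<Rightarrow>\<^sub>0 rat"

definition tree_comul :: "tree_class \<Rightarrow> (forest \<times> forest \<Rightarrow>\<^sub>0 rat)" where
  "tree_comul c = (let T = tree_rep c in
     Poly_Mapping.single ({#c#}, {#}) 1 + Poly_Mapping.single ({#}, {#c#}) 1 +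
     (\<Sum>C | admissible_cut T C. Poly_Mapping.single (cut_pruned T C, {#cut_root T C#}) 1))"

definition kreimer_comul :: "kreimer \<Rightarrow> (forest \<times> forest \<Rightarrow>\<^sub>0 rat)" where
  "kreimer_comul x =
     (\<Sum>F\<in>Poly_Mapping.keys x.
        Poly_Mapping.single 0 (Poly_Mapping.lookup x F) * (\<Prod>c\<in>#F. tree_comul c))"

definition kreimer_counit :: "kreimer \<Rightarrow> rat" where
  "kreimer_counit x = Poly_Mapping.lookup x {#}"

definition forest_size :: "forest \<Rightarrow> nat" where
  "forest_size F = (\<Sum>c\<in>#F. card (verts (tree_rep c)))"

definition kreimer_component :: "nat \<Rightarrow> kreimer set" where
  "kreimer_component n = {x. \<forall>F\<in>Poly_Mapping.keys x. forest_size F = n}"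

text \<open>
  A sum of functionals on the homogeneous components is a linear functional on the whole algebra
  that vanishes on all but finitely many homogeneous components.
\<close>

definition kreimer_graded_dual :: "(kreimer \<Rightarrow> rat) set" where
  "kreimer_graded_dual =
     {\<alpha>. (\<forall>x y. \<alpha> (x + y) = \<alpha> x + \<alpha> y) \<and>
         (\<forall>c x. \<alpha> (Poly_Mapping.single 0 c * x) = c * \<alpha> x) \<and>
         finite {n. \<exists>x\<in>kreimer_component n. \<alpha> x \<noteq> 0}}"

text \<open>
  The pairing of functionals \<open>\<alpha> \<otimes> \<beta>\<close> with an element of the tensor square, such that
  \<open>(\<alpha> \<otimes> \<beta>) (x \<otimes> y) = \<alpha> x * \<beta> y\<close>.
\<close>

definition tensor_pairing ::
  "(kreimer \<Rightarrow> rat) \<Rightarrow> (kreimer \<Rightarrow> rat) \<Rightarrow> (forest \<times> forest \<Rightarrow>\<^sub>0 rat) \<Rightarrow> rat" where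
  "tensor_pairing \<alpha> \<beta> u =
     (\<Sum>(F, G)\<in>Poly_Mapping.keys u. Poly_Mapping.lookup u (F, G) *
        \<alpha> (Poly_Mapping.single F 1) * \<beta> (Poly_Mapping.single G 1))"

definition kreimer_dual :: "kreimer bialgebra_data" where
  "kreimer_dual =
     \<lparr>space = kreimer_graded_dual,
      mul = (\<lambda>\<alpha> \<beta> x. tensor_pairing \<alpha> \<beta> (kreimer_comul x)),
      unit = kreimer_counit,
      comul = (\<lambda>\<alpha> (x, y). \<alpha> (x * y)),
      counit = (\<lambda>\<alpha>. \<alpha> 1)\<rparr>"

end

theory Submission
  imports Defs
begin

text \<open>
  A finite nilpotent module is a rooted forest: the vertices are the elements other than the base
  point, and \<open>t\<close> maps a vertex to its parent, or to the base point if the vertex is a root. Nilpotency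
  says that there are no cycles. In this dictionary a direct sum is a disjoint union, a submodule is a
  set \<open>U\<close> of vertices that is closed under parents, and the quotient by it is the forest on the
  complement of \<open>U\<close>. If the forest is a single tree, then the sets \<open>U\<close> other than the empty set and the set of all
  vertices correspond to the admissible cuts: cutting the edges that lead into \<open>U\<close> leaves \<open>U\<close> as the
  component of the root, and the complement of \<open>U\<close> as the pruned forest. Hence Kreimer's coproduct of a
  forest is the sum, over all \<open>U\<close>, of the complement of \<open>U\<close> tensor \<open>U\<close>. The dual product is the Hall
  product, the dual of the disjoint union is the coproduct of the Hall algebra, and the isomorphism
  sends a functional \<open>\<alpha>\<close> to the function whose value at a module is the value of \<open>\<alpha>\<close> at its forest.
  Symmetry factors do not arise, because a functional is described by its values on the basis of
  forests.

  Both Hopf algebras are thus the graded dual of one object, the monoid of forests with the coproduct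
  \<open>forest_cop\<close>, once seen as functionals on the algebra of forests and once as functions on the set of
  classes of modules. The locale \<open>graded_bialgebra\<close> collects the combinatorial laws (coassociativity,
  multiplicativity, grading), and the locale \<open>dual_realisation\<close> describes what both function spaces have
  in common. From this alone it follows that a realisation is a Hopf algebra (\<open>hopf_algebra_H\<close>) and
  that two realisations are isomorphic (\<open>hopf_isomorphic_realisations\<close>). The antipode comes from a
  recursion on the degree, which also shows that isomorphisms are compatible with antipodes.

  The combinatorial part is done with graphs \<open>(V, E)\<close> instead of isomorphism classes. Two graphs have
  the same forest if and only if they are isomorphic (\<open>forest_of_iso\<close>, \<open>graph_iso_if_forest_of_eq\<close>), so the
  laws of \<open>forest_cop\<close> can be read off from parent-closed subsets of a graph. The two applications are
  \<open>kreimer_dual_realisation\<close>, which rests on the bijection \<open>bij_cut_of\<close> between subsets and cuts, and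
  \<open>hall_algebra_realisation\<close>, which rests on \<open>mod_forest_eq_iff\<close> and on the bijection
  \<open>bij_submodules_upsets\<close>.
\<close>

section \<open>Linear maps on tensor products\<close>

lemma tensor_space_sum_list:
  assumes V: "fun_space.subspace V" and W: "fun_space.subspace W"
    and u: "u \<in> tensor_space V W"
  obtains ps where "set ps \<subseteq> V \<times> W" "u = (\<Sum>(a, b)\<leftarrow>ps. a \<otimes> b)"
proof -
  have "\<exists>ps. set ps \<subseteq> V \<times> W \<and> u = (\<Sum>(a, b)\<leftarrow>ps. a \<otimes> b)"
    using u unfolding tensor_space_def
  proof (induction rule: fun_space.span_induct_alt)
    case base
    show ?case
      by (rule exI [of _ "[]"]) simp
  next
    case (step c x y)
    obtain a b where ab: "x = a \<otimes> b" "a \<in> V" "b \<in> W"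
      using step.hyps by blast
    obtain ps where ps: "set ps \<subseteq> V \<times> W" "y = (\<Sum>(a, b)\<leftarrow>ps. a \<otimes> b)"
      using step.IH by blast
    have "fscale c x = fscale c a \<otimes> b"
      by (auto simp: ab fscale_def tensor_def fun_eq_iff)
    then show ?case
      using ab ps fun_space.subspace_scale [OF V \<open>a \<in> V\<close>]
      by (intro exI [of _ "(fscale c a, b) # ps"]) auto
  qed
  then show ?thesis
    using that by blast
qed

lemma linear_onD:
  assumes "linear_on V scale f"
  shows "a \<in> V \<Longrightarrow> b \<in> V \<Longrightarrow> f (a + b) = f a + f b" "a \<in> V \<Longrightarrow> f (fscale c a) = scale c (f a)"
  using assms by (auto simp: linear_on_def)

lemma linear_on_sum:
  assumes sc: "vector_space scale" and V: "fun_space.subspace V" and f: "linear_on V scale f"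
    and F: "\<And>p. p \<in> P \<Longrightarrow> F p \<in> V"
  shows "f (\<Sum>p\<in>P. F p) = (\<Sum>p\<in>P. f (F p))"
  using F
proof (induction P rule: infinite_finite_induct)
  case (insert p P)
  then have "(\<Sum>p\<in>P. F p) \<in> V"
    by (intro fun_space.subspace_sum [OF V]) auto
  then have "f (F p + (\<Sum>p\<in>P. F p)) = f (F p) + (\<Sum>p\<in>P. f (F p))"
    using insert by (subst linear_onD(1) [OF f]) auto
  then show ?case
    unfolding sum.insert [OF insert(1,2)] .
qed (use linear_on_zero [OF sc V f] in simp_all)

lemma fscale_apply: "fscale c f x = c * f x"
  by (simp add: fscale_def)

lemma sum_apply: "(\<Sum>p\<in>P. F p) x = (\<Sum>p\<in>P. F p x)"
  by (induction P rule: infinite_finite_induct) auto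

text \<open>
  The lift of a bilinear map is defined through a decomposition of the tensor into pure tensors. If the
  bilinear map is a formula \<open>K\<close> in the values of \<open>a \<otimes> b\<close>, and \<open>K\<close> makes sense and is linear for all
  functions of two variables, then no decomposition is needed: the lift is \<open>K\<close>. The lifts in
  the bialgebra axioms have this form, so the axioms become identities between explicit sums.
\<close>

lemma tensor_lift_linear:
  fixes K :: "('x \<times> 'y \<Rightarrow> rat) \<Rightarrow> ('z \<Rightarrow> rat)"
  assumes V: "fun_space.subspace V" and W: "fun_space.subspace W"
    and K: "linear_on UNIV fscale K"
    and B: "\<And>a b. a \<in> V \<Longrightarrow> b \<in> W \<Longrightarrow> B a b = K (a \<otimes> b)"
    and u: "u \<in> tensor_space V W"
  shows "tensor_lift V W B u = K u"
proof -
  have K_add: "K (u + v) = K u + K v" and K_scale: "K (fscale c u) = fscale c (K u)" for u v c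
    using K by (auto simp: linear_on_def)
  obtain ps where ps: "set ps \<subseteq> V \<times> W" "u = (\<Sum>(a, b)\<leftarrow>ps. a \<otimes> b)"
    using tensor_space_sum_list [OF V W u] .
  have sc: "vector_space (fscale :: rat \<Rightarrow> ('z \<Rightarrow> rat) \<Rightarrow> _)"
    by (rule fun_space.vector_space_axioms)
  have tensor_simps: "(a + a') \<otimes> b = a \<otimes> b + a' \<otimes> b" "fscale c a \<otimes> b = fscale c (a \<otimes> b)"
    "a \<otimes> (b + b') = a \<otimes> b + a \<otimes> b'" "a \<otimes> fscale c b = fscale c (a \<otimes> b)"
    for a a' :: "'x \<Rightarrow> rat" and b b' :: "'y \<Rightarrow> rat" and c
    by (auto simp: tensor_def fscale_def fun_eq_iff algebra_simps)
  note closed = fun_space.subspace_add [OF V] fun_space.subspace_scale [OF V]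
    fun_space.subspace_add [OF W] fun_space.subspace_scale [OF W]
  have "linear_on V fscale (\<lambda>a. B a b)" if "b \<in> W" for b
    unfolding linear_on_def using that 
    by (intro conjI ballI allI) (simp_all only: B closed tensor_simps K_add K_scale)
  moreover have "linear_on W fscale (\<lambda>b. B a b)" if "a \<in> V" for a
    unfolding linear_on_def using that 
    by (intro conjI ballI allI) (simp_all only: B closed tensor_simps K_add K_scale)
  ultimately have "tensor_lift V W B u = (\<Sum>(a, b)\<leftarrow>ps. B a b)"
    unfolding ps(2) by (intro tensor_lift_sum_list [OF V W sc _ _ ps(1)]) auto
  also have "\<dots> = (\<Sum>p\<leftarrow>ps. K (fst p \<otimes> snd p))"
    using ps(1) B by (intro arg_cong [where f = sum_list] map_cong) auto
  also have "\<dots> = K u"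
    using linear_on_sum_list [OF sc fun_space.subspace_UNIV K, of ps "\<lambda>p. fst p \<otimes> snd p"]
    by (simp add: ps(2) case_prod_unfold)
  finally show ?thesis .
qed

section \<open>Linear extension to a monoid algebra\<close>

definition linext :: "('x \<Rightarrow> rat) \<Rightarrow> ('x \<Rightarrow>\<^sub>0 rat) \<Rightarrow> rat" where
  "linext f u = (\<Sum>x\<in>Poly_Mapping.keys u. Poly_Mapping.lookup u x * f x)"

lemma linext_superset:
  "finite A \<Longrightarrow> Poly_Mapping.keys u \<subseteq> A \<Longrightarrow> linext f u = (\<Sum>x\<in>A. Poly_Mapping.lookup u x * f x)"
  unfolding linext_def by (intro sum.mono_neutral_left) (auto simp: in_keys_iff)

lemma linext_single [simp]: "linext f (Poly_Mapping.single x c) = c * f x"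
  using linext_superset [of "{x}" "Poly_Mapping.single x c" f] by simp

lemma linext_zero [simp]: "linext f 0 = 0"
  by (simp add: linext_def)

lemma linext_add: "linext f (u + v) = linext f u + linext f v"
  using linext_superset [of "Poly_Mapping.keys u \<union> Poly_Mapping.keys v" _ f]
    Poly_Mapping.keys_add [of u v]
  by (simp add: lookup_add algebra_simps sum.distrib)

lemma linext_sum: "linext f (\<Sum>p\<in>P. F p) = (\<Sum>p\<in>P. linext f (F p))"
  by (induction P rule: infinite_finite_induct) (auto simp: linext_add)

lemma linext_sum_mset: "linext f (\<Sum>p\<in>#P. F p) = (\<Sum>p\<in>#P. linext f (F p))"
  by (induction P) (auto simp: linext_add)

lemma linext_plus_fun: "linext (\<lambda>x. f x + g x) u = linext f u + linext g u"
  by (simp add: linext_def sum.distrib algebra_simps)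

lemma linext_scale_fun: "linext (\<lambda>x. c * f x) u = c * linext f u"
  by (simp add: linext_def sum_distrib_left mult.left_commute)

lemma linext_scale_fun_right: "linext (\<lambda>x. f x * c) u = linext f u * c"
  by (simp add: linext_def sum_distrib_right mult.assoc)

lemma linext_swap: "linext (\<lambda>x. linext (\<lambda>y. h x y) v) u = linext (\<lambda>y. linext (\<lambda>x. h x y) u) v"
  unfolding linext_def sum_distrib_left
  by (subst sum.swap) (auto intro!: sum.cong simp: algebra_simps)

lemma linext_mult_linext:
  "linext f u * linext g v = linext (\<lambda>x. linext (\<lambda>y. f x * g y) v) u"
  by (simp add: linext_scale_fun linext_scale_fun_right)

lemma linext_if_eq: "linext (\<lambda>x. if x = a then 1 else 0) u = Poly_Mapping.lookup u a"
  using linext_superset [of "insert a (Poly_Mapping.keys u)" u "\<lambda>x. if x = a then 1 else 0"]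
  by (auto simp: if_distrib sum.If_cases cong: if_cong)

lemma linext_one [simp]: "linext f 1 = f 0"
  using linext_single [of f 0 1] by simp

lemma poly_mapping_sum_single:
  fixes u :: "'x \<Rightarrow>\<^sub>0 rat"
  shows "u = (\<Sum>x\<in>Poly_Mapping.keys u. Poly_Mapping.single x (Poly_Mapping.lookup u x))"
  by (rule poly_mapping_eqI) (auto simp: lookup_sum lookup_single when_def in_keys_iff)

lemma linext_mult:
  fixes u v :: "'x::comm_monoid_add \<Rightarrow>\<^sub>0 rat"
  shows "linext f (u * v) = linext (\<lambda>x. linext (\<lambda>y. f (x + y)) v) u"
proof -
  have 1: "linext f (Poly_Mapping.single x c * v) = c * linext (\<lambda>y. f (x + y)) v" for x c
    by (subst poly_mapping_sum_single [of v])
      (simp add: sum_distrib_left mult_single linext_sum,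
        simp add: linext_def sum_distrib_left algebra_simps)
  show ?thesis
    by (subst poly_mapping_sum_single [of u])
      (simp add: sum_distrib_right linext_sum 1, simp add: linext_def)
qed

section \<open>Graded combinatorial bialgebras\<close>

lemma sum_mset_sum_mset: "(\<Sum>t\<in>#(\<Sum>p\<in>#M. F p). g t) = (\<Sum>p\<in>#M. \<Sum>t\<in>#F p. g t)"
  by (induction M) auto

lemma sum_mset_if: "(\<Sum>p\<in>#M. if P p then h p else 0) = (\<Sum>p\<in>#filter_mset P M. h p)"
  by (induction M) auto

lemma sum_mset_partition:
  "(\<Sum>p\<in>#M. h p) =
    (\<Sum>p\<in>#filter_mset P M. h p) + (\<Sum>p\<in>#filter_mset (\<lambda>p. \<not> P p) M. h p)"
  by (induction M) (auto simp: ac_simps)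

lemma sum_mset_times_sum_mset:
  fixes f :: "'p \<Rightarrow> 'r::comm_semiring_0"
  shows "(\<Sum>p\<in>#P. f p) * (\<Sum>q\<in>#Q. g q) = (\<Sum>p\<in>#P. \<Sum>q\<in>#Q. f p * g q)"
  by (subst sum_mset.swap) (simp add: sum_mset_distrib_left sum_mset_distrib_right)

lemma double_sum_mset_linear:
  fixes c :: "'r::comm_semiring_0" and w v v' :: "'p \<Rightarrow> 'q \<Rightarrow> 'r"
  shows "(\<Sum>p\<in>#P. \<Sum>q\<in>#Q. w p q * (v p q + v' p q)) =
      (\<Sum>p\<in>#P. \<Sum>q\<in>#Q. w p q * v p q) + (\<Sum>p\<in>#P. \<Sum>q\<in>#Q. w p q * v' p q)"
    and "(\<Sum>p\<in>#P. \<Sum>q\<in>#Q. (v p q + v' p q) * w p q) =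
      (\<Sum>p\<in>#P. \<Sum>q\<in>#Q. v p q * w p q) + (\<Sum>p\<in>#P. \<Sum>q\<in>#Q. v' p q * w p q)"
  by (simp_all add: distrib_left distrib_right sum_mset.distrib)

lemma double_sum_mset_scale:
  fixes c :: "'r::comm_semiring_0" and w v v' :: "'p \<Rightarrow> 'q \<Rightarrow> 'r"
  shows "(\<Sum>p\<in>#P. \<Sum>q\<in>#Q. w p q * (c * v p q)) = c * (\<Sum>p\<in>#P. \<Sum>q\<in>#Q. w p q * v p q)"
    and "(\<Sum>p\<in>#P. \<Sum>q\<in>#Q. (c * v p q) * w p q) = c * (\<Sum>p\<in>#P. \<Sum>q\<in>#Q. v p q * w p q)"
  unfolding sum_mset_distrib_left
  by (intro arg_cong [where f = sum_mset] image_mset_cong; simp add: ac_simps)+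

lemma sum_mset_nonzeroD:
  assumes "(\<Sum>p\<in>#M. f p) \<noteq> 0"
  shows "\<exists>p. p \<in># M \<and> f p \<noteq> 0"
  using assms
proof (induction M)
  case (add x M)
  then show ?case
    by (cases "f x = 0") auto
qed simp

text \<open>
  The monoid algebra of a graded commutative monoid, with a coproduct that is given on the monoid by
  sums of pairs: \<open>cop x\<close> is the multiset of the terms of the coproduct of \<open>x\<close>. Multisets are used because
  a sum over \<open>cop x\<close> makes sense in every commutative monoid; the antipode needs such sums with values
  in the monoid algebra itself.
\<close>

locale graded_bialgebra =
  fixes cop :: "'x::comm_monoid_add \<Rightarrow> ('x \<times> 'x) multiset" and deg :: "'x \<Rightarrow> nat"
  assumes cop_zero: "cop 0 = {#(0, 0)#}"
    and cop_add: "cop (x + y) = (\<Sum>p\<in>#cop x. image_mset (\<lambda>q. p + q) (cop y))"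
    and cop_counit_left: "filter_mset (\<lambda>p. fst p = 0) (cop x) = {#(0, x)#}"
    and cop_counit_right: "filter_mset (\<lambda>p. snd p = 0) (cop x) = {#(x, 0)#}"
    and cop_coassoc: "(\<Sum>p\<in>#cop x. image_mset (\<lambda>q. (fst q, snd q, snd p)) (cop (fst p))) =
          (\<Sum>p\<in>#cop x. image_mset (\<lambda>q. (fst p, fst q, snd q)) (cop (snd p)))"
    and deg_zero_iff: "deg x = 0 \<longleftrightarrow> x = 0"
    and deg_add: "deg (x + y) = deg x + deg y"
    and deg_cop: "p \<in># cop x \<Longrightarrow> deg (fst p) + deg (snd p) = deg x"
    and finite_deg: "finite {x. deg x = n}"
begin

definition conv :: "('x \<Rightarrow> 'r::comm_ring_1) \<Rightarrow> ('x \<Rightarrow> 'r) \<Rightarrow> ('x \<Rightarrow> 'r)" where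
  "conv f g x = (\<Sum>p\<in>#cop x. f (fst p) * g (snd p))"

definition delta :: "'x \<Rightarrow> 'r::comm_ring_1" where
  "delta x = (if x = 0 then 1 else 0)"

text \<open>
  Coassociativity, applied to the function that sends \<open>(a, b, c)\<close> to \<open>f a * g b * h c\<close>.
\<close>

lemma conv_assoc: "conv (conv f g) h = conv f (conv g h)"
proof
  fix x
  have "conv (conv f g) h x =
      (\<Sum>t\<in>#(\<Sum>p\<in>#cop x. image_mset (\<lambda>q. (fst q, snd q, snd p)) (cop (fst p))).
        f (fst t) * g (fst (snd t)) * h (snd (snd t)))"
    by (simp add: conv_def sum_mset_sum_mset sum_mset_distrib_right image_mset.compositionality o_def)
  also have "\<dots> = conv f (conv g h) x"
    unfolding cop_coassoc
    by (simp add: conv_def sum_mset_sum_mset sum_mset_distrib_left image_mset.compositionality o_def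
        mult.assoc)
  finally show "conv (conv f g) h x = conv f (conv g h) x" .
qed

lemma conv_delta_right [simp]: "conv f delta = f"
proof
  fix x
  have "conv f delta x = (\<Sum>p\<in>#cop x. if snd p = 0 then f (fst p) else 0)"
    unfolding conv_def delta_def by (intro arg_cong [where f = sum_mset] image_mset_cong) auto
  then show "conv f delta x = f x"
    by (simp add: sum_mset_if cop_counit_right)
qed

lemma conv_delta_left [simp]: "conv delta f = f"
proof
  fix x
  have "conv delta f x = (\<Sum>p\<in>#cop x. if fst p = 0 then f (snd p) else 0)"
    unfolding conv_def delta_def by (intro arg_cong [where f = sum_mset] image_mset_cong) auto
  then show "conv delta f x = f x"
    by (simp add: sum_mset_if cop_counit_left)
qed

lemma conv_add_args:
  "conv f g (x + y) = (\<Sum>p\<in>#cop x. \<Sum>q\<in>#cop y. f (fst p + fst q) * g (snd p + snd q))"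
  unfolding conv_def cop_add sum_mset_sum_mset image_mset.compositionality o_def by simp

lemma deg_recursion:
  assumes "\<And>A B x. (\<And>y. deg y < deg x \<Longrightarrow> A y = B y) \<Longrightarrow> F A x = F B x"
  shows "\<exists>A. \<forall>x. A x = F A x"
proof -
  have "adm_wf (measure deg) F"
    unfolding adm_wf_def by (intro allI impI assms) simp
  then have "wfrec (measure deg) F = F (wfrec (measure deg) F)"
    by (intro wfrec_fixpoint) simp_all
  then show ?thesis
    by (intro exI [of _ "wfrec (measure deg) F"] allI) (rule fun_cong)
qed

text \<open>
  The term \<open>(x, 0)\<close> occurs exactly once in \<open>cop x\<close>, so the required equation at \<open>x\<close> expresses \<open>A x\<close>
  by values of \<open>A\<close> in smaller degrees.
\<close>

lemma conv_left_inverse: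
  assumes "i 0 = 1"
  shows "\<exists>A. conv A i = delta"
proof -
  define F where "F A x = delta x - (\<Sum>p\<in>#filter_mset (\<lambda>p. snd p \<noteq> 0) (cop x). A (fst p) * i (snd p))"
    for A x
  have F_cong: "F A x = F B x" if "\<And>y. deg y < deg x \<Longrightarrow> A y = B y" for A B x
  proof -
    have "A (fst p) = B (fst p)" if "p \<in># cop x" "snd p \<noteq> 0" for p
      using deg_cop [OF that(1)] deg_zero_iff [of "snd p"] that(2)
      by (intro \<open>\<And>y. deg y < deg x \<Longrightarrow> A y = B y\<close>) auto
    then show ?thesis
      unfolding F_def
      by (intro arg_cong [where f = "\<lambda>s. delta x - sum_mset s"] image_mset_cong) auto
  qed
  obtain A where A: "\<And>x. A x = F A x"
    using deg_recursion [of F, OF F_cong] by auto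
  have "conv A i x = delta x" for x
  proof -
    have "conv A i x = (\<Sum>p\<in>#filter_mset (\<lambda>p. snd p = 0) (cop x). A (fst p) * i (snd p)) +
        (\<Sum>p\<in>#filter_mset (\<lambda>p. snd p \<noteq> 0) (cop x). A (fst p) * i (snd p))"
      unfolding conv_def by (rule sum_mset_partition)
    also have "\<dots> = delta x"
      unfolding cop_counit_right using A [of x] assms by (simp add: F_def)
    finally show ?thesis .
  qed
  then show ?thesis
    by blast
qed

text \<open>
  The left inverse has itself a left inverse, and by associativity that one is \<open>i\<close>.
\<close>

lemma conv_inverse:
  assumes "i 0 = 1"
  obtains A where "conv A i = delta" "conv i A = delta"
proof -
  obtain A where A: "conv A i = delta"
    using conv_left_inverse [of i] assms by auto
  have "A 0 = 1"
    using fun_cong [OF A, of 0] assms by (simp add: conv_def cop_zero delta_def)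
  then obtain B where B: "conv B A = delta"
    using conv_left_inverse [of A] by auto
  have "B = conv B (conv A i)"
    by (simp add: A)
  also have "\<dots> = i"
    unfolding conv_assoc [symmetric] by (simp add: B)
  finally show ?thesis
    using that [of A] A B by simp
qed

lemma finite_deg_le: "finite {x. deg x \<le> n}"
proof -
  have "{x. deg x \<le> n} = (\<Union>m\<le>n. {x. deg x = m})"
    by auto
  then show ?thesis
    using finite_deg by simp
qed

lemma finite_deg_bounded:
  fixes A :: "'x set"
  assumes "finite A"
  shows "\<exists>n. \<forall>x\<in>A. deg x \<le> n"
  using assms by (intro exI [of _ "Max (deg ` A)"]) simp

text \<open>
  Both summands have at most the degree of the sum, and there are only finitely many elements of
  bounded degree.
\<close>

lemma finite_sums:
  fixes A :: "'x set"
  assumes "finite A"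
  shows "finite {(p, q). p + q \<in> A}"
proof -
  obtain n where "\<forall>x\<in>A. deg x \<le> n"
    using finite_deg_bounded [OF assms] ..
  then have "{(p, q). p + q \<in> A} \<subseteq> {x. deg x \<le> n} \<times> {x. deg x \<le> n}"
    by (force simp: deg_add)
  then show ?thesis
    using finite_deg_le finite_subset by blast
qed

lemma finite_conv:
  fixes f g :: "'x \<Rightarrow> rat"
  assumes "finite {x. f x \<noteq> 0}" "finite {x. g x \<noteq> 0}"
  shows "finite {x. conv f g x \<noteq> 0}"
proof -
  obtain m where m: "\<forall>x\<in>{x. f x \<noteq> 0}. deg x \<le> m"
    using finite_deg_bounded [OF assms(1)] ..
  obtain n where n: "\<forall>x\<in>{x. g x \<noteq> 0}. deg x \<le> n"
    using finite_deg_bounded [OF assms(2)] ..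
  have "deg x \<le> m + n" if "conv f g x \<noteq> 0" for x
  proof -
    have "\<exists>p. p \<in># cop x \<and> f (fst p) * g (snd p) \<noteq> 0"
      using that unfolding conv_def by (rule sum_mset_nonzeroD)
    then obtain p where "p \<in># cop x" "f (fst p) * g (snd p) \<noteq> 0"
      by blast
    then show ?thesis
      using bspec [OF m, of "fst p"] bspec [OF n, of "snd p"] deg_cop [of p x] by simp
  qed
  then show ?thesis
    by (intro finite_subset [OF subsetI finite_deg_le [of "m + n"]]) simp
qed

end

section \<open>Realisations of the graded dual\<close>

text \<open>
  The graded dual of the monoid algebra is, in coordinates, the space of finitely supported functions
  on the monoid. Here it is realised by functions on some other type \<open>'y\<close>: the elements \<open>j x\<close> are the
  monoid elements, every \<open>y\<close> has coordinates \<open>co y\<close>, and a function belongs to the space if it is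
  computed from its values on the \<open>j x\<close> by linear extension. This covers functionals on an algebra,
  where \<open>'y\<close> is the algebra, and functions on a set of isomorphism classes, where \<open>j\<close> is a bijection.
  The product is dual to \<open>cop\<close> and the coproduct is dual to the addition of the monoid.
\<close>

locale dual_realisation = graded_bialgebra cop deg
  for cop :: "'x::comm_monoid_add \<Rightarrow> ('x \<times> 'x) multiset" and deg :: "'x \<Rightarrow> nat" +
  fixes H :: "'y bialgebra_data" and j :: "'x \<Rightarrow> 'y" and co :: "'y \<Rightarrow> ('x \<Rightarrow>\<^sub>0 rat)"
  assumes co_j: "co (j x) = Poly_Mapping.single x 1"
    and space_H: "space H = {a. (\<forall>y. a y = linext (a \<circ> j) (co y)) \<and> finite {x. a (j x) \<noteq> 0}}"
    and mul_H: "a \<in> space H \<Longrightarrow> b \<in> space H \<Longrightarrow>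
          mul H a b = (\<lambda>y. linext (conv (a \<circ> j) (b \<circ> j)) (co y))"
    and unit_H: "unit H = (\<lambda>y. linext delta (co y))"
    and comul_H: "a \<in> space H \<Longrightarrow> comul H a =
          (\<lambda>(y, z). linext (\<lambda>x. linext (\<lambda>x'. a (j (x + x'))) (co z)) (co y))"
    and counit_H: "counit H a = a (j 0)"
begin

definition extend :: "('x \<Rightarrow> rat) \<Rightarrow> ('y \<Rightarrow> rat)" where
  "extend f = (\<lambda>y. linext f (co y))"

lemma extend_j [simp]: "extend f (j x) = f x"
  by (simp add: extend_def co_j)

lemma extend_comp_j [simp]: "extend f \<circ> j = f"
  by (simp add: fun_eq_iff)

lemma space_expand: "a \<in> space H \<Longrightarrow> a y = linext (\<lambda>x. a (j x)) (co y)"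
  unfolding space_H o_def by blast

lemma space_finite: "a \<in> space H \<Longrightarrow> finite {x. a (j x) \<noteq> 0}"
  unfolding space_H by blast

lemma space_memI:
  assumes "\<And>y. a y = linext (\<lambda>x. a (j x)) (co y)" "finite {x. a (j x) \<noteq> 0}"
  shows "a \<in> space H"
  using assms unfolding space_H o_def by blast

lemma extend_in_space: "finite {x. f x \<noteq> 0} \<Longrightarrow> extend f \<in> space H"
  by (intro space_memI) (simp_all, simp add: extend_def)

lemma space_eqI:
  assumes "a \<in> space H" "b \<in> space H" "\<And>x. a (j x) = b (j x)"
  shows "a = b"
proof
  fix y
  show "a y = b y"
    using assms by (simp add: space_expand [of a y] space_expand [of b y])
qed

lemma subspace_H: "fun_space.subspace (space H)"
proof (rule fun_space.subspaceI)
  show "0 \<in> space H"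
    by (intro space_memI) (simp_all add: linext_def)
next
  fix a b
  assume ab: "a \<in> space H" "b \<in> space H"
  have "finite {x. (a + b) (j x) \<noteq> 0}"
    by (rule finite_subset [OF _ finite_UnI [OF ab [THEN space_finite]]]) auto
  then show "a + b \<in> space H"
    by (intro space_memI)
      (simp_all add: linext_plus_fun space_expand [OF ab(1), symmetric] space_expand [OF ab(2), symmetric])
next
  fix c a
  assume a: "a \<in> space H"
  have "finite {x. fscale c a (j x) \<noteq> 0}"
    by (rule finite_subset [OF _ space_finite [OF a]]) (auto simp: fscale_def)
  then show "fscale c a \<in> space H"
    by (intro space_memI)
      (simp_all add: fscale_def linext_scale_fun space_expand [OF a, symmetric])
qed

definition basis_fun :: "'x \<Rightarrow> 'y \<Rightarrow> rat" where
  "basis_fun x = extend (\<lambda>x'. if x' = x then 1 else 0)"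

lemma basis_fun_j [simp]: "basis_fun x (j x') = (if x' = x then 1 else 0)"
  by (simp add: basis_fun_def)

lemma basis_fun_in_space [simp]: "basis_fun x \<in> space H"
  unfolding basis_fun_def by (intro extend_in_space) simp

lemma space_eq_sum_basis:
  assumes a: "a \<in> space H"
  shows "a = (\<Sum>x | a (j x) \<noteq> 0. fscale (a (j x)) (basis_fun x))"
proof (rule space_eqI [OF a])
  show "(\<Sum>x | a (j x) \<noteq> 0. fscale (a (j x)) (basis_fun x)) \<in> space H"
    by (intro fun_space.subspace_sum [OF subspace_H] fun_space.subspace_scale [OF subspace_H]) simp
  fix x
  have "(\<Sum>x | a (j x) \<noteq> 0. fscale (a (j x)) (basis_fun x)) (j x) =
      (\<Sum>x' | a (j x') \<noteq> 0. if x' = x then a (j x) else 0)"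
    by (simp add: sum_apply fscale_apply) (intro sum.cong, auto)
  then show "a (j x) = (\<Sum>x | a (j x) \<noteq> 0. fscale (a (j x)) (basis_fun x)) (j x)"
    using space_finite [OF a] by (simp add: sum.delta)
qed

lemma linear_on_space_eqI:
  assumes "linear_on (space H) fscale f" "linear_on (space H) fscale g"
    and "\<And>x. f (basis_fun x) = g (basis_fun x)" and a: "a \<in> space H"
  shows "f a = g a"
proof -
  have *: "f a = (\<Sum>x | a (j x) \<noteq> 0. fscale (a (j x)) (f (basis_fun x)))"
    if "linear_on (space H) fscale f" for f :: "_ \<Rightarrow> 'z \<Rightarrow> rat"
  proof -
    have "f a = f (\<Sum>x | a (j x) \<noteq> 0. fscale (a (j x)) (basis_fun x))"
      using space_eq_sum_basis [OF a] by simp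
    also have "\<dots> = (\<Sum>x | a (j x) \<noteq> 0. f (fscale (a (j x)) (basis_fun x)))"
      by (intro linear_on_sum [OF fun_space.vector_space_axioms subspace_H that]
          fun_space.subspace_scale [OF subspace_H]) simp
    also have "\<dots> = (\<Sum>x | a (j x) \<noteq> 0. fscale (a (j x)) (f (basis_fun x)))"
      by (intro sum.cong) (simp_all add: linear_onD(2) [OF that])
    finally show ?thesis .
  qed
  show ?thesis
    unfolding * [OF assms(1)] * [OF assms(2)] assms(3) ..
qed

abbreviation (input) "tensor_square \<equiv> tensor_space (space H) (space H)"

text \<open>
  In both variables the values are determined by linear extension, because this holds for pure
  tensors.
\<close>

lemma tensor_expand:
  assumes "u \<in> tensor_square"
  shows "u (y, z) = linext (\<lambda>x. linext (\<lambda>x'. u (j x, j x')) (co z)) (co y)"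
proof -
  obtain ps where ps: "set ps \<subseteq> space H \<times> space H" "u = (\<Sum>(a, b)\<leftarrow>ps. a \<otimes> b)"
    using tensor_space_sum_list [OF subspace_H subspace_H assms] .
  show ?thesis
    using ps(1) unfolding ps(2)
  proof (induction ps)
    case (Cons p ps)
    obtain a b where p: "p = (a, b)" "a \<in> space H" "b \<in> space H"
      using Cons.prems by (cases p) auto
    have "(a \<otimes> b) (y, z) = linext (\<lambda>x. linext (\<lambda>x'. (a \<otimes> b) (j x, j x')) (co z)) (co y)"
      by (simp add: tensor_def linext_mult_linext [symmetric]
          space_expand [OF p(2), of y] space_expand [OF p(3), of z])
    with Cons show ?case
      by (simp add: p linext_plus_fun)
  qed (simp add: linext_def)
qed

lemma tensor_eqI:
  assumes "u \<in> tensor_square" "v \<in> tensor_square" "\<And>x x'. u (j x, j x') = v (j x, j x')"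
  shows "u = v"
proof
  fix p
  show "u p = v p"
    using tensor_expand [OF assms(1), of "fst p" "snd p"] tensor_expand [OF assms(2), of "fst p" "snd p"]
    unfolding assms(3) by simp
qed

lemma tensor_in: "a \<in> space H \<Longrightarrow> b \<in> space H \<Longrightarrow> a \<otimes> b \<in> tensor_square"
  unfolding tensor_space_def by (intro fun_space.span_base) blast

lemma subspace_tensor_square: "fun_space.subspace tensor_square"
  unfolding tensor_space_def by (rule fun_space.subspace_span)

lemma comul_j: "a \<in> space H \<Longrightarrow> comul H a (j x, j x') = a (j (x + x'))"
  by (simp add: comul_H co_j)

lemma comul_eqI:
  assumes a: "a \<in> space H" and u: "u \<in> tensor_square" and "\<And>x x'. u (j x, j x') = a (j (x + x'))"
  shows "comul H a = u"
proof
  fix yz :: "'y \<times> 'y"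
  show "comul H a yz = u yz"
    using tensor_expand [OF u, of "fst yz" "snd yz"] unfolding assms(3)
    by (simp add: comul_H [OF a] case_prod_unfold)
qed

text \<open>
  The sum is finite by \<open>finite_sums\<close>; this is why the coproduct takes values in the tensor square
  and not only among the functions of two variables.
\<close>

lemma comul_eq_sum_basis:
  assumes a: "a \<in> space H"
  shows "comul H a = (\<Sum>p | a (j (fst p + snd p)) \<noteq> 0.
    fscale (a (j (fst p + snd p))) (basis_fun (fst p) \<otimes> basis_fun (snd p)))" (is "_ = ?r")
proof (rule comul_eqI [OF a])
  show "?r \<in> tensor_square"
    by (intro fun_space.subspace_sum [OF subspace_tensor_square] fun_space.subspace_scale [OF subspace_tensor_square]
        tensor_in basis_fun_in_space)
next
  fix x x'
  have fin: "finite {p. a (j (fst p + snd p)) \<noteq> 0}"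
    using finite_sums [OF space_finite [OF a]] by (simp add: case_prod_unfold)
  have "?r (j x, j x') =
      (\<Sum>p | a (j (fst p + snd p)) \<noteq> 0. if p = (x, x') then a (j (x + x')) else 0)"
    unfolding sum_apply by (intro sum.cong refl) (auto simp: fscale_apply tensor_def)
  also have "\<dots> = a (j (x + x'))"
    using fin by (simp add: sum.delta)
  finally show "?r (j x, j x') = a (j (x + x'))" .
qed

lemma comul_in:
  assumes "a \<in> space H"
  shows "comul H a \<in> tensor_square"
  unfolding comul_eq_sum_basis [OF assms]
  by (intro fun_space.subspace_sum [OF subspace_tensor_square] fun_space.subspace_scale [OF subspace_tensor_square]
        tensor_in basis_fun_in_space)

lemmas lift_linear = tensor_lift_linear [OF subspace_H subspace_H]

lemma mul_j: "a \<in> space H \<Longrightarrow> b \<in> space H \<Longrightarrow>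
    mul H a b (j x) = (\<Sum>p\<in>#cop x. a (j (fst p)) * b (j (snd p)))"
  by (simp add: mul_H co_j conv_def)

lemma mul_comp_j: "a \<in> space H \<Longrightarrow> b \<in> space H \<Longrightarrow> mul H a b \<circ> j = conv (a \<circ> j) (b \<circ> j)"
  by (simp add: fun_eq_iff mul_H co_j)

lemma mul_extend: "a \<in> space H \<Longrightarrow> b \<in> space H \<Longrightarrow> mul H a b = extend (conv (a \<circ> j) (b \<circ> j))"
  by (simp add: mul_H extend_def)

lemma mul_in: "a \<in> space H \<Longrightarrow> b \<in> space H \<Longrightarrow> mul H a b \<in> space H"
  unfolding mul_extend by (intro extend_in_space finite_conv) (simp_all add: space_finite)

lemma unit_extend: "unit H = extend delta"
  by (simp add: unit_H extend_def)

lemma unit_comp_j: "unit H \<circ> j = delta"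
  by (simp add: unit_extend)

lemma unit_in: "unit H \<in> space H"
  unfolding unit_extend by (intro extend_in_space) (simp add: delta_def)

lemma unit_eq_basis_fun: "unit H = basis_fun 0"
  unfolding unit_extend basis_fun_def by (rule arg_cong [where f = extend]) (simp add: delta_def fun_eq_iff)

lemma space_extend: "a \<in> space H \<Longrightarrow> extend (a \<circ> j) = a"
  by (rule ext) (simp add: extend_def space_expand [symmetric] o_def)

lemma plus_comp: "(a + b) \<circ> j = (\<lambda>x. a (j x) + b (j x))"
  by (simp add: fun_eq_iff)

lemma conv_plus_left: "conv (\<lambda>x. f x + g x) h x = conv f h x + conv g h x"
  by (simp add: conv_def sum_mset.distrib algebra_simps)

lemma conv_plus_right: "conv h (\<lambda>x. f x + g x) x = conv h f x + conv h g x"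
  by (simp add: conv_def sum_mset.distrib algebra_simps)

lemma conv_scale_left: "conv (\<lambda>x. c * f x) h x = c * conv f h x"
  by (simp add: conv_def sum_mset_distrib_left mult.assoc)

lemma conv_scale_right: "conv h (\<lambda>x. c * f x) x = c * conv h f x"
  by (simp add: conv_def sum_mset_distrib_left mult.left_commute)

lemma linear_mul_left: "b \<in> space H \<Longrightarrow> linear_on (space H) fscale (\<lambda>a. mul H a b)"
  unfolding linear_on_def
  by (auto simp: fun_eq_iff mul_H fun_space.subspace_add [OF subspace_H] 
      fun_space.subspace_scale [OF subspace_H] plus_comp fscale_apply o_def
      conv_plus_left [abs_def] conv_scale_left [abs_def] linext_plus_fun linext_scale_fun)

lemma linear_mul_right: "b \<in> space H \<Longrightarrow> linear_on (space H) fscale (\<lambda>a. mul H b a)"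
  unfolding linear_on_def
  by (auto simp: fun_eq_iff mul_H fun_space.subspace_add [OF subspace_H] 
      fun_space.subspace_scale [OF subspace_H] plus_comp fscale_apply o_def
      conv_plus_right [abs_def] conv_scale_right [abs_def] linext_plus_fun linext_scale_fun)

lemma linear_comul: "linear_on (space H) fscale (comul H)"
  unfolding linear_on_def
  by (auto simp: fun_eq_iff comul_H fun_space.subspace_add [OF subspace_H] 
      fun_space.subspace_scale [OF subspace_H] fscale_apply linext_plus_fun linext_scale_fun)

lemma lift_comul_left:
  assumes u: "u \<in> tensor_square"
  shows "lift2 H (\<lambda>b c. comul H b \<otimes> c) u =
    (\<lambda>((y1, y2), y3). linext (\<lambda>x1. linext (\<lambda>x2. u (j (x1 + x2), y3)) (co y2)) (co y1))"
proof (rule lift_linear [OF _ _ u])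
  fix a b
  assume "a \<in> space H" "b \<in> space H"
  then show "comul H a \<otimes> b =
    (\<lambda>((y1, y2), y3). linext (\<lambda>x1. linext (\<lambda>x2. (a \<otimes> b) (j (x1 + x2), y3)) (co y2)) (co y1))"
    by (auto simp: fun_eq_iff tensor_def comul_H linext_scale_fun_right)
qed (auto simp: linear_on_def fun_eq_iff linext_plus_fun fscale_def linext_scale_fun)

lemma lift_comul_right:
  assumes u: "u \<in> tensor_square"
  shows "lift2 H (\<lambda>b c. b \<otimes> comul H c) u =
    (\<lambda>(y1, y2, y3). linext (\<lambda>x2. linext (\<lambda>x3. u (y1, j (x2 + x3))) (co y3)) (co y2))"
proof (rule lift_linear [OF _ _ u])
  fix a b
  assume "a \<in> space H" "b \<in> space H"
  then show "a \<otimes> comul H b =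
    (\<lambda>(y1, y2, y3). linext (\<lambda>x2. linext (\<lambda>x3. (a \<otimes> b) (y1, j (x2 + x3))) (co y3)) (co y2))"
    by (auto simp: fun_eq_iff tensor_def comul_H linext_scale_fun)
qed (auto simp: linear_on_def fun_eq_iff linext_plus_fun fscale_def linext_scale_fun)

lemma coassoc:
  assumes a: "a \<in> space H"
  shows "(\<lambda>(x, y, z). lift2 H (\<lambda>b c. comul H b \<otimes> c) (comul H a) ((x, y), z)) =
          lift2 H (\<lambda>b c. b \<otimes> comul H c) (comul H a)"
proof -
  have "linext (\<lambda>x1. linext (\<lambda>x2. comul H a (j (x1 + x2), y3)) (co y2)) (co y1) =
      linext (\<lambda>x2. linext (\<lambda>x3. comul H a (y1, j (x2 + x3))) (co y3)) (co y2)" for y1 y2 y3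
  proof -
    have "linext (\<lambda>x1. linext (\<lambda>x2. comul H a (j (x1 + x2), y3)) (co y2)) (co y1) =
      linext (\<lambda>x1. linext (\<lambda>x2. linext (\<lambda>x3. a (j (x1 + (x2 + x3)))) (co y3)) (co y2)) (co y1)"
      by (simp add: comul_H a co_j add.assoc)
    also have "\<dots> =
      linext (\<lambda>x2. linext (\<lambda>x1. linext (\<lambda>x3. a (j (x1 + (x2 + x3)))) (co y3)) (co y1)) (co y2)"
      by (rule linext_swap)
    also have "\<dots> = linext (\<lambda>x2. linext (\<lambda>x3. comul H a (y1, j (x2 + x3))) (co y3)) (co y2)"
      by (subst linext_swap) (simp add: comul_H a co_j)
    finally show ?thesis .
  qed
  then show ?thesis
    unfolding lift_comul_left [OF comul_in [OF a]] lift_comul_right [OF comul_in [OF a]]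
    by (auto simp: fun_eq_iff)
qed

lemma counit_left:
  assumes a: "a \<in> space H"
  shows "lift2 H (\<lambda>b c. fscale (counit H b) c) (comul H a) = a"
proof -
  have "lift2 H (\<lambda>b c. fscale (counit H b) c) (comul H a) = (\<lambda>y. comul H a (j 0, y))"
    by (rule lift_linear [OF _ _ comul_in [OF a]])
      (auto simp: linear_on_def fun_eq_iff tensor_def fscale_def counit_H)
  also have "\<dots> = a"
    by (auto simp: fun_eq_iff comul_H a co_j space_expand [OF a, symmetric])
  finally show ?thesis .
qed

lemma counit_right:
  assumes a: "a \<in> space H"
  shows "lift2 H (\<lambda>b c. fscale (counit H c) b) (comul H a) = a"
proof -
  have "lift2 H (\<lambda>b c. fscale (counit H c) b) (comul H a) = (\<lambda>y. comul H a (y, j 0))"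
    by (rule lift_linear [OF _ _ comul_in [OF a]])
      (auto simp: linear_on_def fun_eq_iff tensor_def fscale_def counit_H)
  also have "\<dots> = a"
    by (auto simp: fun_eq_iff comul_H a co_j space_expand [OF a, symmetric])
  finally show ?thesis .
qed

lemma tensor_mul_eq:
  assumes u: "u \<in> tensor_square" and v: "v \<in> tensor_square"
  shows "tensor_mul H u v = (\<lambda>(y, z). linext (\<lambda>x. linext (\<lambda>x'.
    \<Sum>p\<in>#cop x. \<Sum>q\<in>#cop x'. u (j (fst p), j (fst q)) * v (j (snd p), j (snd q))) (co z)) (co y))"
proof -
  have inner: "lift2 H (\<lambda>c d. mul H a c \<otimes> mul H b d) v = (\<lambda>(y, z). linext (\<lambda>x. linext (\<lambda>x'.
    \<Sum>p\<in>#cop x. \<Sum>q\<in>#cop x'. (a \<otimes> b) (j (fst p), j (fst q)) * v (j (snd p), j (snd q))) (co z)) (co y))"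
    if ab: "a \<in> space H" "b \<in> space H" for a b
  proof (rule lift_linear [OF _ _ v])
    fix c d
    assume cd: "c \<in> space H" "d \<in> space H"
    show "mul H a c \<otimes> mul H b d = (\<lambda>(y, z). linext (\<lambda>x. linext (\<lambda>x'.
      \<Sum>p\<in>#cop x. \<Sum>q\<in>#cop x'. (a \<otimes> b) (j (fst p), j (fst q)) * (c \<otimes> d) (j (snd p), j (snd q))) (co z)) (co y))"
      by (simp add: fun_eq_iff mul_H ab cd tensor_def linext_mult_linext conv_def
          sum_mset_times_sum_mset mult.assoc mult.left_commute)
  qed (simp add: linear_on_def fun_eq_iff linext_plus_fun fscale_apply linext_scale_fun
        double_sum_mset_linear double_sum_mset_scale)
  let ?K = "\<lambda>u. \<lambda>(y, z). linext (\<lambda>x. linext (\<lambda>x'.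
      \<Sum>p\<in>#cop x. \<Sum>q\<in>#cop x'. u (j (fst p), j (fst q)) * v (j (snd p), j (snd q))) (co z)) (co y)"
  have "linear_on UNIV fscale ?K"
    by (simp add: linear_on_def fun_eq_iff linext_plus_fun fscale_apply linext_scale_fun
        double_sum_mset_linear double_sum_mset_scale)
  then show ?thesis
    unfolding tensor_mul_def by (rule lift_linear [where K = ?K, OF _ inner u])
qed

lemma comul_mul_eq:
  assumes a: "a \<in> space H" and b: "b \<in> space H"
  shows "comul H (mul H a b) = tensor_mul H (comul H a) (comul H b)"
  unfolding tensor_mul_eq [OF comul_in [OF a] comul_in [OF b]] comul_H [OF mul_in [OF a b]]
  by (simp add: mul_H a b co_j conv_add_args comul_j)

lemma add_eq_zero_iff: "x + y = 0 \<longleftrightarrow> x = 0 \<and> y = (0 :: 'x)"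
  using deg_add [of x y] deg_zero_iff [of x] deg_zero_iff [of y] deg_zero_iff [of "x + y"] by auto

lemma comul_unit_eq: "comul H (unit H) = unit H \<otimes> unit H"
  by (rule tensor_eqI [OF comul_in [OF unit_in] tensor_in [OF unit_in unit_in]])
    (simp add: comul_j unit_in, simp add: tensor_def unit_eq_basis_fun add_eq_zero_iff)

lemma unit_laws:
  assumes "a \<in> space H"
  shows "mul H (unit H) a = a" "mul H a (unit H) = a"
  using assms by (simp_all add: mul_extend unit_in unit_comp_j space_extend)

lemma mul_assoc_eq:
  assumes "a \<in> space H" "b \<in> space H" "c \<in> space H"
  shows "mul H (mul H a b) c = mul H a (mul H b c)"
  using assms by (simp add: mul_extend [of "mul H a b" c] mul_extend [of a "mul H b c"] mul_in
        mul_comp_j conv_assoc)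

lemma counit_laws:
  "linear_on (space H) (*) (counit H)"
  "a \<in> space H \<Longrightarrow> b \<in> space H \<Longrightarrow> counit H (mul H a b) = counit H a * counit H b"
  "counit H (unit H) = 1"
  by (simp_all add: linear_on_def counit_H fscale_def mul_j cop_zero unit_eq_basis_fun)

lemma bialgebra_H: "bialgebra H"
  by unfold_locales
    (fact subspace_H mul_in linear_mul_left linear_mul_right mul_assoc_eq unit_in unit_laws
      comul_in linear_comul coassoc counit_laws counit_left counit_right comul_mul_eq
      comul_unit_eq)+

end

section \<open>The antipode\<close>

context dual_realisation
begin

text \<open>
  The antipode will be composition with a map \<open>A\<close> from the monoid to its algebra. For such an \<open>S\<close> the
  two sides of the antipode identity are given by linear formulas, so \<open>tensor_lift_linear\<close> applies.
\<close>

lemma lift_antipode_kernel: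
  fixes A :: "'x \<Rightarrow> ('x \<Rightarrow>\<^sub>0 rat)"
  assumes u: "u \<in> tensor_square"
    and S: "\<And>a. a \<in> space H \<Longrightarrow> S a \<in> space H"
    and S_j: "\<And>a x. a \<in> space H \<Longrightarrow> S a (j x) = linext (\<lambda>y. a (j y)) (A x)"
  shows "lift2 H (\<lambda>b c. mul H (S b) c) u =
      extend (\<lambda>x. \<Sum>p\<in>#cop x. linext (\<lambda>y. u (j y, j (snd p))) (A (fst p)))"
    and "lift2 H (\<lambda>b c. mul H b (S c)) u =
      extend (\<lambda>x. \<Sum>p\<in>#cop x. linext (\<lambda>y. u (j (fst p), j y)) (A (snd p)))"
proof -
  show "lift2 H (\<lambda>b c. mul H (S b) c) u =
      extend (\<lambda>x. \<Sum>p\<in>#cop x. linext (\<lambda>y. u (j y, j (snd p))) (A (fst p)))"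
  proof (rule lift_linear [OF _ _ u])
    fix b c
    assume bc: "b \<in> space H" "c \<in> space H"
    show "mul H (S b) c = extend (\<lambda>x. \<Sum>p\<in>#cop x. linext (\<lambda>y. (b \<otimes> c) (j y, j (snd p))) (A (fst p)))"
      unfolding mul_extend [OF S [OF bc(1)] bc(2)]
      by (simp add: conv_def [abs_def] fun_eq_iff extend_def S_j bc tensor_def linext_scale_fun_right)
  qed (simp add: linear_on_def fun_eq_iff extend_def linext_plus_fun fscale_apply linext_scale_fun
      sum_mset.distrib sum_mset_distrib_left [symmetric])
  show "lift2 H (\<lambda>b c. mul H b (S c)) u =
      extend (\<lambda>x. \<Sum>p\<in>#cop x. linext (\<lambda>y. u (j (fst p), j y)) (A (snd p)))"
  proof (rule lift_linear [OF _ _ u])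
    fix b c
    assume bc: "b \<in> space H" "c \<in> space H"
    show "mul H b (S c) = extend (\<lambda>x. \<Sum>p\<in>#cop x. linext (\<lambda>y. (b \<otimes> c) (j (fst p), j y)) (A (snd p)))"
      unfolding mul_extend [OF bc(1) S [OF bc(2)]]
      by (simp add: conv_def [abs_def] fun_eq_iff extend_def S_j bc tensor_def linext_scale_fun)
  qed (simp add: linear_on_def fun_eq_iff extend_def linext_plus_fun fscale_apply linext_scale_fun
      sum_mset.distrib sum_mset_distrib_left [symmetric])
qed

lemma linext_delta: "linext f (delta x) = (delta x) * f 0"
  by (simp add: delta_def)

text \<open>
  The antipode of the monoid algebra is the convolution inverse \<open>A\<close> of the inclusion of the monoid into
  its algebra, and the antipode of the dual is composition with \<open>A\<close>. It preserves finite supports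
  because \<open>A\<close> preserves degrees.
\<close>

lemma antipode_exists_H: "\<exists>S. antipode H S"
proof -
  define i :: "'x \<Rightarrow> ('x \<Rightarrow>\<^sub>0 rat)" where "i x = Poly_Mapping.single x 1" for x
  have "i 0 = 1"
    by (simp add: i_def)
  then obtain A where A1: "conv A i = delta" and A2: "conv i A = delta"
    by (rule conv_inverse)
  \<comment> \<open>\<open>A\<close> preserves degrees, by the recursion that the equation \<open>conv A i = delta\<close> amounts to.\<close>
  have keys: "deg y = deg x" if "y \<in> Poly_Mapping.keys (A x)" for x y
    using that
  proof (induction "deg x" arbitrary: x y rule: less_induct)
    case less
    show ?case
    proof (cases "x = 0")
      case True
      have "A 0 = 1"
        using fun_cong [OF A1, of 0] by (simp add: conv_def cop_zero i_def delta_def)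
      then show ?thesis
        using less.prems True by simp
    next
      case False
      have "(\<Sum>p\<in>#cop x. A (fst p) * i (snd p)) = 0"
        using fun_cong [OF A1, of x] False by (simp add: conv_def delta_def)
      then have "A x = - (\<Sum>p\<in>#filter_mset (\<lambda>p. snd p \<noteq> 0) (cop x). A (fst p) * i (snd p))"
        unfolding sum_mset_partition [where P = "\<lambda>p. snd p = 0" and M = "cop x"] cop_counit_right
        by (simp add: \<open>i 0 = 1\<close> eq_neg_iff_add_eq_0)
      then have "Poly_Mapping.lookup (\<Sum>p\<in>#filter_mset (\<lambda>p. snd p \<noteq> 0) (cop x).
          A (fst p) * i (snd p)) y \<noteq> 0"
        using less.prems by (simp add: in_keys_iff)
      moreover have "Poly_Mapping.lookup (\<Sum>p\<in>#P. F p) y = (\<Sum>p\<in>#P. Poly_Mapping.lookup (F p) y)"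
        for P and F :: "'x \<times> 'x \<Rightarrow> ('x \<Rightarrow>\<^sub>0 rat)"
        by (induction P) (auto simp: lookup_add)
      ultimately have "\<exists>p. p \<in># filter_mset (\<lambda>p. snd p \<noteq> 0) (cop x) \<and>
          Poly_Mapping.lookup (A (fst p) * i (snd p)) y \<noteq> 0"
        by (intro sum_mset_nonzeroD) simp
      then obtain p where p: "p \<in># cop x" "snd p \<noteq> 0" "y \<in> Poly_Mapping.keys (A (fst p) * i (snd p))"
        by (auto simp: in_keys_iff)
      then obtain z where z: "z \<in> Poly_Mapping.keys (A (fst p))" "y = z + snd p"
        using Poly_Mapping.keys_mult [of "A (fst p)" "i (snd p)"] by (auto simp: i_def)
      have lt: "deg (fst p) < deg x"
        using deg_cop [OF p(1)] p(2) deg_zero_iff [of "snd p"] by linarith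
      show ?thesis
        using less.hyps [OF lt z(1)] deg_cop [OF p(1)] by (simp add: z(2) deg_add)
    qed
  qed
  define S where "S a = extend (\<lambda>x. linext (\<lambda>y. a (j y)) (A x))" for a
  have S_j: "S a (j x) = linext (\<lambda>y. a (j y)) (A x)" for a x
    by (simp add: S_def)
  have S_in: "S a \<in> space H" if a: "a \<in> space H" for a
    unfolding S_def
  proof (rule extend_in_space)
    obtain n where n: "\<forall>y\<in>{y. a (j y) \<noteq> 0}. deg y \<le> n"
      using finite_deg_bounded [OF space_finite [OF a]] ..
    have "deg x \<le> n" if "linext (\<lambda>y. a (j y)) (A x) \<noteq> 0" for x
    proof -
      have "\<exists>y\<in>Poly_Mapping.keys (A x). a (j y) \<noteq> 0"
      proof (rule ccontr)
        assume "\<not> ?thesis"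
        then have "linext (\<lambda>y. a (j y)) (A x) = 0"
          unfolding linext_def by (intro sum.neutral) simp
        with that show False ..
      qed
      then show ?thesis
        using n keys [of _ x] by auto
    qed
    then show "finite {x. linext (\<lambda>y. a (j y)) (A x) \<noteq> 0}"
      by (intro finite_subset [OF subsetI finite_deg_le [of n]]) simp
  qed
  have conv_i1: "(\<Sum>p\<in>#cop x. linext (\<lambda>y. f (y + snd p)) (A (fst p))) = linext f (delta x)" for f x
    unfolding fun_cong [OF A1, symmetric] by (simp add: conv_def linext_sum_mset linext_mult i_def)
  have conv_i2: "(\<Sum>p\<in>#cop x. linext (\<lambda>y. f (fst p + y)) (A (snd p))) = linext f (delta x)" for f x
    unfolding fun_cong [OF A2, symmetric] by (simp add: conv_def linext_sum_mset linext_mult i_def)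
  have unit: "extend (\<lambda>x. linext (\<lambda>y. a (j y)) (delta x)) = fscale (counit H a) (unit H)" for a
    by (simp add: linext_delta unit_extend counit_H extend_def fscale_def fun_eq_iff
        linext_scale_fun_right mult.commute)
  have "antipode H S"
    unfolding antipode_def
  proof (intro conjI ballI)
    show "S ` space H \<subseteq> space H"
      using S_in by blast
    show "linear_on (space H) fscale S"
      by (simp add: linear_on_def S_def extend_def fun_eq_iff linext_plus_fun fscale_apply
          linext_scale_fun)
    fix a
    assume a: "a \<in> space H"
    show "lift2 H (\<lambda>b c. mul H (S b) c) (comul H a) = fscale (counit H a) (unit H)"
      by (rule trans [OF lift_antipode_kernel(1) [where S = S, OF comul_in [OF a] S_in S_j]])
        (simp_all add: comul_j [OF a] conv_i1 [of "\<lambda>x. a (j x)"] unit)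
    show "lift2 H (\<lambda>b c. mul H b (S c)) (comul H a) = fscale (counit H a) (unit H)"
      by (rule trans [OF lift_antipode_kernel(2) [where S = S, OF comul_in [OF a] S_in S_j]])
        (simp_all add: comul_j [OF a] conv_i2 [of "\<lambda>x. a (j x)"] unit)
  qed
  then show ?thesis
    by (rule exI [of _ S])
qed

lemma hopf_algebra_H: "hopf_algebra H"
  by (intro hopf_algebra.intro bialgebra_H hopf_algebra_axioms.intro antipode_exists_H)

lemma comul_basis_fun: "comul H (basis_fun x) = (\<Sum>p | fst p + snd p = x. basis_fun (fst p) \<otimes> basis_fun (snd p))"
  unfolding comul_eq_sum_basis [OF basis_fun_in_space]
  by (intro sum.cong) (auto simp: fscale_def)

lemma finite_decomp: "finite {p. fst p + snd p = (x :: 'x)}"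
  using finite_sums [of "{x}"] by (simp add: case_prod_unfold)

text \<open>
  The antipode identity, solved for the term of \<open>(x, 0)\<close>. The remaining terms involve \<open>S\<close> only in degrees
  smaller than that of \<open>x\<close>, so this is a recursion that determines every antipode; compatibility of an
  isomorphism with antipodes follows from it by induction on the degree.
\<close>

lemma antipode_basis_fun:
  assumes S: "antipode H S"
  shows "S (basis_fun x) = fscale (counit H (basis_fun x)) (unit H) -
    (\<Sum>p | fst p + snd p = x \<and> snd p \<noteq> 0. mul H (S (basis_fun (fst p))) (basis_fun (snd p)))"
proof -
  have S_in: "\<And>a. a \<in> space H \<Longrightarrow> S a \<in> space H" and S_lin: "linear_on (space H) fscale S"
    and S_eq: "\<And>a. a \<in> space H \<Longrightarrow>
      lift2 H (\<lambda>b c. mul H (S b) c) (comul H a) = fscale (counit H a) (unit H)"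
    using S by (auto simp: antipode_def)
  let ?P = "{p. fst p + snd p = x}"
  have B1: "linear_on (space H) fscale (\<lambda>a. mul H (S a) b)" if "b \<in> space H" for b
    using linear_mul_left [OF that] S_lin S_in by (simp add: linear_on_def)
  have B2: "linear_on (space H) fscale (\<lambda>b. mul H (S a) b)" if "a \<in> space H" for a
    using linear_mul_right [OF S_in [OF that]] .
  obtain ps where ps: "set ps = ?P" "distinct ps"
    using finite_distinct_list [OF finite_decomp] by blast
  define qs where "qs = map (\<lambda>p. (basis_fun (fst p), basis_fun (snd p))) ps"
  have "comul H (basis_fun x) = (\<Sum>(a, b)\<leftarrow>qs. a \<otimes> b)"
    unfolding comul_basis_fun qs_def using ps by (simp add: sum_list_distinct_conv_sum_set o_def)
  then have "fscale (counit H (basis_fun x)) (unit H) = lift2 H (\<lambda>b c. mul H (S b) c) (\<Sum>(a, b)\<leftarrow>qs. a \<otimes> b)"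
    using S_eq [OF basis_fun_in_space, of x] by simp
  also have "\<dots> = (\<Sum>(a, b)\<leftarrow>qs. mul H (S a) b)"
    by (intro tensor_lift_sum_list [OF subspace_H subspace_H fun_space.vector_space_axioms B1 B2])
      (auto simp: qs_def)
  also have "\<dots> = (\<Sum>p\<in>?P. mul H (S (basis_fun (fst p))) (basis_fun (snd p)))"
    unfolding qs_def using ps by (simp add: sum_list_distinct_conv_sum_set o_def)
  also have "?P = insert (x, 0) {p. fst p + snd p = x \<and> snd p \<noteq> 0}"
    by auto
  also have "(\<Sum>p\<in>\<dots>. mul H (S (basis_fun (fst p))) (basis_fun (snd p))) = S (basis_fun x) +
      (\<Sum>p | fst p + snd p = x \<and> snd p \<noteq> 0. mul H (S (basis_fun (fst p))) (basis_fun (snd p)))"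
    using finite_subset [OF _ finite_decomp [of x], of "{p. fst p + snd p = x \<and> snd p \<noteq> 0}"]
    by (subst sum.insert) (auto simp: unit_eq_basis_fun [symmetric] unit_laws S_in)
  finally show ?thesis
    by (simp add: algebra_simps)
qed

end

section \<open>Isomorphism of two realisations\<close>

text \<open>
  The isomorphism restricts a function to the monoid elements of one realisation and extends it
  linearly in the other.
\<close>

lemma hopf_isomorphic_realisations:
  assumes H: "dual_realisation cop deg H j co" and K: "dual_realisation cop deg K j' co'"
  shows "hopf_isomorphic H K"
proof -
  interpret H: dual_realisation cop deg H j co
    by (rule H)
  interpret K: dual_realisation cop deg K j' co'
    by (rule K)
  define \<phi> where "\<phi> a = K.extend (a \<circ> j)" for a
  have \<phi>_j: "\<phi> a (j' x) = a (j x)" for a x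
    by (simp add: \<phi>_def)
  have \<phi>_in: "\<phi> a \<in> space K" if "a \<in> space H" for a
    unfolding \<phi>_def using H.space_finite [OF that] by (intro K.extend_in_space) simp
  have \<phi>_lin: "linear_on (space H) fscale \<phi>"
    by (simp add: linear_on_def \<phi>_def K.extend_def fun_eq_iff o_def linext_plus_fun fscale_apply
        linext_scale_fun)
  have \<phi>_bas: "\<phi> (H.basis_fun x) = K.basis_fun x" for x
    by (rule K.space_eqI) (simp_all add: \<phi>_in \<phi>_j)
  have \<phi>_unit: "\<phi> (unit H) = unit K"
    by (simp add: H.unit_eq_basis_fun K.unit_eq_basis_fun \<phi>_bas)
  have \<phi>_mul: "\<phi> (mul H a b) = mul K (\<phi> a) (\<phi> b)" if "a \<in> space H" "b \<in> space H" for a b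
    using that by (intro K.space_eqI) (simp_all add: \<phi>_in H.mul_in K.mul_in \<phi>_j H.mul_j K.mul_j)
  have \<phi>_counit: "counit K (\<phi> a) = counit H a" for a
    by (simp add: H.counit_H K.counit_H \<phi>_j)
  have "hopf_isomorphism H K \<phi>"
  proof (intro hopf_isomorphism.intro hopf_isomorphism_axioms.intro)
    show "hopf_algebra H" "hopf_algebra K"
      by (rule H.hopf_algebra_H K.hopf_algebra_H)+
    show "bij_betw \<phi> (space H) (space K)"
    proof (rule bij_betw_byWitness [where f' = "\<lambda>b. H.extend (b \<circ> j')"])
      show "\<forall>a\<in>space H. H.extend (\<phi> a \<circ> j') = a"
        by (simp add: \<phi>_def H.space_extend)
      show "\<forall>b\<in>space K. \<phi> (H.extend (b \<circ> j')) = b"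
        by (simp add: \<phi>_def K.space_extend)
      show "\<phi> ` space H \<subseteq> space K"
        using \<phi>_in by blast
      show "(\<lambda>b. H.extend (b \<circ> j')) ` space K \<subseteq> space H"
        using K.space_finite by (auto intro!: H.extend_in_space)
    qed
    show "linear_on (space H) fscale \<phi>" "\<phi> (unit H) = unit K"
      by (rule \<phi>_lin \<phi>_unit)+
    show "comul K (\<phi> a) = lift2 H (\<lambda>b c. \<phi> b \<otimes> \<phi> c) (comul H a)" if a: "a \<in> space H" for a
    proof -
      have "lift2 H (\<lambda>b c. \<phi> b \<otimes> \<phi> c) (comul H a) =
        (\<lambda>(y, z). linext (\<lambda>x. linext (\<lambda>x'. comul H a (j x, j x')) (co' z)) (co' y))"
        by (rule H.lift_linear [OF _ _ H.comul_in [OF a]])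
          (simp_all add: linear_on_def fun_eq_iff \<phi>_def K.extend_def tensor_def linext_mult_linext
            linext_plus_fun fscale_apply linext_scale_fun)
      then show ?thesis
        by (simp add: K.comul_H \<phi>_in a \<phi>_j H.comul_j)
    qed
    show "\<phi> (S a) = S' (\<phi> a)" if S: "antipode H S" and S': "antipode K S'" and a: "a \<in> space H"
      for S S' a
    proof -
      have S_in: "\<And>a. a \<in> space H \<Longrightarrow> S a \<in> space H" and S_lin: "linear_on (space H) fscale S"
        and S'_lin: "linear_on (space K) fscale S'"
        using S S' by (auto simp: antipode_def)
      have basis_fun: "\<phi> (S (H.basis_fun x)) = S' (K.basis_fun x)" for x
      proof (induction "deg x" arbitrary: x rule: less_induct)
        case less
        let ?P = "{p. fst p + snd p = x \<and> snd p \<noteq> 0}"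
        let ?f = "\<lambda>p. mul H (S (H.basis_fun (fst p))) (H.basis_fun (snd p))"
        have f_in: "?f p \<in> space H" for p
          by (intro H.mul_in S_in H.basis_fun_in_space)
        have lt: "deg (fst p) < deg x" if "p \<in> ?P" for p
          using that H.deg_add [of "fst p" "snd p"] H.deg_zero_iff [of "snd p"] by auto
        have sum_in: "(\<Sum>p\<in>?P. ?f p) \<in> space H"
          by (intro fun_space.subspace_sum [OF H.subspace_H] f_in)
        have "\<phi> (S (H.basis_fun x)) = \<phi> (fscale (counit H (H.basis_fun x)) (unit H) - (\<Sum>p\<in>?P. ?f p))"
          using H.antipode_basis_fun [OF S, of x] by simp
        also have "\<dots> = fscale (counit H (H.basis_fun x)) (\<phi> (unit H)) - \<phi> (\<Sum>p\<in>?P. ?f p)"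
          by (simp add: \<phi>_def K.extend_def fun_eq_iff o_def fscale_apply linext_def
              sum_subtractf sum_distrib_left algebra_simps)
        also have "\<phi> (\<Sum>p\<in>?P. ?f p) = (\<Sum>p\<in>?P. \<phi> (?f p))"
          by (rule linear_on_sum [OF fun_space.vector_space_axioms H.subspace_H \<phi>_lin f_in])
        also have "\<dots> = (\<Sum>p\<in>?P. mul K (S' (K.basis_fun (fst p))) (K.basis_fun (snd p)))"
          using less lt by (intro sum.cong) (simp_all add: \<phi>_mul S_in \<phi>_bas)
        also have "fscale (counit H (H.basis_fun x)) (\<phi> (unit H)) =
            fscale (counit K (K.basis_fun x)) (unit K)"
          by (simp add: \<phi>_unit \<phi>_counit [symmetric] \<phi>_bas)
        finally show ?case
          by (rule trans [OF _ K.antipode_basis_fun [OF S', of x, symmetric]])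
      qed
      show ?thesis
      proof (rule H.linear_on_space_eqI [OF _ _ _ a])
        show "linear_on (space H) fscale (\<lambda>a. \<phi> (S a))"
          using S_lin S_in \<phi>_lin by (simp add: linear_on_def)
        show "linear_on (space H) fscale (\<lambda>a. S' (\<phi> a))"
          using S'_lin \<phi>_in \<phi>_lin by (simp add: linear_on_def)
        show "\<phi> (S (H.basis_fun x)) = S' (\<phi> (H.basis_fun x))" for x
          by (simp add: basis_fun \<phi>_bas)
      qed
    qed
  qed (use \<phi>_mul \<phi>_counit in simp_all)
  then show ?thesis
    unfolding hopf_isomorphic_def by (rule exI [of _ \<phi>])
qed

section \<open>Rooted forests as graphs\<close>

abbreviation restr :: "('v \<times> 'v) set \<Rightarrow> 'v set \<Rightarrow> ('v \<times> 'v) set" where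
  "restr E V \<equiv> E \<inter> V \<times> V"

text \<open>
  Edges point to parents. Edges outside of \<open>V\<close> are permitted and ignored. Thus a subset of \<open>V\<close> spans a
  forest with the same \<open>E\<close>, and forests that are cut repeatedly need no bookkeeping of edges.
\<close>

definition forest_graph :: "'v set \<Rightarrow> ('v \<times> 'v) set \<Rightarrow> bool" where
  "forest_graph V E \<longleftrightarrow> finite V \<and> single_valued (restr E V) \<and> acyclic (restr E V)"

definition roots :: "'v set \<Rightarrow> ('v \<times> 'v) set \<Rightarrow> 'v set" where
  "roots V E = {r \<in> V. \<forall>w\<in>V. (r, w) \<notin> E}"

definition below :: "'v set \<Rightarrow> ('v \<times> 'v) set \<Rightarrow> 'v \<Rightarrow> 'v set" where
  "below V E r = {v \<in> V. (v, r) \<in> (restr E V)\<^sup>*}"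

definition subtree :: "'v set \<Rightarrow> ('v \<times> 'v) set \<Rightarrow> 'v \<Rightarrow> 'v tree" where
  "subtree V E r = \<lparr>verts = below V E r, edges = restr E (below V E r), root_vertex = r\<rparr>"

definition forest_of :: "'v set \<Rightarrow> ('v \<times> 'v) set \<Rightarrow> forest" where
  "forest_of V E = image_mset (\<lambda>r. tree_class (subtree V E r)) (mset_set (roots V E))"

lemma forest_graph_subset: "forest_graph V E \<Longrightarrow> W \<subseteq> V \<Longrightarrow> forest_graph W E"
  using finite_subset [of W V] single_valued_subset [of "restr E W" "restr E V"]
    acyclic_subset [of "restr E V" "restr E W"]
  by (auto simp: forest_graph_def)

lemma forest_graphD:
  assumes "forest_graph V E"
  shows "finite V" "\<lbrakk>(v, w) \<in> E; (v, w') \<in> E; v \<in> V; w \<in> V; w' \<in> V\<rbrakk> \<Longrightarrow> w = w'"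
    "acyclic (restr E V)"
  using assms by (auto simp: forest_graph_def single_valued_def)

lemma finite_roots: "forest_graph V E \<Longrightarrow> finite (roots V E)"
  by (simp add: roots_def forest_graph_def)

lemma root_above:
  assumes V: "forest_graph V E" and v: "v \<in> V"
  shows "\<exists>r\<in>roots V E. v \<in> below V E r"
proof -
  have "finite (restr E V)"
    using forest_graphD(1) [OF V] by simp
  then have "wf ((restr E V)\<inverse>)"
    by (intro finite_acyclic_wf_converse forest_graphD(3) [OF V])
  then show ?thesis
    using v
  proof (induction v rule: wf_induct_rule)
    case (less v)
    show ?case
    proof (cases "v \<in> roots V E")
      case True
      then show ?thesis
        using less.prems by (auto simp: below_def)
    next
      case False
      then obtain w where w: "w \<in> V" "(v, w) \<in> E"
        using less.prems by (auto simp: roots_def)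
      then obtain r where "r \<in> roots V E" "w \<in> below V E r"
        using less.IH [of w] less.prems by auto
      then show ?thesis
        using w less.prems by (intro bexI [of _ r]) (auto simp: below_def intro: converse_rtrancl_into_rtrancl)
    qed
  qed
qed

lemma root_rtrancl_eq: "r \<in> roots V E \<Longrightarrow> (r, w) \<in> (restr E V)\<^sup>* \<Longrightarrow> w = r"
  by (erule converse_rtranclE) (auto simp: roots_def)

lemma root_unique:
  assumes V: "forest_graph V E" and r: "r \<in> roots V E" "s \<in> roots V E"
    and v: "v \<in> below V E r" "v \<in> below V E s"
  shows "r = s"
proof -
  have "single_valued (restr E V)"
    using V by (simp add: forest_graph_def)
  moreover have "(v, r) \<in> (restr E V)\<^sup>*" "(v, s) \<in> (restr E V)\<^sup>*"
    using v by (simp_all add: below_def)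
  ultimately have "(r, s) \<in> (restr E V)\<^sup>* \<or> (s, r) \<in> (restr E V)\<^sup>*"
    by (rule single_valued_confluent)
  then show ?thesis
    using root_rtrancl_eq [OF r(1)] root_rtrancl_eq [OF r(2)] by auto
qed

lemma below_edge:
  assumes V: "forest_graph V E" and r: "r \<in> roots V E" and e: "(v, w) \<in> E" "v \<in> V" "w \<in> V"
  shows "v \<in> below V E r \<longleftrightarrow> w \<in> below V E r"
proof
  assume "v \<in> below V E r"
  then have "(v, r) \<in> (restr E V)\<^sup>*"
    by (simp add: below_def)
  then show "w \<in> below V E r"
  proof (cases rule: converse_rtranclE)
    case base
    with e r show ?thesis
      by (auto simp: roots_def)
  next
    case (step x)
    then have "x = w"
      using e forest_graphD(2) [OF V] by blast
    with step e show ?thesis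
      by (simp add: below_def)
  qed
next
  assume "w \<in> below V E r"
  then show "v \<in> below V E r"
    using e by (auto simp: below_def intro: converse_rtrancl_into_rtrancl)
qed

lemma below_subset: "below V E r \<subseteq> V"
  by (auto simp: below_def)

lemma root_in_below: "r \<in> roots V E \<Longrightarrow> r \<in> below V E r"
  by (simp add: below_def roots_def)

lemma UN_below: "forest_graph V E \<Longrightarrow> (\<Union>r\<in>roots V E. below V E r) = V"
  using root_above below_subset by fastforce

lemma below_path:
  assumes V: "forest_graph V E" and r: "r \<in> roots V E" and v: "v \<in> below V E r"
  shows "(v, r) \<in> (restr E (below V E r))\<^sup>*"
proof -
  have "(v, r) \<in> (restr E V)\<^sup>*"
    using v by (simp add: below_def)
  then show ?thesis
  proof (induction rule: converse_rtrancl_induct)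
    case (step x y)
    then have "y \<in> below V E r" "x \<in> below V E r"
      by (auto simp: below_def intro: converse_rtrancl_into_rtrancl)
    with step show ?case
      by (auto intro: converse_rtrancl_into_rtrancl)
  qed simp
qed

lemma rooted_tree_subtree:
  assumes V: "forest_graph V E" and r: "r \<in> roots V E"
  shows "rooted_tree (subtree V E r)"
  unfolding rooted_tree_def
proof (intro conjI ballI allI)
  show "finite (verts (subtree V E r))"
    using forest_graphD(1) [OF V] finite_subset [OF below_subset] by (auto simp: subtree_def)
  show "root_vertex (subtree V E r) \<in> verts (subtree V E r)"
    using root_in_below [OF r] by (simp add: subtree_def)
  show "edges (subtree V E r) \<subseteq> verts (subtree V E r) \<times> verts (subtree V E r)"
    by (auto simp: subtree_def)
  show "(root_vertex (subtree V E r), w) \<notin> edges (subtree V E r)" for w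
    using r by (auto simp: subtree_def roots_def below_def)
  show "(v, root_vertex (subtree V E r)) \<in> (edges (subtree V E r))\<^sup>*"
    if "v \<in> verts (subtree V E r)" for v
    using below_path [OF V r] that by (simp add: subtree_def)
  fix v
  assume "v \<in> verts (subtree V E r) - {root_vertex (subtree V E r)}"
  then have v: "v \<in> below V E r" "v \<noteq> r"
    by (simp_all add: subtree_def)
  obtain w where "(v, w) \<in> restr E (below V E r)"
    using below_path [OF V r v(1)] v(2) by (meson converse_rtranclE)
  moreover have "x = y" if "(v, x) \<in> restr E (below V E r)" "(v, y) \<in> restr E (below V E r)" for x y
    using that by (intro forest_graphD(2) [OF V, of v]) (auto simp: below_def)
  ultimately show "\<exists>!w. (v, w) \<in> edges (subtree V E r)"
    by (auto simp: subtree_def)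
qed

text \<open>
  Acyclicity holds because parents are unique: every path that starts on a cycle stays on it, whereas
  the root, which has no parent, can be reached from each vertex.
\<close>

lemma rooted_tree_forest_graph:
  assumes T: "rooted_tree T"
  shows "forest_graph (verts T) (edges T)" "roots (verts T) (edges T) = {root_vertex T}"
    "restr (edges T) (verts T) = edges T" "subtree (verts T) (edges T) (root_vertex T) = T"
proof -
  have fin: "finite (verts T)" and root: "root_vertex T \<in> verts T"
    and sub: "edges T \<subseteq> verts T \<times> verts T" and top: "\<And>w. (root_vertex T, w) \<notin> edges T"
    and par: "\<And>v. v \<in> verts T \<Longrightarrow> v \<noteq> root_vertex T \<Longrightarrow> \<exists>!w. (v, w) \<in> edges T"
    and reach: "\<And>v. v \<in> verts T \<Longrightarrow> (v, root_vertex T) \<in> (edges T)\<^sup>*"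
    using T by (simp_all add: rooted_tree_def)
  show res: "restr (edges T) (verts T) = edges T"
    using sub by blast
  have sv: "w = w'" if "(v, w) \<in> edges T" "(v, w') \<in> edges T" for v w w'
    using that sub top par [of v] by blast
  \<comment> \<open>From each vertex \<open>x\<close> that is reachable from the cycle, the path returns to \<open>v\<close>.\<close>
  have cyc: "(x, v) \<in> (edges T)\<^sup>+" if "(v, v) \<in> (edges T)\<^sup>+" "(v, x) \<in> (edges T)\<^sup>*" for v x
    using that(2)
  proof (induction rule: rtrancl_induct)
    case (step x y)
    from step.IH obtain z where z: "(x, z) \<in> edges T" "(z, v) \<in> (edges T)\<^sup>*"
      by (meson tranclD)
    then show ?case
      using sv [OF z(1) step.hyps(2)] that(1) by (metis rtranclD)
  qed (rule that(1))
  have "acyclic (edges T)"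
    unfolding acyclic_def
  proof (intro allI notI)
    fix v
    assume v: "(v, v) \<in> (edges T)\<^sup>+"
    then have "v \<in> verts T"
      using sub by (meson SigmaD1 subsetD tranclD)
    then have "(root_vertex T, v) \<in> (edges T)\<^sup>+"
      using cyc [OF v reach] by blast
    then show False
      using top by (meson tranclD)
  qed
  then show "forest_graph (verts T) (edges T)"
    using fin sv by (auto simp: forest_graph_def res single_valued_def)
  show "roots (verts T) (edges T) = {root_vertex T}"
    using root top par sub by (auto simp: roots_def) blast
  have "below (verts T) (edges T) (root_vertex T) = verts T"
    using reach by (auto simp: below_def res)
  then show "subtree (verts T) (edges T) (root_vertex T) = T"
    by (simp add: subtree_def res)
qed

lemma forest_of_rooted_tree: "rooted_tree T \<Longrightarrow> forest_of (verts T) (edges T) = {#tree_class T#}"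
  by (simp add: forest_of_def rooted_tree_forest_graph)

section \<open>Isomorphisms of forest graphs\<close>

definition graph_iso ::
  "('v \<Rightarrow> 'w) \<Rightarrow> 'v set \<Rightarrow> ('v \<times> 'v) set \<Rightarrow> 'w set \<Rightarrow> ('w \<times> 'w) set \<Rightarrow> bool" where
  "graph_iso f V E V' E' \<longleftrightarrow>
     bij_betw f V V' \<and> (\<forall>u\<in>V. \<forall>v\<in>V. (u, v) \<in> E \<longleftrightarrow> (f u, f v) \<in> E')"

lemma tree_iso_graph_iso:
  "tree_iso S T \<longleftrightarrow> (\<exists>f. graph_iso f (verts S) (edges S) (verts T) (edges T) \<and>
      f (root_vertex S) = root_vertex T)"
  by (auto simp: tree_iso_def graph_iso_def)

lemma graph_iso_inv:
  assumes "graph_iso f V E V' E'"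
  shows "graph_iso (inv_into V f) V' E' V E"
proof -
  have f: "bij_betw f V V'" and E: "\<And>u v. u \<in> V \<Longrightarrow> v \<in> V \<Longrightarrow> (u, v) \<in> E \<longleftrightarrow> (f u, f v) \<in> E'"
    using assms by (auto simp: graph_iso_def)
  have "inv_into V f u \<in> V \<and> f (inv_into V f u) = u" if "u \<in> V'" for u
    using f that by (metis bij_betw_def f_inv_into_f inv_into_into)
  then show ?thesis
    using bij_betw_inv_into [OF f] E by (auto simp: graph_iso_def)
qed

lemma graph_iso_comp:
  assumes "graph_iso f V E V' E'" "graph_iso g V' E' V'' E''"
  shows "graph_iso (g \<circ> f) V E V'' E''"
  using assms bij_betw_trans [of f V V' g V''] bij_betwE [of f V V'] by (auto simp: graph_iso_def)

lemma graph_iso_subset: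
  "graph_iso f V E V' E' \<Longrightarrow> W \<subseteq> V \<Longrightarrow> graph_iso f W E (f ` W) E'"
  unfolding graph_iso_def by (meson bij_betw_subset order_refl subsetD)

lemma rtrancl_map:
  assumes "(x, y) \<in> R\<^sup>*" "\<And>x y. (x, y) \<in> R \<Longrightarrow> (f x, f y) \<in> S"
  shows "(f x, f y) \<in> S\<^sup>*"
  using assms(1) by (induction rule: rtrancl_induct) (auto intro: assms(2) rtrancl_into_rtrancl)

lemma trancl_map:
  assumes "(x, y) \<in> R\<^sup>+" "\<And>x y. (x, y) \<in> R \<Longrightarrow> (f x, f y) \<in> S"
  shows "(f x, f y) \<in> S\<^sup>+"
  using assms(1) by (induction rule: trancl_induct) (auto intro: assms(2) trancl_into_trancl)

lemma graph_iso_edge: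
  "graph_iso f V E V' E' \<Longrightarrow> (x, y) \<in> restr E V \<Longrightarrow> (f x, f y) \<in> restr E' V'"
  by (auto simp: graph_iso_def dest: bij_betwE)

lemma graph_iso_image: "graph_iso f V E V' E' \<Longrightarrow> f ` V = V'"
  by (simp add: graph_iso_def bij_betw_def)

lemma graph_iso_inv_apply:
  "graph_iso f V E V' E' \<Longrightarrow> v \<in> V \<Longrightarrow> inv_into V f (f v) = v"
  by (simp add: graph_iso_def bij_betw_def)

lemma forest_graph_iso:
  assumes f: "graph_iso f V E V' E'" and V: "forest_graph V E"
  shows "forest_graph V' E'"
  unfolding forest_graph_def
proof (intro conjI)
  let ?g = "inv_into V f"
  have g: "graph_iso ?g V' E' V E"
    by (rule graph_iso_inv [OF f])
  show "finite V'"
    using forest_graphD(1) [OF V] graph_iso_image [OF f] by blast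
  show "acyclic (restr E' V')"
    unfolding acyclic_def
  proof (intro allI notI)
    fix x
    assume "(x, x) \<in> (restr E' V')\<^sup>+"
    then have "(?g x, ?g x) \<in> (restr E V)\<^sup>+"
      using graph_iso_edge [OF g] by (rule trancl_map)
    then show False
      using forest_graphD(3) [OF V] by (auto simp: acyclic_def)
  qed
  show "single_valued (restr E' V')"
    unfolding single_valued_def
  proof (intro allI impI)
    fix x y z
    assume xy: "(x, y) \<in> restr E' V'" and xz: "(x, z) \<in> restr E' V'"
    have "?g y = ?g z"
      using graph_iso_edge [OF g xy] graph_iso_edge [OF g xz]
      by (intro forest_graphD(2) [OF V, of "?g x"]) auto
    then show "y = z"
      using g xy xz by (auto simp: graph_iso_def bij_betw_def dest: inj_onD)
  qed
qed

lemma roots_iso: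
  assumes f: "graph_iso f V E V' E'"
  shows "roots V' E' = f ` roots V E"
  using f graph_iso_image [OF f, symmetric] by (auto simp: roots_def graph_iso_def)

lemma below_iso:
  assumes f: "graph_iso f V E V' E'" and r: "r \<in> V"
  shows "below V' E' (f r) = f ` below V E r"
proof
  let ?g = "inv_into V f"
  have g: "graph_iso ?g V' E' V E"
    by (rule graph_iso_inv [OF f])
  show "f ` below V E r \<subseteq> below V' E' (f r)"
  proof
    fix y
    assume "y \<in> f ` below V E r"
    then obtain v where v: "y = f v" "v \<in> V" "(v, r) \<in> (restr E V)\<^sup>*"
      by (auto simp: below_def)
    have "(f v, f r) \<in> (restr E' V')\<^sup>*"
      using v(3) graph_iso_edge [OF f] by (rule rtrancl_map)
    then show "y \<in> below V' E' (f r)"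
      using v graph_iso_image [OF f] by (auto simp: below_def)
  qed
  show "below V' E' (f r) \<subseteq> f ` below V E r"
  proof
    fix v
    assume v: "v \<in> below V' E' (f r)"
    then obtain u where u: "v = f u" "u \<in> V"
      using graph_iso_image [OF f] by (auto simp: below_def)
    have "(f u, f r) \<in> (restr E' V')\<^sup>*"
      using v by (simp add: below_def u)
    then have "(?g (f u), ?g (f r)) \<in> (restr E V)\<^sup>*"
      using graph_iso_edge [OF g] by (rule rtrancl_map)
    then show "v \<in> f ` below V E r"
      using u r by (simp add: graph_iso_inv_apply [OF f] below_def)
  qed
qed

lemma subtree_iso:
  assumes f: "graph_iso f V E V' E'" and r: "r \<in> V"
  shows "tree_iso (subtree V E r) (subtree V' E' (f r))"
  unfolding tree_iso_graph_iso
proof (intro exI [of _ f] conjI)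
  have "graph_iso f (below V E r) E (below V' E' (f r)) E'"
    unfolding below_iso [OF f r] by (rule graph_iso_subset [OF f below_subset])
  then show "graph_iso f (verts (subtree V E r)) (edges (subtree V E r))
    (verts (subtree V' E' (f r))) (edges (subtree V' E' (f r)))"
    by (auto simp: subtree_def graph_iso_def dest: bij_betwE)
qed (simp add: subtree_def)

lemma tree_iso_sym:
  assumes T: "tree_iso S T" and r: "root_vertex S \<in> verts S"
  shows "tree_iso T S"
proof -
  obtain f where f: "graph_iso f (verts S) (edges S) (verts T) (edges T)"
    "f (root_vertex S) = root_vertex T"
    using T by (auto simp: tree_iso_graph_iso)
  show ?thesis
    unfolding tree_iso_graph_iso using graph_iso_inv [OF f(1)] graph_iso_inv_apply [OF f(1) r]
    by (intro exI [of _ "inv_into (verts S) f"]) (simp add: f(2))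
qed

lemma tree_iso_trans: "tree_iso S T \<Longrightarrow> tree_iso T U \<Longrightarrow> tree_iso S U"
  unfolding tree_iso_graph_iso using graph_iso_comp by (metis comp_apply)

lemma tree_class_eqI:
  assumes T: "tree_iso S T" and r: "root_vertex S \<in> verts S"
  shows "tree_class S = tree_class T"
proof -
  have "tree_copies S = tree_copies T"
    using tree_iso_trans [OF T] tree_iso_trans [OF tree_iso_sym [OF T r]]
    by (auto simp: tree_copies_def)
  then show ?thesis
    by (simp add: tree_class_def)
qed

lemma rooted_treeI:
  assumes V: "forest_graph (verts T) (edges T)" and r: "roots (verts T) (edges T) = {root_vertex T}"
    and E: "edges T \<subseteq> verts T \<times> verts T"
  shows "rooted_tree (T :: 'v tree)"
proof -
  have r': "root_vertex T \<in> roots (verts T) (edges T)"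
    by (simp add: r)
  have "below (verts T) (edges T) (root_vertex T) = verts T"
    using UN_below [OF V] by (simp add: r)
  then have "subtree (verts T) (edges T) (root_vertex T) = T"
    using E by (simp add: subtree_def inf.absorb1)
  then show ?thesis
    using rooted_tree_subtree [OF V r'] by simp
qed

lemma rooted_tree_iso:
  assumes S: "rooted_tree S" and f: "tree_iso S T" and E: "edges T \<subseteq> verts T \<times> verts T"
  shows "rooted_tree T"
proof -
  obtain f where f: "graph_iso f (verts S) (edges S) (verts T) (edges T)"
    "f (root_vertex S) = root_vertex T"
    using f by (auto simp: tree_iso_graph_iso)
  show ?thesis
    using forest_graph_iso [OF f(1)] roots_iso [OF f(1)] rooted_tree_forest_graph [OF S] f(2) E
    by (intro rooted_treeI) simp_all
qed

lemma graph_iso_map_prod: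
  "inj_on f V \<Longrightarrow> graph_iso f V E (f ` V) (map_prod f f ` restr E V)"
  unfolding graph_iso_def by (auto simp: inj_on_imp_bij_betw inj_on_eq_iff)

lemma ex_nat_copy:
  fixes T :: "'v tree"
  assumes T: "rooted_tree T"
  obtains T' :: "nat tree" where "rooted_tree T'" "tree_iso T T'"
proof -
  have "finite (verts T)"
    using T by (simp add: rooted_tree_def)
  then obtain f :: "'v \<Rightarrow> nat" where f: "inj_on f (verts T)"
    using finite_imp_inj_to_nat_seg by blast
  define T' where "T' = \<lparr>verts = f ` verts T, edges = map_prod f f ` restr (edges T) (verts T),
    root_vertex = f (root_vertex T)\<rparr>"
  have "tree_iso T T'"
    unfolding tree_iso_graph_iso using graph_iso_map_prod [OF f]
    by (intro exI [of _ f]) (simp add: T'_def)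
  moreover from this have "rooted_tree T'"
    by (rule rooted_tree_iso [OF T]) (auto simp: T'_def)
  ultimately show ?thesis
    using that by blast
qed

lemma root_in_verts: "rooted_tree T \<Longrightarrow> root_vertex T \<in> verts T"
  by (simp add: rooted_tree_def)

lemma copies_of_tree_class:
  assumes T: "rooted_tree T"
  shows "copies_of_tree_class (tree_class T) = tree_copies T"
proof -
  obtain T' :: "nat tree" where T': "rooted_tree T'" "tree_iso T T'"
    using ex_nat_copy [OF T] .
  have "tree_copies T = tree_copies T'"
    using tree_iso_trans [OF T'(2)] tree_iso_trans [OF tree_iso_sym [OF T'(2) root_in_verts [OF T]]]
    by (auto simp: tree_copies_def)
  then show ?thesis
    unfolding tree_class_def using T'(1) by (intro Abs_tree_class_inverse) auto
qed

text \<open>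
  A finite tree has a copy on the natural numbers, so its isomorphism class has a representative.
\<close>

lemma tree_rep_tree_class:
  assumes T: "rooted_tree T"
  shows "rooted_tree (tree_rep (tree_class T))" "tree_iso T (tree_rep (tree_class T))"
proof -
  obtain T' :: "nat tree" where T': "rooted_tree T'" "tree_iso T T'"
    using ex_nat_copy [OF T] .
  then have "T' \<in> copies_of_tree_class (tree_class T)"
    by (simp add: copies_of_tree_class [OF T] tree_copies_def)
  then have "tree_rep (tree_class T) \<in> copies_of_tree_class (tree_class T)"
    unfolding tree_rep_def by (rule someI)
  then show "rooted_tree (tree_rep (tree_class T))" "tree_iso T (tree_rep (tree_class T))"
    by (simp_all add: copies_of_tree_class [OF T] tree_copies_def)
qed

lemma tree_class_eqD:
  assumes "rooted_tree S" "rooted_tree T" "tree_class S = tree_class T"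
  shows "tree_iso S T"
  using assms tree_rep_tree_class [of S] tree_rep_tree_class [of T]
  by (metis tree_iso_sym tree_iso_trans root_in_verts)

lemma tree_rep: "rooted_tree (tree_rep c)" "tree_class (tree_rep c) = c"
proof -
  obtain T :: "nat tree" where T: "rooted_tree T" "c = tree_class T"
    by (cases c) (auto simp: tree_class_def)
  show "rooted_tree (tree_rep c)"
    using tree_rep_tree_class(1) [OF T(1)] T(2) by simp
  show "tree_class (tree_rep c) = c"
    using tree_class_eqI [OF tree_rep_tree_class(2) [OF T(1)] root_in_verts [OF T(1)]] T(2) by simp
qed

text \<open>
  An isomorphism of graphs maps roots to roots and restricts to isomorphisms of the trees below
  them.
\<close>

lemma forest_of_iso:
  assumes f: "graph_iso f V E V' E'"
  shows "forest_of V' E' = forest_of V E"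
proof -
  have inj: "inj_on f (roots V E)"
    using f by (auto simp: graph_iso_def bij_betw_def roots_def intro: inj_on_subset)
  have "tree_class (subtree V' E' (f r)) = tree_class (subtree V E r)" if "r \<in> roots V E" for r
    using that root_in_below [OF that]
    by (intro tree_class_eqI [OF subtree_iso [OF f], symmetric]) (simp_all add: roots_def subtree_def)
  then show ?thesis
    unfolding forest_of_def roots_iso [OF f] image_mset_mset_set [OF inj, symmetric]
      image_mset.compositionality
    by (cases "finite (roots V E)") (auto intro!: image_mset_cong)
qed

lemma forest_of_cong: "restr E V = restr E' V \<Longrightarrow> forest_of V E = forest_of V E'"
  by (rule forest_of_iso [where f = id]) (auto simp: graph_iso_def set_eq_iff)

section \<open>Disjoint unions of forest graphs\<close>

lemma below_memD: "v \<in> below V E r \<Longrightarrow> v \<in> V"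
  by (simp add: below_def)

lemma forest_of_union:
  assumes disj: "A \<inter> B = {}" and fin: "finite A" "finite B"
    and no_edge: "\<And>a b. a \<in> A \<Longrightarrow> b \<in> B \<Longrightarrow> (a, b) \<notin> E \<and> (b, a) \<notin> E"
  shows "forest_of (A \<union> B) E = forest_of A E + forest_of B E"
proof -
  have *: "below (C \<union> D) E r = below C E r"
    if r: "r \<in> C" and no_edge': "\<And>a b. a \<in> C \<Longrightarrow> b \<in> D \<Longrightarrow> (b, a) \<notin> E" for C D r
  proof -
    have "v \<in> C \<and> (v, r) \<in> (restr E C)\<^sup>*" if "(v, r) \<in> (restr E (C \<union> D))\<^sup>*" for v
      using that
    proof (induction rule: converse_rtrancl_induct)
      case (step x y)
      then have "(x, y) \<in> restr E C"
        using no_edge' by auto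
      then show ?case
        using step.IH by (meson IntD2 SigmaD1 converse_rtrancl_into_rtrancl)
    qed (use r in simp)
    moreover have "(restr E C)\<^sup>* \<subseteq> (restr E (C \<union> D))\<^sup>*"
      by (intro rtrancl_mono) auto
    ultimately show ?thesis
      by (auto simp: below_def)
  qed
  have roots: "roots (A \<union> B) E = roots A E \<union> roots B E" "roots A E \<inter> roots B E = {}"
    using no_edge disj by (auto simp: roots_def)
  have fin': "finite (roots A E)" "finite (roots B E)"
    using fin by (simp_all add: roots_def)
  have A: "below (A \<union> B) E r = below A E r" if "r \<in> A" for r
    using that no_edge by (intro *) auto
  have B: "below (A \<union> B) E r = below B E r" if "r \<in> B" for r
    using that no_edge * [of r B A] by (auto simp: Un_commute)
  show ?thesis
    unfolding forest_of_def roots(1) mset_set_Union [OF fin' roots(2)] image_mset_union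
    using fin' by (intro arg_cong2 [where f = plus] image_mset_cong)
      (auto simp: subtree_def A B roots_def)
qed

lemma forest_graph_union:
  assumes disj: "A \<inter> B = {}" and A: "forest_graph A E" and B: "forest_graph B E"
    and no_edge: "\<And>a b. a \<in> A \<Longrightarrow> b \<in> B \<Longrightarrow> (a, b) \<notin> E \<and> (b, a) \<notin> E"
  shows "forest_graph (A \<union> B) E"
proof -
  have *: "(x, y) \<in> (restr E C)\<^sup>+"
    if "(x, y) \<in> (restr E (C \<union> D))\<^sup>+" "x \<in> C" "\<And>a b. a \<in> C \<Longrightarrow> b \<in> D \<Longrightarrow> (a, b) \<notin> E" for C D x y
    using that(1)
  proof (induction rule: trancl_induct)
    case (base y)
    then have "(x, y) \<in> restr E C"
      using that(2,3) by auto
    then show ?case ..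
  next
    case (step y z)
    have "y \<in> C"
      using step.IH by (meson IntD2 SigmaD2 tranclD2)
    then have "(y, z) \<in> restr E C"
      using step.hyps that(3) by auto
    with step.IH show ?case
      by (rule trancl_into_trancl)
  qed
  have "(x, x) \<notin> (restr E (A \<union> B))\<^sup>+" for x
  proof
    assume x: "(x, x) \<in> (restr E (A \<union> B))\<^sup>+"
    then have "x \<in> A \<union> B"
      by (meson IntD2 SigmaD1 tranclD)
    then show False
      using * [of x x A B] * [of x x B A] x no_edge forest_graphD(3) [OF A] forest_graphD(3) [OF B]
      by (auto simp: acyclic_def Un_commute)
  qed
  moreover have "single_valued (restr E (A \<union> B))"
    unfolding single_valued_def
  proof (intro allI impI)
    fix x y z
    assume "(x, y) \<in> restr E (A \<union> B)" "(x, z) \<in> restr E (A \<union> B)"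
    then show "y = z"
      using no_edge forest_graphD(2) [OF A, of x y z] forest_graphD(2) [OF B, of x y z] by blast
  qed
  ultimately show ?thesis
    using forest_graphD(1) [OF A] forest_graphD(1) [OF B]
    by (simp add: forest_graph_def acyclic_def)
qed

definition sum_edges :: "('v \<times> 'v) set \<Rightarrow> ('w \<times> 'w) set \<Rightarrow> (('v + 'w) \<times> ('v + 'w)) set" where
  "sum_edges E E' = map_prod Inl Inl ` E \<union> map_prod Inr Inr ` E'"

lemma sum_edges_simps [simp]:
  "(Inl u, Inl v) \<in> sum_edges E E' \<longleftrightarrow> (u, v) \<in> E"
  "(Inr u', Inr v') \<in> sum_edges E E' \<longleftrightarrow> (u', v') \<in> E'"
  "(Inl u, Inr v') \<notin> sum_edges E E'"
  "(Inr u', Inl v) \<notin> sum_edges E E'"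
  by (auto simp: sum_edges_def)

lemma graph_iso_Inl: "graph_iso Inl V E (Inl ` V) (sum_edges E E')"
  by (auto simp: graph_iso_def inj_on_imp_bij_betw)

lemma graph_iso_Inr: "graph_iso Inr V E (Inr ` V) (sum_edges E' E)"
  by (auto simp: graph_iso_def inj_on_imp_bij_betw)

lemma forest_graph_sum:
  assumes "forest_graph V E" "forest_graph V' E'"
  shows "forest_graph (V <+> V') (sum_edges E E')"
  unfolding Plus_def
  by (rule forest_graph_union)
    (use forest_graph_iso [OF graph_iso_Inl assms(1)] forest_graph_iso [OF graph_iso_Inr assms(2)] in auto)

lemma forest_of_sum:
  assumes "finite V" "finite V'"
  shows "forest_of (V <+> V') (sum_edges E E') = forest_of V E + forest_of V' E'"
proof -
  have "forest_of (V <+> V') (sum_edges E E') =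
      forest_of (Inl ` V) (sum_edges E E') + forest_of (Inr ` V') (sum_edges E E')"
    unfolding Plus_def using assms by (intro forest_of_union) auto
  then show ?thesis
    by (simp add: forest_of_iso [OF graph_iso_Inl] forest_of_iso [OF graph_iso_Inr])
qed

section \<open>Forests as isomorphism classes of graphs\<close>

lemma card_tree_rep:
  assumes "rooted_tree T"
  shows "card (verts (tree_rep (tree_class T))) = card (verts T)"
  using tree_rep_tree_class(2) [OF assms] by (auto simp: tree_iso_def dest: bij_betw_same_card)

text \<open>
  The vertices are partitioned by the trees below the roots.
\<close>

lemma forest_size_forest_of:
  assumes V: "forest_graph V E"
  shows "forest_size (forest_of V E) = card V"
proof -
  have "forest_size (forest_of V E) = (\<Sum>r\<in>roots V E. card (verts (tree_rep (tree_class (subtree V E r)))))"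
    by (simp add: forest_size_def forest_of_def image_mset.compositionality o_def sum_unfold_sum_mset)
  also have "\<dots> = (\<Sum>r\<in>roots V E. card (below V E r))"
    by (intro sum.cong refl) (simp add: card_tree_rep rooted_tree_subtree [OF V], simp add: subtree_def)
  also have "\<dots> = card (\<Union>r\<in>roots V E. below V E r)"
    using root_unique [OF V] finite_roots [OF V] finite_subset [OF below_subset forest_graphD(1) [OF V]]
    by (intro card_UN_disjoint [symmetric]) blast+
  finally show ?thesis
    by (simp add: UN_below [OF V])
qed

lemma image_mset_set_eq_bij:
  assumes "finite A" "finite B" "image_mset f (mset_set A) = image_mset g (mset_set B)"
  shows "\<exists>h. bij_betw h A B \<and> (\<forall>a\<in>A. f a = g (h a))"
  using assms
proof (induction A arbitrary: B rule: finite_induct)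
  case empty
  then show ?case
    by (auto simp: bij_betw_def mset_set_empty_iff)
next
  case (insert a A)
  have "f a \<in># image_mset g (mset_set B)"
    using insert by (metis image_mset_add_mset mset_set.insert union_single_eq_member)
  then obtain b where b: "b \<in> B" "f a = g b"
    using insert.prems by auto
  have "mset_set B = add_mset b (mset_set (B - {b}))"
    using mset_set.remove [OF insert.prems(1) b(1)] .
  then have "image_mset f (mset_set A) = image_mset g (mset_set (B - {b}))"
    using insert b by simp
  then obtain h where h: "bij_betw h A (B - {b})" "\<forall>a\<in>A. f a = g (h a)"
    using insert.IH [of "B - {b}"] insert.prems by auto
  have "bij_betw (h(a := b)) A (B - {b})"
    using h(1) insert.hyps by (subst bij_betw_cong [of A _ h]) auto
  moreover have "bij_betw (h(a := b)) {a} {b}"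
    by (simp add: bij_betw_def)
  ultimately have "bij_betw (h(a := b)) (A \<union> {a}) ((B - {b}) \<union> {b})"
    by (rule bij_betw_combine) simp
  moreover have "A \<union> {a} = insert a A" "(B - {b}) \<union> {b} = B"
    using b by auto
  ultimately have "bij_betw (h(a := b)) (insert a A) B"
    by simp
  moreover have "\<forall>x\<in>insert a A. f x = g ((h(a := b)) x)"
    using h(2) b(2) insert.hyps by auto
  ultimately show ?case
    by (intro exI [of _ "h(a := b)"] conjI)
qed

text \<open>
  Equality of the multisets of trees matches the roots such that the trees below matched roots are
  isomorphic. The isomorphisms of these trees fit together, since each vertex lies below exactly one
  root and no edge joins two trees.
\<close>

lemma graph_iso_if_forest_of_eq:
  assumes V: "forest_graph V E" and V': "forest_graph V' E'" and eq: "forest_of V E = forest_of V' E'"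
  shows "\<exists>f. graph_iso f V E V' E'"
proof -
  obtain h where h: "bij_betw h (roots V E) (roots V' E')"
    and h_eq: "\<forall>r\<in>roots V E. tree_class (subtree V E r) = tree_class (subtree V' E' (h r))"
    using image_mset_set_eq_bij [OF finite_roots [OF V] finite_roots [OF V'] eq [unfolded forest_of_def]]
    by (elim exE conjE)
  have h_in: "h r \<in> roots V' E'" if "r \<in> roots V E" for r
    using h that by (auto dest: bij_betwE)
  have "\<forall>r\<in>roots V E. \<exists>f. graph_iso f (below V E r) E (below V' E' (h r)) E'"
  proof
    fix r
    assume r: "r \<in> roots V E"
    then have "tree_iso (subtree V E r) (subtree V' E' (h r))"
      using h_eq h_in by (intro tree_class_eqD rooted_tree_subtree V V') auto
    then obtain f where f: "graph_iso f (below V E r) (restr E (below V E r))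
        (below V' E' (h r)) (restr E' (below V' E' (h r)))"
      unfolding tree_iso_graph_iso subtree_def tree.simps by (elim exE conjE)
    then have "graph_iso f (below V E r) E (below V' E' (h r)) E'"
      by (auto simp: graph_iso_def dest: bij_betwE)
    then show "\<exists>f. graph_iso f (below V E r) E (below V' E' (h r)) E'"
      by (rule exI [of _ f])
  qed
  then obtain F where F': "\<forall>r\<in>roots V E. graph_iso (F r) (below V E r) E (below V' E' (h r)) E'"
    by (rule bchoice [THEN exE])
  note F = bspec [OF F']
  define root_of where "root_of v = (SOME r. r \<in> roots V E \<and> v \<in> below V E r)" for v
  have root_of: "root_of v \<in> roots V E" "v \<in> below V E (root_of v)" if "v \<in> V" for v
  proof -
    have "\<exists>r. r \<in> roots V E \<and> v \<in> below V E r"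
      using root_above [OF V that] by blast
    then have "root_of v \<in> roots V E \<and> v \<in> below V E (root_of v)"
      unfolding root_of_def by (rule someI_ex)
    then show "root_of v \<in> roots V E" "v \<in> below V E (root_of v)"
      by auto
  qed
  have root_of_eq: "root_of v = r" if "r \<in> roots V E" "v \<in> below V E r" for v r
  proof -
    have "v \<in> V"
      using that(2) by (rule below_memD)
    then show ?thesis
      by (intro root_unique [OF V root_of(1) that(1) root_of(2) that(2)])
  qed
  define f where "f v = F (root_of v) v" for v
  have f_in: "f v \<in> below V' E' (h (root_of v))" if "v \<in> V" for v
    using F [OF root_of(1) [OF that]] root_of(2) [OF that] by (auto simp: f_def graph_iso_def dest: bij_betwE)
  have f_V': "f v \<in> V'" if "v \<in> V" for v
    using f_in [OF that] by (rule below_memD)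
  have root_of_f: "root_of u = root_of v" if "u \<in> V" "v \<in> V" "f v \<in> below V' E' (h (root_of u))" for u v
  proof -
    have "h (root_of u) = h (root_of v)"
      by (rule root_unique [OF V' h_in h_in that(3) f_in]) (rule root_of that)+
    then show ?thesis
      using h by (intro inj_onD [of h "roots V E"] root_of that) (simp_all add: bij_betw_def)
  qed
  have "graph_iso f V E V' E'"
    unfolding graph_iso_def
  proof (intro conjI ballI)
    show "bij_betw f V V'"
      unfolding bij_betw_def
    proof
      show "inj_on f V"
      proof (rule inj_onI)
        fix u v
        assume uv: "u \<in> V" "v \<in> V" "f u = f v"
        then have "root_of u = root_of v"
          using root_of_f [of u v] f_in [of u] by simp
        then show "u = v"
          using uv F [OF root_of(1) [OF uv(1)]] root_of(2) [OF uv(1)] root_of(2) [OF uv(2)]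
          by (auto simp: f_def graph_iso_def bij_betw_def dest: inj_onD)
      qed
      show "f ` V = V'"
      proof
        show "f ` V \<subseteq> V'"
          using f_V' by blast
        show "V' \<subseteq> f ` V"
        proof
          fix w
          assume "w \<in> V'"
          then obtain s where s: "s \<in> roots V' E'" "w \<in> below V' E' s"
            using root_above [OF V'] by blast
          then obtain r where r: "r \<in> roots V E" "s = h r"
            using h by (auto simp: bij_betw_def)
          obtain v where "v \<in> below V E r" "w = F r v"
            using graph_iso_image [OF F [OF r(1)]] s r by blast
          then show "w \<in> f ` V"
            using root_of_eq [OF r(1), of v] below_subset [of V E r] by (auto simp: f_def image_iff)
        qed
      qed
    qed
    fix u v
    assume uv: "u \<in> V" "v \<in> V"
    show "(u, v) \<in> E \<longleftrightarrow> (f u, f v) \<in> E'"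
    proof (cases "root_of u = root_of v")
      case True
      then show ?thesis
        using F [OF root_of(1) [OF uv(1)]] root_of(2) [OF uv(1)] root_of(2) [OF uv(2)]
        by (simp add: f_def graph_iso_def)
    next
      case False
      have "(u, v) \<notin> E"
      proof
        assume "(u, v) \<in> E"
        then have "v \<in> below V E (root_of u)"
          using below_edge [OF V root_of(1) [OF uv(1)], of u v] uv root_of(2) [OF uv(1)] by simp
        with False show False
          using root_of_eq [OF root_of(1) [OF uv(1)], of v] by simp
      qed
      moreover have "(f u, f v) \<notin> E'"
      proof
        assume "(f u, f v) \<in> E'"
        then have "f v \<in> below V' E' (h (root_of u))"
          using below_edge [OF V' h_in [OF root_of(1) [OF uv(1)]], of "f u" "f v"] f_in [OF uv(1)]
            f_V' [OF uv(1)] f_V' [OF uv(2)] by simp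
        with False show False
          using root_of_f [OF uv] by simp
      qed
      ultimately show ?thesis
        by simp
    qed
  qed
  then show ?thesis
    by (rule exI [of _ f])
qed

lemma nat_copy_graph:
  assumes V: "forest_graph V E"
  shows "\<exists>E' :: (nat \<times> nat) set. forest_graph {..<card V} E' \<and> forest_of {..<card V} E' = forest_of V E"
proof -
  obtain f where f: "bij_betw f V {0..<card V}"
    using ex_bij_betw_finite_nat [OF forest_graphD(1) [OF V]] by blast
  then have "graph_iso f V E {..<card V} (map_prod f f ` restr E V)"
    using graph_iso_map_prod [of f V E] by (simp add: bij_betw_def lessThan_atLeast0)
  then show ?thesis
    using forest_graph_iso [of f V E] V forest_of_iso [of f V E]
    by (intro exI [of _ "map_prod f f ` restr E V"]) simp
qed

lemma forest_of_empty [simp]: "forest_of {} E = {#}"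
  by (simp add: forest_of_def roots_def)

lemma forest_graph_empty [simp]: "forest_graph {} E"
  by (simp add: forest_graph_def acyclic_def)

lemma ex_forest_graph:
  "\<exists>E :: (nat \<times> nat) set. forest_graph {..<forest_size F} E \<and> forest_of {..<forest_size F} E = F"
proof (induction F)
  case empty
  show ?case
    using forest_graph_empty by (intro exI [of _ "{}"]) (simp add: forest_size_def)
next
  case (add c F)
  let ?T = "tree_rep c"
  obtain E :: "(nat \<times> nat) set" where E: "forest_graph {..<forest_size F} E"
    "forest_of {..<forest_size F} E = F"
    using add.IH by blast
  have T: "rooted_tree ?T" "forest_of (verts ?T) (edges ?T) = {#c#}"
    using tree_rep [of c] by (simp_all add: forest_of_rooted_tree)
  let ?V = "verts ?T <+> {..<forest_size F}" and ?E = "sum_edges (edges ?T) E"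
  have V: "forest_graph ?V ?E"
    by (intro forest_graph_sum rooted_tree_forest_graph(1) T(1) E(1))
  have F: "forest_of ?V ?E = add_mset c F"
    using forest_graphD(1) [OF rooted_tree_forest_graph(1) [OF T(1)]]
    by (subst forest_of_sum) (simp_all add: T(2) E(2))
  show ?case
    using nat_copy_graph [OF V] forest_size_forest_of [OF V] by (simp add: F)
qed

lemma forest_cases:
  obtains V :: "nat set" and E where "forest_graph V E" "F = forest_of V E"
  using ex_forest_graph [of F] by metis

lemma forest_of_eq_empty_iff:
  assumes "forest_graph V E"
  shows "forest_of V E = {#} \<longleftrightarrow> V = {}"
  using forest_size_forest_of [OF assms] forest_graphD(1) [OF assms] by (auto simp: forest_size_def)

lemma forest_size_zero_iff: "forest_size F = 0 \<longleftrightarrow> F = {#}"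
proof -
  obtain V :: "nat set" and E where V: "forest_graph V E" "F = forest_of V E"
    by (rule forest_cases)
  show ?thesis
    using forest_graphD(1) [OF V(1)]
    by (simp add: V(2) forest_of_eq_empty_iff [OF V(1)] forest_size_forest_of [OF V(1)])
qed

lemma forest_size_add: "forest_size (F + G) = forest_size F + forest_size G"
  by (simp add: forest_size_def)

lemma finite_forest_size: "finite {F. forest_size F = n}"
proof (rule finite_subset)
  show "{F. forest_size F = n} \<subseteq> forest_of {..<n} ` Pow ({..<n} \<times> {..<n})"
  proof
    fix F
    assume "F \<in> {F. forest_size F = n}"
    then obtain E :: "(nat \<times> nat) set" where "F = forest_of {..<n} E"
      using ex_forest_graph [of F] by (metis mem_Collect_eq)
    moreover have "forest_of {..<n} E = forest_of {..<n} (restr E {..<n})"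
      by (rule forest_of_cong) blast
    ultimately show "F \<in> forest_of {..<n} ` Pow ({..<n} \<times> {..<n})"
      by blast
  qed
qed simp

section \<open>The coproduct of forests\<close>

text \<open>
  These sets are the parts that remain at the roots when a forest is cut, and they are the
  submodules, without the base point, when the forest comes from a module.
\<close>

definition upsets :: "'v set \<Rightarrow> ('v \<times> 'v) set \<Rightarrow> 'v set set" where
  "upsets V E = {U. U \<subseteq> V \<and> (\<forall>v\<in>U. \<forall>w\<in>V. (v, w) \<in> E \<longrightarrow> w \<in> U)}"

definition graph_cop :: "'v set \<Rightarrow> ('v \<times> 'v) set \<Rightarrow> (forest \<times> forest) multiset" where
  "graph_cop V E = image_mset (\<lambda>U. (forest_of (V - U) E, forest_of U E)) (mset_set (upsets V E))"

lemma upsetsI: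
  "U \<subseteq> V \<Longrightarrow> (\<And>v w. v \<in> U \<Longrightarrow> w \<in> V \<Longrightarrow> (v, w) \<in> E \<Longrightarrow> w \<in> U) \<Longrightarrow> U \<in> upsets V E"
  by (simp add: upsets_def)

lemma upsetsD:
  "U \<in> upsets V E \<Longrightarrow> U \<subseteq> V"
  "U \<in> upsets V E \<Longrightarrow> v \<in> U \<Longrightarrow> w \<in> V \<Longrightarrow> (v, w) \<in> E \<Longrightarrow> w \<in> U"
  by (simp_all add: upsets_def)

lemma finite_upsets: "finite V \<Longrightarrow> finite (upsets V E)"
  by (rule finite_subset [of _ "Pow V"]) (auto simp: upsets_def)

lemma upsets_iso:
  assumes f: "graph_iso f V E V' E'"
  shows "upsets V' E' = (`) f ` upsets V E"
proof
  show "upsets V' E' \<subseteq> (`) f ` upsets V E"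
  proof
    fix U'
    assume U': "U' \<in> upsets V' E'"
    define U where "U = {v \<in> V. f v \<in> U'}"
    have "U' = f ` U"
      using U' graph_iso_image [OF f] by (auto simp: U_def upsets_def)
    moreover have "w \<in> U" if "v \<in> U" "w \<in> V" "(v, w) \<in> E" for v w
    proof -
      have "(f v, f w) \<in> E'" "f w \<in> V'" "f v \<in> U'"
        using f that graph_iso_image [OF f] by (auto simp: U_def graph_iso_def)
      then show ?thesis
        using U' that(2) unfolding U_def upsets_def by blast
    qed
    then have "U \<in> upsets V E"
      unfolding upsets_def U_def by blast
    ultimately show "U' \<in> (`) f ` upsets V E"
      by (rule image_eqI)
  qed
  show "(`) f ` upsets V E \<subseteq> upsets V' E'"
  proof
    fix U'
    assume "U' \<in> (`) f ` upsets V E"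
    then obtain U where U: "U' = f ` U" "U \<in> upsets V E"
      by blast
    have up: "w \<in> U" if "v \<in> U" "w \<in> V" "(f v, f w) \<in> E'" for v w
    proof -
      have "v \<in> V"
        using U(2) that(1) unfolding upsets_def by blast
      then have "(v, w) \<in> E"
        using f that by (simp add: graph_iso_def)
      then show ?thesis
        using U(2) that unfolding upsets_def by blast
    qed
    have "U \<subseteq> V"
      using U(2) by (simp add: upsets_def)
    then show "U' \<in> upsets V' E'"
      unfolding upsets_def U(1) graph_iso_image [OF f, symmetric] using up by blast
  qed
qed

lemma graph_cop_iso:
  assumes f: "graph_iso f V E V' E'"
  shows "graph_cop V' E' = graph_cop V E"
proof -
  have inj: "inj_on f V"
    using f by (simp add: graph_iso_def bij_betw_def)
  then have "inj_on ((`) f) (upsets V E)"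
    by (intro inj_on_subset [OF inj_on_image_Pow]) (auto simp: upsets_def)
  then have "graph_cop V' E' = image_mset (\<lambda>U. (forest_of (V' - f ` U) E', forest_of (f ` U) E'))
      (mset_set (upsets V E))"
    by (simp add: graph_cop_def upsets_iso [OF f] image_mset_mset_set [symmetric]
        image_mset.compositionality o_def)
  also have "\<dots> = graph_cop V E"
  proof (cases "finite (upsets V E)")
    case True
    have eq: "(forest_of (V' - f ` U) E', forest_of (f ` U) E') = (forest_of (V - U) E, forest_of U E)"
      if "U \<in> upsets V E" for U
    proof -
      have U: "U \<subseteq> V"
        using that by (simp add: upsets_def)
      have "V' - f ` U = f ` (V - U)"
        using inj_on_image_set_diff [OF inj, of V U] U graph_iso_image [OF f] by auto
      then show ?thesis
        using forest_of_iso [OF graph_iso_subset [OF f U]]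
          forest_of_iso [OF graph_iso_subset [OF f, of "V - U"]] by simp
    qed
    show ?thesis
      unfolding graph_cop_def by (rule image_mset_cong, rule eq) (use True in simp)
  qed (simp add: graph_cop_def)
  finally show ?thesis .
qed

text \<open>
  The coproduct is computed on some graph; by \<open>forest_cop_forest_of\<close> every graph gives the same result.
\<close>

definition forest_cop :: "forest \<Rightarrow> (forest \<times> forest) multiset" where
  "forest_cop F = graph_cop {..<forest_size F}
     (SOME E. forest_graph {..<forest_size F} E \<and> forest_of {..<forest_size F} E = F)"

lemma forest_cop_forest_of:
  assumes V: "forest_graph V E"
  shows "forest_cop (forest_of V E) = graph_cop V E"
proof -
  let ?F = "forest_of V E"
  define E' :: "(nat \<times> nat) set" where
    "E' = (SOME E. forest_graph {..<forest_size ?F} E \<and> forest_of {..<forest_size ?F} E = ?F)"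
  have E': "forest_graph {..<forest_size ?F} E' \<and> forest_of {..<forest_size ?F} E' = ?F"
    unfolding E'_def by (rule someI_ex [OF ex_forest_graph])
  have "\<exists>f. graph_iso f {..<forest_size ?F} E' V E"
    by (rule graph_iso_if_forest_of_eq) (simp_all add: E' V)
  then obtain f where "graph_iso f {..<forest_size ?F} E' V E"
    by (rule exE)
  then show ?thesis
    unfolding forest_cop_def E'_def [symmetric] by (rule graph_cop_iso [symmetric])
qed

lemma mset_set_Sigma:
  assumes "finite A" "\<And>a. a \<in> A \<Longrightarrow> finite (B a)"
  shows "mset_set (Sigma A B) = (\<Sum>a\<in>#mset_set A. image_mset (Pair a) (mset_set (B a)))"
  using assms
proof (induction A rule: finite_induct)
  case (insert a A)
  have "Sigma (insert a A) B = Pair a ` B a \<union> Sigma A B"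
    by auto
  moreover have "mset_set (Pair a ` B a \<union> Sigma A B) = mset_set (Pair a ` B a) + mset_set (Sigma A B)"
    using insert by (intro mset_set_Union) auto
  moreover have "mset_set (Pair a ` B a) = image_mset (Pair a) (mset_set (B a))"
    by (rule image_mset_mset_set [symmetric]) (simp add: inj_on_def)
  moreover have "mset_set (Sigma A B) = (\<Sum>a\<in>#mset_set A. image_mset (Pair a) (mset_set (B a)))"
    using insert.prems by (intro insert.IH) simp
  ultimately show ?case
    using insert.hyps by simp
qed simp

lemma image_mset_sum_mset: "image_mset g (\<Sum>a\<in>#M. F a) = (\<Sum>a\<in>#M. image_mset g (F a))"
  by (induction M) auto

lemma sum_mset_Sigma:
  assumes "finite A" "\<And>a. a \<in> A \<Longrightarrow> finite (B a)"
  shows "(\<Sum>a\<in>#mset_set A. image_mset (\<lambda>b. k a b) (mset_set (B a))) =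
    image_mset (\<lambda>(a, b). k a b) (mset_set (Sigma A B))"
  by (simp add: mset_set_Sigma [OF assms] image_mset_sum_mset image_mset.compositionality o_def)

text \<open>
  Both sides sum over the chains of two parent-closed sets: on the left the smaller set \<open>U\<close> is chosen
  first and then a set \<open>W\<close> outside of it, on the right the larger set \<open>U \<union> W\<close> comes first.
\<close>

lemma forest_cop_coassoc:
  "(\<Sum>p\<in>#forest_cop F. image_mset (\<lambda>q. (fst q, snd q, snd p)) (forest_cop (fst p))) =
   (\<Sum>p\<in>#forest_cop F. image_mset (\<lambda>q. (fst p, fst q, snd q)) (forest_cop (snd p)))"
proof -
  obtain V :: "nat set" and E where V: "forest_graph V E" and F: "F = forest_of V E"
    by (rule forest_cases)
  have fin: "finite V" "finite (upsets V E)"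
    using forest_graphD(1) [OF V] finite_upsets by auto
  have sub: "forest_graph W E" "finite (upsets W E)" if "W \<subseteq> V" for W
    using forest_graph_subset [OF V that] finite_upsets forest_graphD(1) by blast+
  have up: "U \<subseteq> V" if "U \<in> upsets V E" for U
    using that by (simp add: upsets_def)
  let ?A = "Sigma (upsets V E) (\<lambda>U. upsets (V - U) E)" and ?B = "Sigma (upsets V E) (\<lambda>U. upsets U E)"
  let ?h = "\<lambda>(U, W). (U \<union> W, U)"
  have bij: "bij_betw ?h ?A ?B"
  proof (rule bij_betw_byWitness [where f' = "\<lambda>(U, W). (W, U - W)"])
    show "?h ` ?A \<subseteq> ?B" "(\<lambda>(U, W). (W, U - W)) ` ?B \<subseteq> ?A"
      by (fastforce simp: upsets_def)+
  qed (auto simp: upsets_def)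
  have "(\<Sum>p\<in>#forest_cop F. image_mset (\<lambda>q. (fst q, snd q, snd p)) (forest_cop (fst p))) =
      (\<Sum>U\<in>#mset_set (upsets V E). image_mset (\<lambda>W. (forest_of (V - U - W) E, forest_of W E, forest_of U E))
        (mset_set (upsets (V - U) E)))"
    unfolding F forest_cop_forest_of [OF V] graph_cop_def image_mset.compositionality o_def
    using fin sub by (intro arg_cong [where f = sum_mset] image_mset_cong)
      (simp add: forest_cop_forest_of graph_cop_def image_mset.compositionality o_def)
  also have "\<dots> = image_mset (\<lambda>(U, W). (forest_of (V - U - W) E, forest_of W E, forest_of U E)) (mset_set ?A)"
    using fin sub by (intro sum_mset_Sigma) auto
  also have "\<dots> = image_mset (\<lambda>(U, W). (forest_of (V - U) E, forest_of (U - W) E, forest_of W E))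
      (image_mset ?h (mset_set ?A))"
    unfolding image_mset.compositionality
  proof (rule image_mset_cong)
    fix p
    assume "p \<in># mset_set ?A"
    then have "p \<in> ?A"
      using elem_mset_set [of ?A p] by (metis empty_iff mset_set.infinite set_mset_empty)
    then obtain U W where p: "p = (U, W)" "W \<subseteq> V - U"
      by (auto simp: upsets_def)
    have "V - U - W = V - (U \<union> W)" "U \<union> W - U = W"
      using p by auto
    then show "(case p of (U, W) \<Rightarrow> (forest_of (V - U - W) E, forest_of W E, forest_of U E)) =
      ((\<lambda>(U, W). (forest_of (V - U) E, forest_of (U - W) E, forest_of W E)) \<circ> ?h) p"
      by (simp add: p(1))
  qed
  also have "image_mset ?h (mset_set ?A) = mset_set ?B"
    using bij by (simp add: bij_betw_def image_mset_mset_set)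
  also have "image_mset (\<lambda>(U, W). (forest_of (V - U) E, forest_of (U - W) E, forest_of W E)) (mset_set ?B) =
      (\<Sum>U\<in>#mset_set (upsets V E). image_mset (\<lambda>W. (forest_of (V - U) E, forest_of (U - W) E, forest_of W E))
        (mset_set (upsets U E)))"
    using fin sub up by (intro sum_mset_Sigma [symmetric]) auto
  also have "\<dots> = (\<Sum>p\<in>#forest_cop F. image_mset (\<lambda>q. (fst p, fst q, snd q)) (forest_cop (snd p)))"
    unfolding F forest_cop_forest_of [OF V] graph_cop_def image_mset.compositionality o_def
    using fin sub up by (intro arg_cong [where f = sum_mset] image_mset_cong)
      (simp add: forest_cop_forest_of graph_cop_def image_mset.compositionality o_def)
  finally show ?thesis .
qed

lemma Plus_diff: "(V <+> V') - (U <+> U') = (V - U) <+> (V' - U')"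
  by auto

lemma upsets_sum: "upsets (V <+> V') (sum_edges E E') = (\<lambda>(U, U'). U <+> U') ` (upsets V E \<times> upsets V' E')"
proof
  show "upsets (V <+> V') (sum_edges E E') \<subseteq> (\<lambda>(U, U'). U <+> U') ` (upsets V E \<times> upsets V' E')"
  proof
    fix W
    assume W: "W \<in> upsets (V <+> V') (sum_edges E E')"
    have "x \<in> W \<longleftrightarrow> x \<in> (Inl -` W) <+> (Inr -` W)" for x
      by (cases x) (simp_all add: InlI InrI Plus_def image_iff)
    then have "W = (Inl -` W) <+> (Inr -` W)"
      by (rule set_eqI)
    moreover have "Inl -` W \<in> upsets V E"
      using upsetsD [OF W] by (intro upsetsI) (force, simp add: Plus_def)
    moreover have "Inr -` W \<in> upsets V' E'"
      using upsetsD [OF W] by (intro upsetsI) (force, simp add: Plus_def)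
    ultimately show "W \<in> (\<lambda>(U, U'). U <+> U') ` (upsets V E \<times> upsets V' E')"
      by (intro image_eqI [of _ _ "(Inl -` W, Inr -` W)"]) simp_all
  qed
  show "(\<lambda>(U, U'). U <+> U') ` (upsets V E \<times> upsets V' E') \<subseteq> upsets (V <+> V') (sum_edges E E')"
  proof clarify
    fix U U'
    assume U: "U \<in> upsets V E" and U': "U' \<in> upsets V' E'"
    show "U <+> U' \<in> upsets (V <+> V') (sum_edges E E')"
      using upsetsD [OF U] upsetsD [OF U'] by (intro upsetsI) auto
  qed
qed

text \<open>
  A parent-closed set in a disjoint union of two graphs is a pair of parent-closed sets.
\<close>

lemma forest_cop_add:
  "forest_cop (F + G) = (\<Sum>p\<in>#forest_cop F. image_mset (\<lambda>q. p + q) (forest_cop G))"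
proof -
  obtain V :: "nat set" and E where V: "forest_graph V E" and F: "F = forest_of V E"
    by (rule forest_cases)
  obtain V' :: "nat set" and E' where V': "forest_graph V' E'" and G: "G = forest_of V' E'"
    by (rule forest_cases)
  have fin: "finite V" "finite V'" "finite (upsets V E)" "finite (upsets V' E')"
    using forest_graphD(1) [OF V] forest_graphD(1) [OF V'] finite_upsets by auto
  have fin': "finite W" if "W \<subseteq> V \<or> W \<subseteq> V'" for W
    using that fin finite_subset by blast
  have FG: "F + G = forest_of (V <+> V') (sum_edges E E')"
    by (simp add: F G forest_of_sum fin)
  have inj: "inj_on (\<lambda>(U, U'). U <+> U') (upsets V E \<times> upsets V' E')"
    by (auto simp: inj_on_def set_eq_iff Plus_def)
  have "forest_cop (F + G) = image_mset (\<lambda>(U, U'). (forest_of (V - U) E, forest_of U E) +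
      (forest_of (V' - U') E', forest_of U' E')) (mset_set (upsets V E \<times> upsets V' E'))"
    unfolding FG forest_cop_forest_of [OF forest_graph_sum [OF V V']] graph_cop_def upsets_sum
      image_mset_mset_set [OF inj, symmetric] image_mset.compositionality
  proof (rule image_mset_cong)
    fix p
    assume "p \<in># mset_set (upsets V E \<times> upsets V' E')"
    then have "p \<in> upsets V E \<times> upsets V' E'"
      using fin by simp
    then obtain U U' where p: "p = (U, U')" "U \<subseteq> V" "U' \<subseteq> V'"
      by (auto simp: upsets_def)
    then show "((\<lambda>U. (forest_of ((V <+> V') - U) (sum_edges E E'), forest_of U (sum_edges E E'))) \<circ>
        (\<lambda>(U, U'). U <+> U')) p =
      (case p of (U, U') \<Rightarrow> (forest_of (V - U) E, forest_of U E) + (forest_of (V' - U') E', forest_of U' E'))"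
      by (simp add: Plus_diff forest_of_sum fin')
  qed
  also have "\<dots> = (\<Sum>U\<in>#mset_set (upsets V E). image_mset (\<lambda>U'. (forest_of (V - U) E, forest_of U E) +
      (forest_of (V' - U') E', forest_of U' E')) (mset_set (upsets V' E')))"
    using fin by (intro sum_mset_Sigma [symmetric]) auto
  also have "\<dots> = (\<Sum>p\<in>#forest_cop F. image_mset (\<lambda>q. p + q) (forest_cop G))"
    by (simp add: F G forest_cop_forest_of V V' graph_cop_def image_mset.compositionality o_def)
  finally show ?thesis .
qed

lemma forest_cop_zero: "forest_cop 0 = {#(0, 0)#}"
proof -
  have "upsets {} E = {{}}" for E :: "(nat \<times> nat) set"
    by (auto simp: upsets_def)
  then show ?thesis
    using forest_cop_forest_of [of "{} :: nat set" "{}"] by (simp add: graph_cop_def)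
qed

lemma forest_cop_counit:
  "filter_mset (\<lambda>p. fst p = 0) (forest_cop F) = {#(0, F)#}"
  "filter_mset (\<lambda>p. snd p = 0) (forest_cop F) = {#(F, 0)#}"
proof -
  obtain V :: "nat set" and E where V: "forest_graph V E" and F: "F = forest_of V E"
    by (rule forest_cases)
  have fin: "finite (upsets V E)"
    using forest_graphD(1) [OF V] finite_upsets by auto
  have empty_iff: "forest_of W E = {#} \<longleftrightarrow> W = {}" if "W \<subseteq> V" for W
    by (rule forest_of_eq_empty_iff [OF forest_graph_subset [OF V that]])
  have "{U \<in> upsets V E. forest_of (V - U) E = {#}} = {V}"
    by (auto simp: empty_iff) (auto simp: upsets_def)
  then show "filter_mset (\<lambda>p. fst p = 0) (forest_cop F) = {#(0, F)#}"
    by (simp add: F forest_cop_forest_of V graph_cop_def filter_mset_image_mset filter_mset_mset_set fin)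
  have "{U \<in> upsets V E. forest_of U E = {#}} = {{}}"
    using empty_iff by (auto simp: upsets_def)
  then show "filter_mset (\<lambda>p. snd p = 0) (forest_cop F) = {#(F, 0)#}"
    by (simp add: F forest_cop_forest_of V graph_cop_def filter_mset_image_mset filter_mset_mset_set fin)
qed

lemma forest_size_cop:
  assumes "p \<in># forest_cop F"
  shows "forest_size (fst p) + forest_size (snd p) = forest_size F"
proof -
  obtain V :: "nat set" and E where V: "forest_graph V E" and F: "F = forest_of V E"
    by (rule forest_cases)
  have fin: "finite V" "finite (upsets V E)"
    using forest_graphD(1) [OF V] finite_upsets by auto
  obtain U where U: "U \<in> upsets V E" "p = (forest_of (V - U) E, forest_of U E)"
    using assms fin by (auto simp: F forest_cop_forest_of [OF V] graph_cop_def)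
  then have "U \<subseteq> V"
    by (simp add: upsets_def)
  then show ?thesis
    using fin by (simp add: F U forest_size_forest_of V forest_graph_subset [OF V] card_Diff_subset
        finite_subset card_mono)
qed

section \<open>Admissible cuts\<close>

text \<open>
  The edges that have to be removed in order to separate the part \<open>U\<close> at the root from the rest.
\<close>

definition cut_of :: "'v tree \<Rightarrow> 'v set \<Rightarrow> ('v \<times> 'v) set" where
  "cut_of T U = {(v, w) \<in> edges T. v \<notin> U \<and> w \<in> U}"

lemma path_edges_Cons [simp]: "path_edges (u # v # vs) = insert (u, v) (path_edges (v # vs))"
  by (simp add: path_edges_def)

lemma path_edges_single [simp]: "path_edges [v] = {}" "path_edges [] = {}"
  by (simp_all add: path_edges_def)

lemma path_edges_append:
  "us \<noteq> [] \<Longrightarrow> vs \<noteq> [] \<Longrightarrow> path_edges us \<union> path_edges vs \<union> {(last us, hd vs)} = path_edges (us @ vs)"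
proof (induction us rule: induct_list012)
  case (2 u)
  then show ?case
    by (cases vs) auto
next
  case (3 u u' us)
  have IH: "path_edges (u' # us) \<union> path_edges vs \<union> {(last (u' # us), hd vs)} = path_edges ((u' # us) @ vs)"
    using 3 by blast
  have "path_edges (u # u' # us) \<union> path_edges vs \<union> {(last (u # u' # us), hd vs)} =
      insert (u, u') (path_edges (u' # us) \<union> path_edges vs \<union> {(last (u' # us), hd vs)})"
    by auto
  also have "\<dots> = path_edges ((u # u' # us) @ vs)"
    unfolding IH by simp
  finally show ?case .
qed simp

lemma finite_path_edges: "finite (path_edges vs)"
  by (simp add: path_edges_def)

lemma rtrancl_path:
  assumes "(u, v) \<in> R\<^sup>*"
  shows "\<exists>vs. vs \<noteq> [] \<and> hd vs = u \<and> last vs = v \<and> successively (\<lambda>u v. (u, v) \<in> R) vs"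
  using assms
proof (induction rule: converse_rtrancl_induct)
  case base
  show ?case
    by (intro exI [of _ "[v]"]) simp
next
  case (step x y)
  then obtain vs where "vs \<noteq> []" "hd vs = y" "last vs = v" "successively (\<lambda>u v. (u, v) \<in> R) vs"
    by (elim exE conjE)
  then show ?case
    using step.hyps by (intro exI [of _ "x # vs"]) (simp add: successively_Cons)
qed

lemma path_rtrancl:
  assumes "successively (\<lambda>u v. (u, v) \<in> R) vs" "vs \<noteq> []" "path_edges vs \<inter> C = {}"
  shows "(hd vs, last vs) \<in> (R - C)\<^sup>*"
  using assms
proof (induction vs rule: induct_list012)
  case (3 u v vs)
  then have "(u, v) \<in> R - C" "(v, last (v # vs)) \<in> (R - C)\<^sup>*"
    by simp_all
  then have "(u, last (v # vs)) \<in> (R - C)\<^sup>*"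
    by (rule converse_rtrancl_into_rtrancl)
  then show ?case
    by simp
qed simp_all

lemma path_edge_reachable:
  assumes "successively (\<lambda>u v. (u, v) \<in> R) vs" "(x, y) \<in> path_edges vs"
  shows "(hd vs, x) \<in> R\<^sup>*"
  using assms
proof (induction vs rule: induct_list012)
  case (3 u v vs)
  have uv: "(u, v) \<in> R"
    using "3.prems"(1) by simp
  show ?case
  proof (cases "(x, y) = (u, v)")
    case False
    then have "(v, x) \<in> R\<^sup>*"
      using "3.IH"(2) "3.prems" by auto
    with uv have "(u, x) \<in> R\<^sup>*"
      by (rule converse_rtrancl_into_rtrancl)
    then show ?thesis
      by simp
  qed simp
qed simp_all

locale tree_cuts =
  fixes T :: "'v tree"
  assumes T: "rooted_tree T"
begin

abbreviation "V \<equiv> verts T"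
abbreviation "E \<equiv> edges T"
abbreviation "r \<equiv> root_vertex T"

lemma finite_V: "finite V" and root_in_V: "r \<in> V" and edges_subset: "E \<subseteq> V \<times> V"
  and root_no_parent: "(r, w) \<notin> E" and reach: "v \<in> V \<Longrightarrow> (v, r) \<in> E\<^sup>*"
  using T by (simp_all add: rooted_tree_def)

lemma graph: "forest_graph V E" and restr_E: "restr E V = E"
  using rooted_tree_forest_graph [OF T] by simp_all

lemma parent_unique: "(v, w) \<in> E \<Longrightarrow> (v, w') \<in> E \<Longrightarrow> w = w'"
  using forest_graphD(2) [OF graph, of v w w'] edges_subset by auto

lemma acyclic_E: "acyclic E"
  using forest_graphD(3) [OF graph] by (simp add: restr_E)

text \<open>
  A path that joins a vertex to the root by edges in both directions can be replaced by the ascending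
  path: parents are unique, so after a step down from a vertex the way to the root leads back through
  that vertex.
\<close>

lemma component_root: "component T C r = {v \<in> V. (v, r) \<in> (E - C)\<^sup>*}"
proof -
  let ?R = "(E - C) \<union> (E - C)\<inverse>"
  have "(v, r) \<in> (E - C)\<^sup>*" if "(r, v) \<in> ?R\<^sup>*" for v
    using that
  proof (induction rule: rtrancl_induct)
    case (step x y)
    show ?case
    proof (cases "(x, y) \<in> E - C")
      case True
      from step.IH show ?thesis
      proof (cases rule: converse_rtranclE)
        case base
        then show ?thesis
          using True root_no_parent by blast
      next
        case (step z)
        then show ?thesis
          using True parent_unique [of x y z] by simp
      qed
    next
      case False
      then have "(y, x) \<in> E - C"
        using step.hyps by blast
      then show ?thesis
        using step.IH by (rule converse_rtrancl_into_rtrancl)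
    qed
  qed simp
  moreover have "(r, v) \<in> ?R\<^sup>*" if "(v, r) \<in> (E - C)\<^sup>*" for v
  proof -
    have "(r, v) \<in> ((E - C)\<inverse>)\<^sup>*"
      using that by (simp add: rtrancl_converse)
    moreover have "((E - C)\<inverse>)\<^sup>* \<subseteq> ?R\<^sup>*"
      by (intro rtrancl_mono) simp
    ultimately show ?thesis
      by (rule subsetD [rotated])
  qed
  ultimately show ?thesis
    unfolding component_def by auto
qed

lemma upset_closed:
  assumes U: "U \<in> upsets V E" and "(v, w) \<in> E\<^sup>*" "v \<in> U"
  shows "w \<in> U"
  using assms(2)
proof (induction rule: rtrancl_induct)
  case (step x y)
  then have "y \<in> V"
    using edges_subset by auto
  then show ?case
    using upsetsD(2) [OF U step.IH] step.hyps(2) by simp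
qed (rule assms(3))

lemma root_in_upset:
  assumes U: "U \<in> upsets V E" and "U \<noteq> {}"
  shows "r \<in> U"
proof -
  obtain v where v: "v \<in> U"
    using assms(2) by auto
  then have "v \<in> V"
    using upsetsD(1) [OF U] by auto
  then show ?thesis
    using upset_closed [OF U reach v] by simp
qed

lemma component_cut_of:
  assumes U: "U \<in> upsets V E" and "U \<noteq> {}"
  shows "component T (cut_of T U) r = U"
proof -
  have r: "r \<in> U"
    by (rule root_in_upset [OF assms])
  have "v \<in> U" if "(v, r) \<in> (E - cut_of T U)\<^sup>*" for v
    using that by (induction rule: converse_rtrancl_induct) (use r in \<open>auto simp: cut_of_def\<close>)
  moreover have "v \<in> U \<longrightarrow> (v, r) \<in> (E - cut_of T U)\<^sup>*" if "(v, r) \<in> E\<^sup>*" for v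
    using that
  proof (induction rule: converse_rtrancl_induct)
    case (step x y)
    show ?case
    proof
      assume x: "x \<in> U"
      then have "y \<in> U"
        using step.hyps(1) by (intro upset_closed [OF U _ x]) auto
      moreover have "(x, y) \<in> E - cut_of T U"
        using step.hyps(1) x by (simp add: cut_of_def)
      ultimately show "(x, r) \<in> (E - cut_of T U)\<^sup>*"
        using step.IH by (auto intro: converse_rtrancl_into_rtrancl)
    qed
  qed simp
  ultimately show ?thesis
    unfolding component_root using upsetsD(1) [OF U] reach by auto
qed

text \<open>
  Once an ascending path has entered \<open>U\<close> it cannot leave it.
\<close>

lemma path_meets_cut_once:
  assumes U: "U \<in> upsets V E" and "successively (\<lambda>u v. (u, v) \<in> E) vs"
  shows "(vs \<noteq> [] \<longrightarrow> hd vs \<in> U \<longrightarrow> path_edges vs \<inter> cut_of T U = {}) \<and>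
    card (path_edges vs \<inter> cut_of T U) \<le> 1"
  using assms(2)
proof (induction vs rule: induct_list012)
  case (3 u v vs)
  have uv: "(u, v) \<in> E"
    using "3.prems" by simp
  have IH: "v \<in> U \<Longrightarrow> path_edges (v # vs) \<inter> cut_of T U = {}"
    "card (path_edges (v # vs) \<inter> cut_of T U) \<le> 1"
    using "3.IH"(2) "3.prems" by simp_all
  have step: "v \<in> U" if "u \<in> U"
    using uv that by (intro upset_closed [OF U _ that]) auto
  show ?case
  proof (cases "(u, v) \<in> cut_of T U")
    case True
    then have "u \<notin> U" "v \<in> U"
      by (simp_all add: cut_of_def)
    then have "path_edges (u # v # vs) \<inter> cut_of T U = {(u, v)}"
      using IH(1) True by auto
    then show ?thesis
      using \<open>u \<notin> U\<close> by simp
  next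
    case False
    then show ?thesis
      using IH step by (simp add: Int_insert_left)
  qed
qed simp_all

lemma admissible_cut_of:
  assumes U: "U \<in> upsets V E" "U \<noteq> {}" "U \<noteq> V"
  shows "admissible_cut T (cut_of T U)"
  unfolding admissible_cut_def
proof (intro conjI allI impI)
  obtain v where v: "v \<in> V" "v \<notin> U"
    using U upsetsD(1) [OF U(1)] by auto
  have "v \<in> U \<or> (\<exists>x y. (x, y) \<in> cut_of T U)" if "(v, r) \<in> E\<^sup>*" for v
    using that
    by (induction rule: converse_rtrancl_induct) (use root_in_upset [OF U(1,2)] in \<open>auto simp: cut_of_def\<close>)
  then show "cut_of T U \<noteq> {}"
    using v reach by blast
  show "cut_of T U \<subseteq> E"
    by (auto simp: cut_of_def)
  show "card (path_edges vs \<inter> cut_of T U) \<le> 1" if "leaf_root_path T vs" for vs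
    using path_meets_cut_once [OF U(1), of vs] that by (simp add: leaf_root_path_def)
qed

lemma leaf_below:
  assumes "v \<in> V"
  shows "\<exists>l. leaf T l \<and> (l, v) \<in> E\<^sup>*"
proof -
  have "finite E"
    using finite_V edges_subset finite_subset by blast
  then have "wf E"
    by (intro finite_acyclic_wf acyclic_E)
  then show ?thesis
    using assms
  proof (induction v rule: wf_induct_rule)
    case (less v)
    show ?case
    proof (cases "leaf T v")
      case True
      then show ?thesis
        by auto
    next
      case False
      then obtain u where u: "(u, v) \<in> E"
        using less.prems by (auto simp: leaf_def)
      then obtain l where "leaf T l" "(l, u) \<in> E\<^sup>*"
        using less.IH [OF u] edges_subset by auto
      then show ?thesis
        using u by (auto intro: rtrancl_into_rtrancl)
    qed
  qed
qed

text \<open>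
  If a second edge of the cut were met on the way from \<open>w\<close> up to the root, then a path to the root from
  a leaf below \<open>v\<close> would contain two edges of the cut.
\<close>

lemma cut_edge_component:
  assumes C: "admissible_cut T C" and e: "(v, w) \<in> C"
  shows "v \<notin> component T C r" "w \<in> component T C r"
proof -
  have vw: "(v, w) \<in> E" "v \<in> V" "w \<in> V"
    using C e edges_subset by (auto simp: admissible_cut_def)
  show "v \<notin> component T C r"
  proof
    assume "v \<in> component T C r"
    then have "(v, r) \<in> (E - C)\<^sup>*"
      by (simp add: component_root)
    then show False
    proof (cases rule: converse_rtranclE)
      case base
      then show False
        using vw(1) root_no_parent by simp
    next
      case (step z)
      then show False
        using e parent_unique [OF vw(1), of z] by auto
    qed
  qed
  obtain l where l: "leaf T l" "(l, v) \<in> E\<^sup>*"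
    using leaf_below [OF vw(2)] by (elim exE conjE)
  obtain us where us: "us \<noteq> []" "hd us = l" "last us = v" "successively (\<lambda>u v. (u, v) \<in> E) us"
    using rtrancl_path [OF l(2)] by (elim exE conjE)
  obtain ws where ws: "ws \<noteq> []" "hd ws = w" "last ws = r" "successively (\<lambda>u v. (u, v) \<in> E) ws"
    using rtrancl_path [OF reach [OF vw(3)]] by (elim exE conjE)
  have path: "leaf_root_path T (us @ ws)"
    unfolding leaf_root_path_def using us ws vw l(1) by (simp add: successively_append_iff)
  have edges: "path_edges us \<union> path_edges ws \<union> {(v, w)} = path_edges (us @ ws)"
    using path_edges_append [OF us(1) ws(1)] us(3) ws(2) by simp
  have "path_edges ws \<inter> C = {}"
  proof (rule ccontr)
    assume "path_edges ws \<inter> C \<noteq> {}"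
    then obtain x y where xy: "(x, y) \<in> path_edges ws" "(x, y) \<in> C"
      by (metis Int_iff all_not_in_conv surj_pair)
    have "(w, x) \<in> E\<^sup>*"
      using path_edge_reachable [OF ws(4) xy(1)] ws(2) by simp
    then have "(v, x) \<in> E\<^sup>+"
      using vw(1) by (rule rtrancl_into_trancl2 [rotated])
    then have "x \<noteq> v"
      using acyclic_E by (auto simp: acyclic_def)
    then have "card {(x, y), (v, w)} = 2"
      by simp
    moreover have "card {(x, y), (v, w)} \<le> card (path_edges (us @ ws) \<inter> C)"
      using edges xy e finite_path_edges by (intro card_mono) auto
    ultimately show False
      using C path by (auto simp: admissible_cut_def)
  qed
  then have "(w, r) \<in> (E - C)\<^sup>*"
    using path_rtrancl [OF ws(4,1)] ws(2,3) by simp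
  then show "w \<in> component T C r"
    using vw(3) by (simp add: component_root)
qed

lemma admissible_cut_component:
  assumes C: "admissible_cut T C"
  shows "component T C r \<in> upsets V E" "component T C r \<noteq> {}" "component T C r \<noteq> V"
    "cut_of T (component T C r) = C"
proof -
  show "component T C r \<in> upsets V E"
  proof (rule upsetsI)
    show "component T C r \<subseteq> V"
      by (auto simp: component_def)
    fix v w
    assume v: "v \<in> component T C r" and w: "w \<in> V" and vw: "(v, w) \<in> E"
    have "(v, r) \<in> (E - C)\<^sup>*"
      using v by (simp add: component_root)
    then show "w \<in> component T C r"
    proof (cases rule: converse_rtranclE)
      case base
      then show ?thesis
        using vw root_no_parent by simp
    next
      case (step z)
      then show ?thesis
        using parent_unique [OF vw, of z] w by (simp add: component_root)
    qed
  qed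
  show "component T C r \<noteq> {}"
    using root_in_V by (auto simp: component_root)
  obtain v w where vw: "(v, w) \<in> C" "(v, w) \<in> E"
    using C by (auto simp: admissible_cut_def)
  then show "component T C r \<noteq> V"
    using cut_edge_component(1) [OF C vw(1)] edges_subset by auto
  show "cut_of T (component T C r) = C"
  proof
    show "C \<subseteq> cut_of T (component T C r)"
      using cut_edge_component [OF C] C by (auto simp: cut_of_def admissible_cut_def)
    show "cut_of T (component T C r) \<subseteq> C"
    proof
      fix e
      assume "e \<in> cut_of T (component T C r)"
      then obtain v w where e: "e = (v, w)" "(v, w) \<in> E" "v \<notin> component T C r" "w \<in> component T C r"
        by (auto simp: cut_of_def)
      show "e \<in> C"
      proof (rule ccontr)
        assume "e \<notin> C"
        then have "(v, r) \<in> (E - C)\<^sup>*"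
          using e by (auto simp: component_root intro: converse_rtrancl_into_rtrancl)
        then show False
          using e edges_subset by (auto simp: component_root)
      qed
    qed
  qed
qed

text \<open>
  The parent-closed sets other than \<open>{}\<close> and \<open>V\<close> are the parts \<open>R\<^sub>C\<close> of the admissible cuts \<open>C\<close>.
\<close>

lemma bij_cut_of:
  "bij_betw (cut_of T) (upsets V E - {{}, V}) {C. admissible_cut T C}"
proof (rule bij_betw_byWitness [where f' = "\<lambda>C. component T C r"])
  show "\<forall>U\<in>upsets V E - {{}, V}. component T (cut_of T U) r = U"
    by (simp add: component_cut_of)
  show "\<forall>C\<in>{C. admissible_cut T C}. cut_of T (component T C r) = C"
    by (simp add: admissible_cut_component)
  show "cut_of T ` (upsets V E - {{}, V}) \<subseteq> {C. admissible_cut T C}"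
    by (simp add: image_subset_iff admissible_cut_of)
  show "(\<lambda>C. component T C r) ` {C. admissible_cut T C} \<subseteq> upsets V E - {{}, V}"
    by (simp add: image_subset_iff admissible_cut_component)
qed

lemma relpow_root_unique: "(v, r) \<in> E ^^ m \<Longrightarrow> (v, r) \<in> E ^^ n \<Longrightarrow> m = n"
proof (induction m arbitrary: v n)
  case 0
  have "v = r"
    using "0.prems"(1) by simp
  show ?case
  proof (cases n)
    case (Suc k)
    then have "\<exists>w. (v, w) \<in> E \<and> (w, r) \<in> E ^^ k"
      using "0.prems"(2) by (intro relpow_Suc_D2) simp
    then show ?thesis
      using \<open>v = r\<close> root_no_parent by simp
  qed simp
next
  case (Suc m)
  obtain w where w: "(v, w) \<in> E" "(w, r) \<in> E ^^ m"
    using relpow_Suc_D2 [OF Suc.prems(1)] by (elim exE conjE)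
  have "n \<noteq> 0"
  proof
    assume "n = 0"
    then have "v = r"
      using Suc.prems(2) by simp
    then show False
      using w(1) root_no_parent by simp
  qed
  then obtain k where k: "n = Suc k"
    by (cases n) simp_all
  obtain w' where w': "(v, w') \<in> E" "(w', r) \<in> E ^^ k"
    using relpow_Suc_D2 [OF Suc.prems(2) [unfolded k]] by (elim exE conjE)
  have "w = w'"
    by (rule parent_unique [OF w(1) w'(1)])
  then show ?case
    using Suc.IH [OF w(2), of k] w'(2) k by simp
qed

lemma root_distance_eq: "(v, r) \<in> E ^^ n \<Longrightarrow> root_distance T v = n"
  unfolding root_distance_def by (rule Least_equality) (auto dest: relpow_root_unique)

text \<open>
  If all vertices of \<open>K\<close> are below \<open>s\<close>, then their paths to the root pass through \<open>s\<close>, so that \<open>s\<close> is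
  closest to the root.
\<close>

lemma arg_min_root_distance:
  assumes s: "s \<in> K" "s \<in> V" and K: "\<And>v. v \<in> K \<Longrightarrow> (v, s) \<in> E\<^sup>*"
  shows "arg_min_on (root_distance T) K = s"
proof -
  obtain m where m: "(s, r) \<in> E ^^ m"
    using reach [OF s(2)] rtrancl_imp_relpow by blast
  let ?a = "arg_min_on (root_distance T) K"
  have a: "?a \<in> K" "root_distance T ?a \<le> root_distance T s"
    using arg_min_nat_lemma [of "\<lambda>x. x \<in> K" s "root_distance T"] s(1) by (auto simp: arg_min_on_def)
  obtain k where k: "(?a, s) \<in> E ^^ k"
    using K [OF a(1)] rtrancl_imp_relpow by blast
  then have "root_distance T ?a = k + m"
    using m by (intro root_distance_eq) (auto simp: relpow_add)
  then have "k = 0"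
    using a(2) root_distance_eq [OF m] by simp
  then show ?thesis
    using k by simp
qed

lemma forest_of_upset:
  assumes U: "U \<in> upsets V E" "U \<noteq> {}"
  shows "forest_of U E = {#cut_root T (cut_of T U)#}"
proof -
  have UV: "U \<subseteq> V"
    by (rule upsetsD(1) [OF U(1)])
  have rU: "r \<in> U"
    by (rule root_in_upset [OF U])
  have "v = r" if "v \<in> roots U E" for v
  proof (rule ccontr)
    assume "v \<noteq> r"
    have v: "v \<in> U" "v \<in> V"
      using that UV by (auto simp: roots_def)
    then obtain w where "(v, w) \<in> E"
      using reach \<open>v \<noteq> r\<close> by (meson converse_rtranclE)
    then show False
      using upset_closed [OF U(1) _ v(1), of w] that by (auto simp: roots_def)
  qed
  then have roots: "roots U E = {r}"
    using rU root_no_parent by (auto simp: roots_def)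
  have "below U E r = U"
    using UN_below [OF forest_graph_subset [OF graph UV]] by (simp add: roots)
  moreover have "(E - cut_of T U) \<inter> U \<times> U = restr E U"
    by (auto simp: cut_of_def)
  moreover have "arg_min_on (root_distance T) U = r"
    using UV rU reach by (intro arg_min_root_distance) auto
  ultimately show ?thesis
    by (simp add: forest_of_def roots cut_root_def component_cut_of [OF U] component_tree_def subtree_def)
qed

lemma component_eq:
  assumes "(v, w) \<in> ((E - C) \<union> (E - C)\<inverse>)\<^sup>*"
  shows "component T C v = component T C w"
proof -
  have "sym (((E - C) \<union> (E - C)\<inverse>)\<^sup>*)"
    by (intro sym_rtrancl) (auto simp: sym_def)
  then have "(w, v) \<in> ((E - C) \<union> (E - C)\<inverse>)\<^sup>*"
    using assms by (rule symD)
  with assms show ?thesis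
    unfolding component_def by (auto intro: rtrancl_trans)
qed

text \<open>
  No edge leads out of \<open>U\<close>, and all edges that lead into \<open>U\<close> are cut. What remains of the edges at a
  vertex outside of \<open>U\<close> are the edges of the forest on the complement of \<open>U\<close>.
\<close>

lemma component_pruned:
  assumes U: "U \<in> upsets V E" and s: "s \<in> roots (V - U) E" and v: "v \<in> below (V - U) E s"
  shows "component T (cut_of T U) v = below (V - U) E s"
proof
  let ?W = "V - U" and ?C = "cut_of T U"
  let ?R = "(E - ?C) \<union> (E - ?C)\<inverse>"
  have W: "forest_graph ?W E"
    by (rule forest_graph_subset [OF graph]) auto
  show "component T ?C v \<subseteq> below ?W E s"
  proof
    fix w
    assume "w \<in> component T ?C v"
    then have "(v, w) \<in> ?R\<^sup>*"
      by (simp add: component_def)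
    then show "w \<in> below ?W E s"
    proof (induction rule: rtrancl_induct)
      case (step x y)
      have x: "x \<in> ?W"
        using step.IH by (rule below_memD)
      show ?case
      proof (cases "(x, y) \<in> E - ?C")
        case True
        then have "y \<in> ?W"
          using x edges_subset by (auto simp: cut_of_def)
        then show ?thesis
          using below_edge [OF W s, of x y] x True step.IH by simp
      next
        case False
        then have yx: "(y, x) \<in> E"
          using step.hyps(2) by blast
        then have "y \<in> ?W"
          using x edges_subset upset_closed [OF U, of y x] by auto
        then show ?thesis
          using below_edge [OF W s, of y x] x yx step.IH by simp
      qed
    qed (rule v)
  qed
  have sub: "restr E ?W \<subseteq> E - ?C"
    by (auto simp: cut_of_def)
  have to_root: "(w, s) \<in> (E - ?C)\<^sup>*" if "w \<in> below ?W E s" for w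
    using that rtrancl_mono [OF sub] by (auto simp: below_def)
  show "below ?W E s \<subseteq> component T ?C v"
  proof
    fix w
    assume w: "w \<in> below ?W E s"
    have "(v, s) \<in> ?R\<^sup>*"
      using to_root [OF v] rtrancl_mono [of "E - ?C" ?R] by auto
    moreover have "(s, w) \<in> ((E - ?C)\<inverse>)\<^sup>*"
      using to_root [OF w] by (simp add: rtrancl_converse)
    then have "(s, w) \<in> ?R\<^sup>*"
      using rtrancl_mono [of "(E - ?C)\<inverse>" ?R] by auto
    ultimately have "(v, w) \<in> ?R\<^sup>*"
      by (rule rtrancl_trans)
    then show "w \<in> component T ?C v"
      using below_memD [OF w] by (simp add: component_def)
  qed
qed

lemma pruned_components:
  assumes U: "U \<in> upsets V E" "U \<noteq> {}"
  shows "component T (cut_of T U) ` V - {component T (cut_of T U) r} =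
    below (V - U) E ` roots (V - U) E"
proof -
  let ?W = "V - U" and ?C = "cut_of T U"
  have W: "forest_graph ?W E"
    by (rule forest_graph_subset [OF graph]) auto
  have r: "component T ?C r = U"
    by (rule component_cut_of [OF U])
  show ?thesis
    unfolding r
  proof
    show "component T ?C ` V - {U} \<subseteq> below ?W E ` roots ?W E"
    proof
      fix K
      assume K: "K \<in> component T ?C ` V - {U}"
      then obtain v where v: "v \<in> V" "K = component T ?C v"
        by auto
      have "v \<notin> U"
      proof
        assume "v \<in> U"
        then have "(r, v) \<in> ((E - ?C) \<union> (E - ?C)\<inverse>)\<^sup>*"
          using r by (auto simp: component_def)
        then have "component T ?C v = component T ?C r"
          by (rule component_eq [symmetric])
        then show False
          using K v r by simp
      qed
      then obtain s where s: "s \<in> roots ?W E" "v \<in> below ?W E s"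
        using root_above [OF W, of v] v(1) by auto
      then show "K \<in> below ?W E ` roots ?W E"
        using component_pruned [OF U(1) s] v(2) by simp
    qed
    show "below ?W E ` roots ?W E \<subseteq> component T ?C ` V - {U}"
    proof
      fix K
      assume "K \<in> below ?W E ` roots ?W E"
      then obtain s where s: "s \<in> roots ?W E" "K = below ?W E s"
        by auto
      have "K = component T ?C s"
        using component_pruned [OF U(1) s(1) root_in_below [OF s(1)]] s(2) by simp
      moreover have "s \<in> V" "s \<notin> U" "s \<in> K"
        using s root_in_below [OF s(1)] by (auto simp: roots_def)
      ultimately show "K \<in> component T ?C ` V - {U}"
        by auto
    qed
  qed
qed

lemma forest_of_pruned:
  assumes U: "U \<in> upsets V E" "U \<noteq> {}"
  shows "forest_of (V - U) E = cut_pruned T (cut_of T U)"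
proof -
  let ?W = "V - U" and ?C = "cut_of T U"
  have W: "forest_graph ?W E"
    by (rule forest_graph_subset [OF graph]) auto
  \<comment> \<open>The pruned components form a set, so distinct roots must give distinct components.\<close>
  have inj: "inj_on (below ?W E) (roots ?W E)"
  proof (rule inj_onI)
    fix s s'
    assume s: "s \<in> roots ?W E" "s' \<in> roots ?W E" "below ?W E s = below ?W E s'"
    show "s = s'"
      using root_unique [OF W s(1,2) root_in_below [OF s(1)]] root_in_below [OF s(1)] s(3) by simp
  qed
  have "component_tree T ?C (below ?W E s) = subtree ?W E s" if s: "s \<in> roots ?W E" for s
  proof -
    have "(E - ?C) \<inter> below ?W E s \<times> below ?W E s = restr E (below ?W E s)"
      by (auto simp: cut_of_def below_def)
    moreover have "(v, s) \<in> E\<^sup>*" if "v \<in> below ?W E s" for v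
      using that rtrancl_mono [of "restr E ?W" E] by (auto simp: below_def)
    then have "arg_min_on (root_distance T) (below ?W E s) = s"
      using s root_in_below [OF s] by (intro arg_min_root_distance) (auto simp: roots_def)
    ultimately show ?thesis
      by (simp add: component_tree_def subtree_def)
  qed
  then show ?thesis
    unfolding cut_pruned_def pruned_components [OF U] image_mset_mset_set [OF inj, symmetric]
      image_mset.compositionality forest_of_def
    using finite_roots [OF W] by (intro image_mset_cong) simp
qed

text \<open>
  The two terms of the coproduct of a tree that do not come from admissible cuts belong to the
  parent-closed sets \<open>{}\<close> and \<open>V\<close>.
\<close>

lemma sum_graph_cop:
  "(\<Sum>p\<in>#graph_cop V E. Poly_Mapping.single p (1 :: rat)) =
     Poly_Mapping.single ({#tree_class T#}, {#}) 1 + Poly_Mapping.single ({#}, {#tree_class T#}) 1 +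
     (\<Sum>C | admissible_cut T C. Poly_Mapping.single (cut_pruned T C, {#cut_root T C#}) 1)"
proof -
  let ?s = "\<lambda>U. Poly_Mapping.single (forest_of (V - U) E, forest_of U E) (1 :: rat)"
  have fin: "finite (upsets V E)"
    by (rule finite_upsets [OF finite_V])
  have VU: "{} \<in> upsets V E" "V \<in> upsets V E" "{} \<noteq> V"
    using root_in_V by (auto simp: upsets_def)
  have "(\<Sum>p\<in>#graph_cop V E. Poly_Mapping.single p (1 :: rat)) = (\<Sum>U\<in>upsets V E. ?s U)"
    by (simp add: graph_cop_def image_mset.compositionality o_def sum_unfold_sum_mset)
  also have "\<dots> = (\<Sum>U\<in>{{}, V}. ?s U) + (\<Sum>U\<in>upsets V E - {{}, V}. ?s U)"
    using fin VU by (subst sum.subset_diff [of "{{}, V}"]) (auto simp: add.commute)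
  also have "(\<Sum>U\<in>{{}, V}. ?s U) = Poly_Mapping.single ({#tree_class T#}, {#}) 1 +
      Poly_Mapping.single ({#}, {#tree_class T#}) 1"
    using VU by (simp add: forest_of_rooted_tree [OF T])
  also have "(\<Sum>U\<in>upsets V E - {{}, V}. ?s U) = (\<Sum>U\<in>upsets V E - {{}, V}.
      Poly_Mapping.single (cut_pruned T (cut_of T U), {#cut_root T (cut_of T U)#}) 1)"
    by (intro sum.cong) (simp_all add: forest_of_pruned forest_of_upset)
  also have "\<dots> = (\<Sum>C | admissible_cut T C. Poly_Mapping.single (cut_pruned T C, {#cut_root T C#}) 1)"
    by (rule sum.reindex_bij_betw [OF bij_cut_of])
  finally show ?thesis .
qed

end

section \<open>The graded dual of Kreimer's Hopf algebra\<close>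

lemma tree_comul_eq: "tree_comul c = (\<Sum>p\<in>#forest_cop {#c#}. Poly_Mapping.single p 1)"
proof -
  interpret tree_cuts "tree_rep c"
    by unfold_locales (rule tree_rep)
  have "forest_of V E = {#c#}"
    by (simp add: forest_of_rooted_tree T tree_rep)
  then have "forest_cop {#c#} = graph_cop V E"
    using forest_cop_forest_of [OF graph] by simp
  then show ?thesis
    by (simp add: sum_graph_cop tree_comul_def Let_def tree_rep)
qed

text \<open>
  Both sides are multiplicative in the forest, so that the case of trees suffices.
\<close>

lemma prod_tree_comul: "(\<Prod>c\<in>#F. tree_comul c) = (\<Sum>p\<in>#forest_cop F. Poly_Mapping.single p 1)"
proof (induction F)
  case empty
  show ?case
    using forest_cop_zero by (simp add: zero_prod_def [symmetric])
next
  case (add c F)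
  have "(\<Prod>c\<in>#add_mset c F. tree_comul c) =
      (\<Sum>p\<in>#forest_cop {#c#}. Poly_Mapping.single p 1) * (\<Sum>q\<in>#forest_cop F. Poly_Mapping.single q 1)"
    unfolding tree_comul_eq [of c, symmetric] add.IH [symmetric] by simp
  also have "\<dots> = (\<Sum>p\<in>#forest_cop ({#c#} + F). Poly_Mapping.single p 1)"
    by (simp only: forest_cop_add sum_mset_sum_mset image_mset.compositionality o_def
        sum_mset_times_sum_mset mult_single mult_1)
  finally show ?case
    by simp
qed

interpretation forests: graded_bialgebra forest_cop forest_size
  by unfold_locales
    (fact forest_cop_zero forest_cop_add forest_cop_counit forest_cop_coassoc forest_size_zero_iff
      forest_size_add forest_size_cop finite_forest_size)+

lemma tensor_pairing_linext:
  "tensor_pairing \<alpha> \<beta> u =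
    linext (\<lambda>p. \<alpha> (Poly_Mapping.single (fst p) 1) * \<beta> (Poly_Mapping.single (snd p) 1)) u"
  by (simp add: tensor_pairing_def linext_def case_prod_unfold mult.assoc)

lemma linext_single_zero_mult:
  fixes u :: "'x::comm_monoid_add \<Rightarrow>\<^sub>0 rat"
  shows "linext f (Poly_Mapping.single 0 c * u) = c * linext f u"
  by (simp add: linext_mult)

lemma linext_kreimer_comul:
  "linext h (kreimer_comul x) = linext (\<lambda>F. \<Sum>p\<in>#forest_cop F. h p) x"
  by (simp add: kreimer_comul_def linext_sum linext_single_zero_mult prod_tree_comul linext_sum_mset)
    (simp add: linext_def)

text \<open>
  For each size there are only finitely many forests. Therefore a linear functional vanishes in almost
  all degrees if and only if it vanishes on almost all forests.
\<close>

lemma kreimer_graded_dual_eq: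
  "kreimer_graded_dual = {a. (\<forall>y. a y = linext (\<lambda>F. a (Poly_Mapping.single F 1)) y) \<and>
      finite {F. a (Poly_Mapping.single F 1) \<noteq> 0}}" (is "_ = ?R")
proof
  show "kreimer_graded_dual \<subseteq> ?R"
  proof
    fix a
    assume a: "a \<in> kreimer_graded_dual"
    let ?N = "{n. \<exists>x\<in>kreimer_component n. a x \<noteq> 0}"
    let ?U = "\<Union>n\<in>?N. {F. forest_size F = n}"
    have add: "a (x + y) = a x + a y" and scale: "a (Poly_Mapping.single 0 c * x) = c * a x" for x y c
      using a by (auto simp: kreimer_graded_dual_def)
    have fin: "finite ?N"
      using a by (simp add: kreimer_graded_dual_def)
    have "a 0 = 0"
      using scale [of 0 0] by simp
    then have sum: "a (\<Sum>p\<in>P. f p) = (\<Sum>p\<in>P. a (f p))" for P and f :: "forest \<Rightarrow> kreimer"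
      by (induction P rule: infinite_finite_induct) (simp_all add: add)
    have single: "a (Poly_Mapping.single F c) = c * a (Poly_Mapping.single F 1)" for F c
      using scale [of c "Poly_Mapping.single F 1"] by (simp add: mult_single)
    have "a y = linext (\<lambda>F. a (Poly_Mapping.single F 1)) y" for y
    proof -
      have "a y = a (\<Sum>F\<in>Poly_Mapping.keys y. Poly_Mapping.single F (Poly_Mapping.lookup y F))"
        using poly_mapping_sum_single [of y] by simp
      also have "\<dots> = (\<Sum>F\<in>Poly_Mapping.keys y. Poly_Mapping.lookup y F * a (Poly_Mapping.single F 1))"
        unfolding sum by (intro sum.cong refl single)
      finally show ?thesis
        by (simp add: linext_def)
    qed
    moreover have "finite {F. a (Poly_Mapping.single F 1) \<noteq> 0}"
    proof (rule finite_subset)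
      show "{F. a (Poly_Mapping.single F 1) \<noteq> 0} \<subseteq>
          ?U"
      proof
        fix F
        assume "F \<in> {F. a (Poly_Mapping.single F 1) \<noteq> 0}"
        moreover have "Poly_Mapping.single F 1 \<in> kreimer_component (forest_size F)"
          by (simp add: kreimer_component_def)
        ultimately show "F \<in> ?U"
          by (intro UN_I [of "forest_size F"]) auto
      qed
      show "finite ?U"
        using fin finite_forest_size by simp
    qed
    ultimately show "a \<in> ?R"
      by blast
  qed
  show "?R \<subseteq> kreimer_graded_dual"
  proof
    fix a
    assume "a \<in> ?R"
    then have a: "\<And>y. a y = linext (\<lambda>F. a (Poly_Mapping.single F 1)) y"
      and fin: "finite {F. a (Poly_Mapping.single F 1) \<noteq> 0}"
      by blast+
    define f where "f = (\<lambda>F. a (Poly_Mapping.single F 1))"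
    have a_f: "a = linext f"
      unfolding f_def by (rule ext) (rule a)
    have "{n. \<exists>x\<in>kreimer_component n. linext f x \<noteq> 0} \<subseteq> forest_size ` {F. f F \<noteq> 0}"
    proof
      fix n
      assume "n \<in> {n. \<exists>x\<in>kreimer_component n. linext f x \<noteq> 0}"
      then obtain x where x: "x \<in> kreimer_component n" "linext f x \<noteq> 0"
        by blast
      have "\<exists>F\<in>Poly_Mapping.keys x. f F \<noteq> 0"
      proof (rule ccontr)
        assume "\<not> ?thesis"
        then have "linext f x = 0"
          unfolding linext_def by (intro sum.neutral) simp
        with x(2) show False ..
      qed
      then show "n \<in> forest_size ` {F. f F \<noteq> 0}"
        using x(1) by (auto simp: kreimer_component_def)
    qed
    then have "finite {n. \<exists>x\<in>kreimer_component n. linext f x \<noteq> 0}"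
      by (rule finite_subset) (use fin in \<open>simp add: f_def\<close>)
    then show "a \<in> kreimer_graded_dual"
      unfolding a_f kreimer_graded_dual_def by (simp add: linext_add linext_single_zero_mult)
  qed
qed

lemma kreimer_dual_realisation:
  "dual_realisation forest_cop forest_size kreimer_dual (\<lambda>F. Poly_Mapping.single F 1) (\<lambda>x. x)"
proof
  show "space kreimer_dual = {a. (\<forall>y. a y = linext (a \<circ> (\<lambda>F. Poly_Mapping.single F 1)) y) \<and>
      finite {x. a (Poly_Mapping.single x 1) \<noteq> 0}}"
    unfolding kreimer_graded_dual_eq [symmetric] o_def by (simp add: kreimer_dual_def)
next
  fix a b
  show "mul kreimer_dual a b = (\<lambda>y. linext (forests.conv (a \<circ> (\<lambda>F. Poly_Mapping.single F 1))
      (b \<circ> (\<lambda>F. Poly_Mapping.single F 1))) y)"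
    by (simp add: kreimer_dual_def tensor_pairing_linext linext_kreimer_comul forests.conv_def [abs_def])
next
  show "bialgebra_data.unit kreimer_dual = (\<lambda>y. linext forests.delta y)"
    by (simp add: kreimer_dual_def kreimer_counit_def [abs_def] forests.delta_def [abs_def] linext_if_eq)
next
  fix a
  assume "a \<in> space kreimer_dual"
  then have "a \<in> kreimer_graded_dual"
    by (simp add: kreimer_dual_def)
  then have a: "a y = linext (\<lambda>F. a (Poly_Mapping.single F 1)) y" for y
    unfolding kreimer_graded_dual_eq by blast
  have "a (y * z) = linext (\<lambda>x. linext (\<lambda>x'. a (Poly_Mapping.single (x + x') 1)) z) y" for y z
    unfolding a [of "y * z"] by (rule linext_mult)
  then show "comul kreimer_dual a = (\<lambda>(y, z). linext (\<lambda>x. linext (\<lambda>x'. a (Poly_Mapping.single (x + x') 1)) z) y)"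
    by (simp add: kreimer_dual_def)
next
  fix a
  show "counit kreimer_dual a = a (Poly_Mapping.single 0 1)"
    by (simp add: kreimer_dual_def)
qed simp

section \<open>Nilpotent modules as rooted forests\<close>

definition mod_verts :: "'a tmod \<Rightarrow> 'a set" where
  "mod_verts M = carrier M - {base M}"

text \<open>
  Pairs that involve the base point disappear on restriction to \<open>mod_verts\<close>.
\<close>

definition mod_edges :: "'a tmod \<Rightarrow> ('a \<times> 'a) set" where
  "mod_edges M = {(v, w). w = act M tgen v}"

definition mod_forest :: "'a tmod \<Rightarrow> forest" where
  "mod_forest M = forest_of (mod_verts M) (mod_edges M)"

lemma tmodule_simps:
  assumes "tmodule M"
  shows "base M \<in> carrier M" "m \<in> carrier M \<Longrightarrow> act M a m \<in> carrier M"
    "m \<in> carrier M \<Longrightarrow> act M (a * b) m = act M a (act M b m)"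
    "m \<in> carrier M \<Longrightarrow> act M 1 m = m" "m \<in> carrier M \<Longrightarrow> act M TZero m = base M"
    "act M a (base M) = base M"
proof -
  show *: "base M \<in> carrier M" "m \<in> carrier M \<Longrightarrow> act M a m \<in> carrier M"
    "m \<in> carrier M \<Longrightarrow> act M (a * b) m = act M a (act M b m)"
    "m \<in> carrier M \<Longrightarrow> act M 1 m = m" "m \<in> carrier M \<Longrightarrow> act M TZero m = base M" for a b m
    using assms by (auto simp: tmodule_def zero_tmonoid_def)
  have "act M a (base M) = act M a (act M TZero (base M))"
    using *(1,5) by simp
  also have "\<dots> = act M (a * TZero) (base M)"
    using *(1,3) by simp
  also have "a * TZero = TZero"
    by (cases a) simp_all
  finally show "act M a (base M) = base M"
    using *(1,5) by simp
qed

lemma tgen_power: "tgen ^ n = TPow n"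
  by (induction n) (simp_all add: one_tmonoid_def tgen_def)

lemma act_power:
  assumes M: "tmodule M" and m: "m \<in> carrier M"
  shows "act M (TPow n) m = (act M tgen ^^ n) m"
proof (induction n)
  case 0
  show ?case
    using tmodule_simps(4) [OF M m] by (simp add: one_tmonoid_def)
next
  case (Suc n)
  have "TPow (Suc n) = tgen * TPow n"
    by (simp add: tgen_def)
  then show ?case
    using tmodule_simps(3) [OF M m, of tgen "TPow n"] Suc by simp
qed

lemma act_power_in: "tmodule M \<Longrightarrow> m \<in> carrier M \<Longrightarrow> (act M tgen ^^ n) m \<in> carrier M"
  by (simp add: act_power [symmetric] tmodule_simps)

lemma nilpotent_iff:
  "tmodule M \<Longrightarrow> nilpotent M \<longleftrightarrow> (\<exists>n. \<forall>m\<in>carrier M. (act M tgen ^^ n) m = base M)"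
  by (simp add: nilpotent_def tgen_power act_power)

text \<open>
  On a cycle some positive power of \<open>t\<close> would fix a vertex, but the high powers of \<open>t\<close> map it to the
  base point.
\<close>

lemma forest_graph_mod:
  assumes M: "fin_nil_tmodule M"
  shows "forest_graph (mod_verts M) (mod_edges M)"
proof -
  have mod: "tmodule M"
    using M by (simp add: fin_nil_tmodule_def)
  obtain N where N: "\<forall>m\<in>carrier M. (act M tgen ^^ N) m = base M"
    using M nilpotent_iff [OF mod] by (auto simp: fin_nil_tmodule_def)
  let ?R = "restr (mod_edges M) (mod_verts M)"
  have path: "w = (act M tgen ^^ k) v" if "(v, w) \<in> ?R ^^ k" for v w k
    using that
  proof (induction k arbitrary: w)
    case (Suc k)
    then obtain u where "(v, u) \<in> ?R ^^ k" "(u, w) \<in> ?R"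
      by auto
    then show ?case
      using Suc.IH [of u] by (simp add: mod_edges_def)
  qed simp
  have "(v, v) \<notin> ?R\<^sup>+" for v
  proof
    assume v: "(v, v) \<in> ?R\<^sup>+"
    have "v \<in> mod_verts M"
      using tranclD [OF v] by auto
    then have v': "v \<in> carrier M" "v \<noteq> base M"
      by (simp_all add: mod_verts_def)
    obtain k where k: "k > 0" "(v, v) \<in> ?R ^^ k"
      using v by (auto simp: trancl_power)
    have fix_k: "(act M tgen ^^ k) v = v"
      using path [OF k(2)] by simp
    have "((act M tgen ^^ k) ^^ i) v = v" for i
      by (induction i) (simp_all add: fix_k)
    then have "(act M tgen ^^ (k * N)) v = v"
      by (simp add: funpow_mult)
    \<comment> \<open>The power \<open>t\<^sup>N\<close> is applied last, so that nilpotency can be used.\<close>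
    moreover have "k * N = N + (k - 1) * N"
      using k(1) by (cases k) simp_all
    ultimately have "(act M tgen ^^ N) ((act M tgen ^^ ((k - 1) * N)) v) = v"
      by (simp add: funpow_add)
    then show False
      using N act_power_in [OF mod v'(1), of "(k - 1) * N"] v'(2) by simp
  qed
  then show ?thesis
    using M by (simp add: forest_graph_def acyclic_def fin_nil_tmodule_def mod_verts_def
        single_valued_def mod_edges_def)
qed

lemma graph_iso_if_tmod_iso:
  assumes M: "tmodule M" and N: "tmodule N" and iso: "tmod_iso M N"
  shows "\<exists>f. graph_iso f (mod_verts M) (mod_edges M) (mod_verts N) (mod_edges N) \<and> bij_betw f (carrier M) (carrier N)
    \<and> f (base M) = base N \<and> (\<forall>m\<in>carrier M. f (act M tgen m) = act N tgen (f m))"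
proof -
  obtain f g where f: "normal_hom M N f" and g: "normal_hom N M g"
    and gf: "\<forall>m\<in>carrier M. g (f m) = m" and fg: "\<forall>n\<in>carrier N. f (g n) = n"
    using iso unfolding tmod_iso_def by (elim exE conjE)
  have f': "f ` carrier M \<subseteq> carrier N" "f (base M) = base N"
    "\<And>a m. m \<in> carrier M \<Longrightarrow> f (act M a m) = act N a (f m)"
    using f by (auto simp: normal_hom_def tmod_hom_def)
  have g': "g ` carrier N \<subseteq> carrier M" "g (base N) = base M"
    using g by (auto simp: normal_hom_def tmod_hom_def)
  have bij: "bij_betw f (carrier M) (carrier N)"
    by (rule bij_betw_byWitness [OF gf fg f'(1) g'(1)])
  have "bij_betw f (mod_verts M) (mod_verts N)"
  proof (rule bij_betw_byWitness [where f' = g])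
    show "\<forall>m\<in>mod_verts M. g (f m) = m" "\<forall>n\<in>mod_verts N. f (g n) = n"
      using gf fg by (simp_all add: mod_verts_def)
    show "f ` mod_verts M \<subseteq> mod_verts N"
      using gf g'(2) f'(1) by (auto simp: mod_verts_def image_subset_iff)
    show "g ` mod_verts N \<subseteq> mod_verts M"
      using fg f'(2) g'(1) by (auto simp: mod_verts_def image_subset_iff)
  qed
  moreover have "(u, v) \<in> mod_edges M \<longleftrightarrow> (f u, f v) \<in> mod_edges N"
    if "u \<in> mod_verts M" "v \<in> mod_verts M" for u v
  proof -
    have "u \<in> carrier M" "v \<in> carrier M" "act M tgen u \<in> carrier M"
      using that tmodule_simps(2) [OF M] by (simp_all add: mod_verts_def)
    then show ?thesis
      using f'(3) [of u tgen] inj_on_eq_iff [of f "carrier M" v "act M tgen u"] bij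
      by (auto simp: mod_edges_def bij_betw_def)
  qed
  ultimately show ?thesis
    using bij f' by (intro exI [of _ f]) (simp add: graph_iso_def)
qed

lemma tmod_homI:
  assumes M: "tmodule M" and N: "tmodule N" and f: "f ` carrier M \<subseteq> carrier N" "f (base M) = base N"
    and t: "\<And>m. m \<in> carrier M \<Longrightarrow> f (act M tgen m) = act N tgen (f m)"
  shows "tmod_hom M N f"
proof -
  have pow: "f ((act M tgen ^^ n) m) = (act N tgen ^^ n) (f m)" if "m \<in> carrier M" for n m
    by (induction n) (simp_all add: t act_power_in [OF M that])
  have "f (act M a m) = act N a (f m)" if m: "m \<in> carrier M" for a m
  proof -
    have "f m \<in> carrier N"
      using f(1) m by auto
    then show ?thesis
      using m by (cases a) (simp_all add: tmodule_simps M N f(2) act_power pow)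
  qed
  then show ?thesis
    using f by (simp add: tmod_hom_def)
qed

text \<open>
  An isomorphism of graphs preserves the vertices without parent, and those are the elements that
  \<open>t\<close> maps to the base point.
\<close>

lemma tmod_hom_if_graph_iso:
  assumes M: "tmodule M" and N: "tmodule N"
    and f: "graph_iso f (mod_verts M) (mod_edges M) (mod_verts N) (mod_edges N)"
  shows "tmod_hom M N (\<lambda>m. if m = base M then base N else f m)" (is "tmod_hom M N ?F")
proof (rule tmod_homI [OF M N])
  have f_in: "f m \<in> mod_verts N" if "m \<in> mod_verts M" for m
    using f that by (auto simp: graph_iso_def dest: bij_betwE)
  show "?F ` carrier M \<subseteq> carrier N"
    using f_in tmodule_simps(1) [OF N] by (auto simp: mod_verts_def)
  show "?F (act M tgen m) = act N tgen (?F m)" if m: "m \<in> carrier M" for m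
  proof (cases "m = base M")
    case True
    then show ?thesis
      by (simp add: tmodule_simps M N)
  next
    case False
    then have mV: "m \<in> mod_verts M"
      using m by (simp add: mod_verts_def)
    show ?thesis
    proof (cases "act M tgen m = base M")
      case True
      have "act N tgen (f m) = base N"
      proof (rule ccontr)
        assume "act N tgen (f m) \<noteq> base N"
        then have "act N tgen (f m) \<in> mod_verts N"
          using f_in [OF mV] tmodule_simps(2) [OF N] by (simp add: mod_verts_def)
        then obtain w where w: "w \<in> mod_verts M" "act N tgen (f m) = f w"
          using graph_iso_image [OF f] by auto
        then have "(f m, f w) \<in> mod_edges N"
          by (simp add: mod_edges_def)
        then have "(m, w) \<in> mod_edges M"
          using f mV w(1) by (simp add: graph_iso_def)
        then show False
          using True w(1) by (simp add: mod_edges_def mod_verts_def)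
      qed
      then show ?thesis
        using True False by simp
    next
      case tm: False
      then have "act M tgen m \<in> mod_verts M"
        using tmodule_simps(2) [OF M m] by (simp add: mod_verts_def)
      moreover have "(m, act M tgen m) \<in> mod_edges M"
        by (simp add: mod_edges_def)
      ultimately have "(f m, f (act M tgen m)) \<in> mod_edges N"
        using f mV by (simp add: graph_iso_def)
      then show ?thesis
        using False tm by (simp add: mod_edges_def)
    qed
  qed
qed simp

lemma normal_homI:
  assumes f: "tmod_hom M N f" and g: "\<And>m. m \<in> carrier M \<Longrightarrow> g (f m) = m"
  shows "normal_hom M N f"
  unfolding normal_hom_def
proof (intro conjI ballI impI f)
  fix n x y
  assume "x \<in> carrier M" "y \<in> carrier M" "f x = n" "f y = n"
  then show "x = y"
    using g [of x] g [of y] by simp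
qed

lemma tmod_iso_if_graph_iso:
  assumes M: "tmodule M" and N: "tmodule N"
    and f: "graph_iso f (mod_verts M) (mod_edges M) (mod_verts N) (mod_edges N)"
  shows "tmod_iso M N"
proof -
  let ?g = "inv_into (mod_verts M) f"
  let ?F = "\<lambda>m. if m = base M then base N else f m" and ?G = "\<lambda>n. if n = base N then base M else ?g n"
  have g: "graph_iso ?g (mod_verts N) (mod_edges N) (mod_verts M) (mod_edges M)"
    by (rule graph_iso_inv [OF f])
  have hom: "tmod_hom M N ?F" "tmod_hom N M ?G"
    by (rule tmod_hom_if_graph_iso [OF M N f] tmod_hom_if_graph_iso [OF N M g])+
  have f_in: "f m \<in> mod_verts N" if "m \<in> mod_verts M" for m
    using f that by (auto simp: graph_iso_def dest: bij_betwE)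
  have g_in: "?g n \<in> mod_verts M" if "n \<in> mod_verts N" for n
    using g that by (auto simp: graph_iso_def dest: bij_betwE)
  have fg: "f (?g n) = n" if "n \<in> mod_verts N" for n
    using that graph_iso_image [OF f] by (intro f_inv_into_f) simp
  have GF: "?G (?F m) = m" if "m \<in> carrier M" for m
    using that f_in [of m] graph_iso_inv_apply [OF f, of m] by (auto simp: mod_verts_def)
  have FG: "?F (?G n) = n" if "n \<in> carrier N" for n
    using that g_in [of n] fg [of n] by (auto simp: mod_verts_def)
  have "normal_hom M N ?F"
    using hom(1) GF by (rule normal_homI)
  moreover have "normal_hom N M ?G"
    using hom(2) FG by (rule normal_homI)
  ultimately show ?thesis
    unfolding tmod_iso_def using GF FG by (intro exI [of _ ?F] exI [of _ ?G]) simp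
qed

text \<open>
  An isomorphism of modules is an isomorphism of their graphs, extended by the base point; and graphs
  are determined up to isomorphism by their forests.
\<close>

lemma mod_forest_eq_iff:
  assumes M: "fin_nil_tmodule M" and N: "fin_nil_tmodule N"
  shows "mod_forest M = mod_forest N \<longleftrightarrow> tmod_iso M N"
proof
  have mods: "tmodule M" "tmodule N"
    using M N by (simp_all add: fin_nil_tmodule_def)
  show "tmod_iso M N" if "mod_forest M = mod_forest N"
  proof -
    have "\<exists>f. graph_iso f (mod_verts M) (mod_edges M) (mod_verts N) (mod_edges N)"
      using that by (intro graph_iso_if_forest_of_eq forest_graph_mod M N) (simp add: mod_forest_def)
    then show ?thesis
      using tmod_iso_if_graph_iso [OF mods] by (elim exE)
  qed
  show "mod_forest M = mod_forest N" if "tmod_iso M N"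
    using graph_iso_if_tmod_iso [OF mods that] unfolding mod_forest_def
    by (elim exE conjE) (rule forest_of_iso [symmetric])
qed

lemma fin_nil_tmodule_iso:
  assumes M: "fin_nil_tmodule M" and N: "tmodule N" and iso: "tmod_iso M N"
  shows "fin_nil_tmodule N"
proof -
  have mod: "tmodule M"
    using M by (simp add: fin_nil_tmodule_def)
  obtain f where f: "bij_betw f (carrier M) (carrier N)" "f (base M) = base N"
    "\<forall>m\<in>carrier M. f (act M tgen m) = act N tgen (f m)"
    using graph_iso_if_tmod_iso [OF mod N iso] by (elim exE conjE)
  obtain k where k: "\<forall>m\<in>carrier M. (act M tgen ^^ k) m = base M"
    using M nilpotent_iff [OF mod] by (auto simp: fin_nil_tmodule_def)
  have pow: "f ((act M tgen ^^ n) m) = (act N tgen ^^ n) (f m)" if "m \<in> carrier M" for n m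
    by (induction n) (simp_all add: f(3) act_power_in [OF mod that])
  have "(act N tgen ^^ k) n = base N" if n: "n \<in> carrier N" for n
  proof -
    obtain m where m: "m \<in> carrier M" "n = f m"
      using f(1) n by (auto simp: bij_betw_def)
    then show ?thesis
      using pow [OF m(1), of k] k f(2) by simp
  qed
  moreover have "finite (carrier N)"
    using bij_betw_finite [OF f(1)] M by (simp add: fin_nil_tmodule_def)
  ultimately show ?thesis
    using N nilpotent_iff [OF N] by (auto simp: fin_nil_tmodule_def)
qed

text \<open>
  The copies of \<open>M\<close> are described by a condition on forests alone, which shows at once that isomorphic
  modules have the same copies, whatever types their carriers have.
\<close>

lemma tmod_copies_eq:
  assumes M: "fin_nil_tmodule M"
  shows "tmod_copies M = {M'. fin_nil_tmodule M' \<and> mod_forest M' = mod_forest M}"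
proof (intro set_eqI iffI)
  fix M' :: "nat tmod"
  assume "M' \<in> tmod_copies M"
  then have M': "tmodule M'" "tmod_iso M M'"
    by (simp_all add: tmod_copies_def)
  have "fin_nil_tmodule M'"
    by (rule fin_nil_tmodule_iso [OF M M'])
  then show "M' \<in> {M'. fin_nil_tmodule M' \<and> mod_forest M' = mod_forest M}"
    using mod_forest_eq_iff [OF M, of M'] M'(2) by simp
next
  fix M' :: "nat tmod"
  assume "M' \<in> {M'. fin_nil_tmodule M' \<and> mod_forest M' = mod_forest M}"
  then have M': "fin_nil_tmodule M'" "mod_forest M = mod_forest M'"
    by simp_all
  then show "M' \<in> tmod_copies M"
    using mod_forest_eq_iff [OF M M'(1)] by (simp add: tmod_copies_def fin_nil_tmodule_def)
qed

text \<open>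
  The vertices of a graph together with one further point \<open>n\<close> form a module, where \<open>t\<close> maps a vertex to
  its parent, or to \<open>n\<close> if it has none. As there are no cycles, the iterates of \<open>t\<close> reach \<open>n\<close>.
\<close>

lemma ex_module_of_forest:
  "\<exists>M :: nat tmod. fin_nil_tmodule M \<and> mod_forest M = F"
proof -
  define n where "n = forest_size F"
  obtain E :: "(nat \<times> nat) set" where E: "forest_graph {..<n} E" "forest_of {..<n} E = F"
    using ex_forest_graph [of F] unfolding n_def by (elim exE conjE)
  define t where "t v = (if v < n \<and> (\<exists>w<n. (v, w) \<in> E) then (SOME w. w < n \<and> (v, w) \<in> E) else n)" for v
  have t_edge: "t v < n \<and> (v, t v) \<in> E" if "v < n" "w < n" "(v, w) \<in> E" for v w
  proof -
    have "(SOME w. w < n \<and> (v, w) \<in> E) < n \<and> (v, SOME w. w < n \<and> (v, w) \<in> E) \<in> E"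
      by (rule someI [of "\<lambda>w. w < n \<and> (v, w) \<in> E" w]) (use that in simp)
    then show ?thesis
      using that by (auto simp: t_def)
  qed
  have t_eq: "t v = w" if "v < n" "w < n" "(v, w) \<in> E" for v w
    using forest_graphD(2) [OF E(1), of v "t v" w] t_edge [OF that] that by simp
  have t_n: "t v = n \<or> (v < n \<and> t v < n \<and> (v, t v) \<in> E)" for v
    using t_edge [of v] by (cases "v < n \<and> (\<exists>w<n. (v, w) \<in> E)") (auto simp: t_def)
  have t_base: "t n = n"
    by (simp add: t_def)
  have pow_base: "(t ^^ k) n = n" for k
    by (induction k) (simp_all add: t_base)
  have "t v \<le> n" for v
    using t_n [of v] by auto
  then have t_le: "(t ^^ k) v \<le> n" if "v \<le> n" for k v
    using that by (induction k) simp_all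
  define M where "M = \<lparr>carrier = {..n}, base = n,
    act = (\<lambda>a v. case a of TZero \<Rightarrow> n | TPow k \<Rightarrow> (t ^^ k) v)\<rparr>"
  have mod: "tmodule M"
    unfolding tmodule_def
  proof (intro conjI allI ballI)
    fix a b m
    assume m: "m \<in> carrier M"
    show "act M a m \<in> carrier M"
      using m t_le by (cases a) (simp_all add: M_def)
    show "act M (a * b) m = act M a (act M b m)"
      by (cases a; cases b) (simp_all add: M_def funpow_add pow_base)
    show "act M 1 m = m" "act M 0 m = base M"
      by (simp_all add: M_def one_tmonoid_def zero_tmonoid_def)
  qed (simp add: M_def)
  have act_t: "act M tgen = t"
    by (simp add: M_def tgen_def fun_eq_iff)
  have "wf ((restr E {..<n})\<inverse>)"
    using E(1) by (intro finite_acyclic_wf_converse forest_graphD(3)) simp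
  then have "\<exists>k. (t ^^ k) v = n" for v
  proof (induction v rule: wf_induct_rule)
    case (less v)
    show ?case
    proof (cases "t v = n")
      case True
      then show ?thesis
        by (intro exI [of _ 1]) simp
    next
      case False
      then have "(t v, v) \<in> (restr E {..<n})\<inverse>"
        using t_n [of v] by auto
      then obtain k where "(t ^^ k) (t v) = n"
        using less.IH [of "t v"] by auto
      then show ?thesis
        by (intro exI [of _ "Suc k"]) (simp add: funpow_Suc_right del: funpow.simps)
    qed
  qed
  then have "\<exists>k. \<forall>v. (t ^^ k v) v = n"
    by (intro choice allI)
  then obtain k where k: "\<forall>v. (t ^^ k v) v = n"
    by (rule exE)
  have "(t ^^ Max (k ` {..n})) v = n" if "v \<le> n" for v
  proof -
    have "k v \<le> Max (k ` {..n})"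
      using that by (intro Max_ge) auto
    then have "Max (k ` {..n}) = (Max (k ` {..n}) - k v) + k v"
      by simp
    then have "(t ^^ Max (k ` {..n})) v = (t ^^ (Max (k ` {..n}) - k v)) ((t ^^ k v) v)"
      by (metis comp_apply funpow_add)
    then show ?thesis
      by (simp add: k pow_base)
  qed
  then have "nilpotent M"
    unfolding nilpotent_iff [OF mod] act_t by (intro exI [of _ "Max (k ` {..n})"]) (simp add: M_def)
  then have M: "fin_nil_tmodule M"
    using mod by (simp add: fin_nil_tmodule_def) (simp add: M_def)
  have V: "mod_verts M = {..<n}"
    by (auto simp: mod_verts_def M_def)
  have "(v, w) \<in> mod_edges M \<longleftrightarrow> (v, w) \<in> E" if "v < n" "w < n" for v w
    using t_n [of v] t_eq [OF that] that by (auto simp: mod_edges_def act_t)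
  then have "restr (mod_edges M) {..<n} = restr E {..<n}"
    by auto
  then have "mod_forest M = F"
    unfolding mod_forest_def V E(2) [symmetric] by (rule forest_of_cong)
  with M show ?thesis
    by (intro exI [of _ M]) simp
qed

lemma copies_of_tmod_class:
  assumes M: "fin_nil_tmodule M"
  shows "copies_of_tmod_class (tmod_class M) = tmod_copies M"
proof -
  obtain M' :: "nat tmod" where M': "fin_nil_tmodule M'" "mod_forest M' = mod_forest M"
    using ex_module_of_forest [of "mod_forest M"] by (elim exE conjE)
  have "tmod_copies M = tmod_copies M'"
    by (simp add: tmod_copies_eq M M')
  then show ?thesis
    unfolding tmod_class_def using M'(1) by (intro Abs_tmod_class_inverse) auto
qed

lemma tmod_class_eqI:
  assumes "fin_nil_tmodule M" "fin_nil_tmodule N" "mod_forest M = mod_forest N"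
  shows "tmod_class M = tmod_class N"
  using assms by (simp add: tmod_class_def tmod_copies_eq)

lemma tmod_rep_tmod_class:
  assumes M: "fin_nil_tmodule M"
  shows "fin_nil_tmodule (tmod_rep (tmod_class M))" "mod_forest (tmod_rep (tmod_class M)) = mod_forest M"
proof -
  obtain M' :: "nat tmod" where M': "fin_nil_tmodule M'" "mod_forest M' = mod_forest M"
    using ex_module_of_forest [of "mod_forest M"] by (elim exE conjE)
  then have "M' \<in> copies_of_tmod_class (tmod_class M)"
    by (simp add: copies_of_tmod_class [OF M] tmod_copies_eq [OF M])
  then have "tmod_rep (tmod_class M) \<in> copies_of_tmod_class (tmod_class M)"
    unfolding tmod_rep_def by (rule someI)
  then show "fin_nil_tmodule (tmod_rep (tmod_class M))" "mod_forest (tmod_rep (tmod_class M)) = mod_forest M"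
    by (simp_all add: copies_of_tmod_class [OF M] tmod_copies_eq [OF M])
qed

definition class_forest :: "tmod_class \<Rightarrow> forest" where
  "class_forest c = mod_forest (tmod_rep c)"

definition forest_class :: "forest \<Rightarrow> tmod_class" where
  "forest_class F = tmod_class (SOME M :: nat tmod. fin_nil_tmodule M \<and> mod_forest M = F)"

lemma class_forest_tmod_class: "fin_nil_tmodule M \<Longrightarrow> class_forest (tmod_class M) = mod_forest M"
  by (simp add: class_forest_def tmod_rep_tmod_class)

lemma tmod_class_eq_forest_class:
  assumes M: "fin_nil_tmodule M"
  shows "tmod_class M = forest_class (mod_forest M)"
proof -
  define M' :: "nat tmod" where "M' = (SOME M'. fin_nil_tmodule M' \<and> mod_forest M' = mod_forest M)"
  have "fin_nil_tmodule M' \<and> mod_forest M' = mod_forest M"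
    unfolding M'_def by (rule someI_ex [OF ex_module_of_forest])
  then show ?thesis
    unfolding forest_class_def M'_def [symmetric] using M by (intro tmod_class_eqI) simp_all
qed

lemma fin_nil_tmod_rep: "fin_nil_tmodule (tmod_rep c)"
  and tmod_class_tmod_rep: "tmod_class (tmod_rep c) = c"
proof -
  obtain M :: "nat tmod" where M: "fin_nil_tmodule M" "c = tmod_class M"
    by (cases c) (auto simp: tmod_class_def)
  show "fin_nil_tmodule (tmod_rep c)"
    using tmod_rep_tmod_class(1) [OF M(1)] M(2) by simp
  then have "tmod_class (tmod_rep c) = tmod_class M"
    by (rule tmod_class_eqI [OF _ M(1)]) (simp add: M(2) tmod_rep_tmod_class(2) [OF M(1)])
  then show "tmod_class (tmod_rep c) = c"
    using M(2) by simp
qed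

lemma forest_class_class_forest [simp]: "forest_class (class_forest c) = c"
  using tmod_class_eq_forest_class [OF fin_nil_tmod_rep [of c]]
  by (simp add: class_forest_def tmod_class_tmod_rep)

lemma class_forest_forest_class [simp]: "class_forest (forest_class F) = F"
proof -
  obtain M :: "nat tmod" where M: "fin_nil_tmodule M" "mod_forest M = F"
    using ex_module_of_forest [of F] by (elim exE conjE)
  then show ?thesis
    using class_forest_tmod_class [OF M(1)] tmod_class_eq_forest_class [OF M(1)] by simp
qed

section \<open>Submodules, quotients and sums\<close>

lemma submodule_quotient:
  assumes M: "fin_nil_tmodule M" and N: "submodule M N"
  shows "fin_nil_tmodule (quotient_tmod M N)"
    "mod_forest (quotient_tmod M N) = forest_of (mod_verts M - (N - {base M})) (mod_edges M)"
proof -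
  let ?Q = "quotient_tmod M N" and ?V = "mod_verts M - (N - {base M})"
  have mod: "tmodule M"
    using M by (simp add: fin_nil_tmodule_def)
  have sub: "N \<subseteq> carrier M" "base M \<in> N" "\<And>a m. m \<in> N \<Longrightarrow> act M a m \<in> N"
    using N by (auto simp: submodule_def)
  have mod': "tmodule ?Q"
    unfolding tmodule_def
  proof (intro conjI allI ballI)
    fix a b m
    assume "m \<in> carrier ?Q"
    then have m: "m \<in> carrier M" "m \<in> N \<Longrightarrow> m = base M"
      using tmodule_simps(1) [OF mod] by (auto simp: quotient_tmod_def)
    show "act ?Q a m \<in> carrier ?Q"
      using tmodule_simps(2) [OF mod m(1)] by (simp add: quotient_tmod_def)
    show "act ?Q (a * b) m = act ?Q a (act ?Q b m)"
    proof (cases "act M b m \<in> N")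
      case True
      then have "act M a (act M b m) \<in> N"
        by (rule sub(3))
      with True show ?thesis
        using tmodule_simps(6) [OF mod] by (simp add: quotient_tmod_def tmodule_simps(3) [OF mod m(1)])
    qed (simp add: quotient_tmod_def tmodule_simps(3) [OF mod m(1)])
    show "act ?Q 1 m = m"
    proof (cases "m \<in> N")
      case True
      have "m = base M"
        by (rule m(2) [OF True])
      then show ?thesis
        using tmodule_simps(6) [OF mod] by (simp add: quotient_tmod_def)
    qed (simp add: quotient_tmod_def tmodule_simps(4) [OF mod m(1)])
    show "act ?Q 0 m = base ?Q"
      using tmodule_simps(5) [OF mod m(1)] by (simp add: quotient_tmod_def zero_tmonoid_def)
  qed (simp add: quotient_tmod_def)
  have carrier: "carrier ?Q \<subseteq> carrier M"
    using tmodule_simps(1) [OF mod] by (auto simp: quotient_tmod_def)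
  have "nilpotent ?Q"
  proof -
    obtain n where "\<forall>m\<in>carrier M. act M (tgen ^ n) m = base M"
      using M by (auto simp: fin_nil_tmodule_def nilpotent_def)
    then have "\<forall>m\<in>carrier ?Q. act ?Q (tgen ^ n) m = base ?Q"
      using carrier sub(2) by (auto simp: quotient_tmod_def)
    then show ?thesis
      unfolding nilpotent_def by (rule exI)
  qed
  then show "fin_nil_tmodule ?Q"
    using mod' M finite_subset [OF carrier] by (simp add: fin_nil_tmodule_def)
  have V: "mod_verts ?Q = ?V"
    using sub(1,2) by (auto simp: mod_verts_def quotient_tmod_def)
  have "(v, w) \<in> mod_edges ?Q \<longleftrightarrow> (v, w) \<in> mod_edges M"
    if "w \<in> ?V" for v w
  proof -
    have "w \<notin> N" "w \<noteq> base M"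
      using that by (auto simp: mod_verts_def)
    then show ?thesis
      by (cases "act M tgen v \<in> N") (auto simp: mod_edges_def quotient_tmod_def)
  qed
  then have E: "restr (mod_edges ?Q) ?V =
      restr (mod_edges M) ?V"
    by auto
  show "mod_forest ?Q = forest_of ?V (mod_edges M)"
    unfolding mod_forest_def V by (rule forest_of_cong [OF E])
qed

lemma submodule_restrict:
  assumes M: "fin_nil_tmodule M" and N: "submodule M N"
  shows "fin_nil_tmodule (restrict_tmod M N)"
    "mod_forest (restrict_tmod M N) = forest_of (N - {base M}) (mod_edges M)"
proof -
  have mod: "tmodule M"
    using M by (simp add: fin_nil_tmodule_def)
  have sub: "N \<subseteq> carrier M" "base M \<in> N" "\<And>a m. m \<in> N \<Longrightarrow> act M a m \<in> N"
    using N by (auto simp: submodule_def)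
  have "tmodule (restrict_tmod M N)"
    using mod sub unfolding tmodule_def restrict_tmod_def by (simp add: subset_iff)
  moreover have "nilpotent (restrict_tmod M N)"
    using M sub(1) unfolding fin_nil_tmodule_def nilpotent_def restrict_tmod_def by auto
  ultimately show "fin_nil_tmodule (restrict_tmod M N)"
    using M finite_subset [OF sub(1)] by (simp add: fin_nil_tmodule_def) (simp add: restrict_tmod_def)
  show "mod_forest (restrict_tmod M N) = forest_of (N - {base M}) (mod_edges M)"
    by (simp add: mod_forest_def mod_verts_def mod_edges_def restrict_tmod_def)
qed

text \<open>
  A set is stable under the monoid if it is stable under \<open>t\<close>, that is, closed under parents, and
  contains the base point.
\<close>

lemma bij_submodules_upsets:
  assumes M: "tmodule M"
  shows "bij_betw (\<lambda>N. N - {base M}) {N. submodule M N} (upsets (mod_verts M) (mod_edges M))"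
proof (rule bij_betw_byWitness [where f' = "insert (base M)"])
  show "\<forall>N\<in>{N. submodule M N}. insert (base M) (N - {base M}) = N"
    by (auto simp: submodule_def)
  show "\<forall>U\<in>upsets (mod_verts M) (mod_edges M). insert (base M) U - {base M} = U"
    by (auto simp: upsets_def mod_verts_def)
  show "(\<lambda>N. N - {base M}) ` {N. submodule M N} \<subseteq> upsets (mod_verts M) (mod_edges M)"
    by (auto simp: submodule_def upsets_def mod_verts_def mod_edges_def)
  show "insert (base M) ` upsets (mod_verts M) (mod_edges M) \<subseteq> {N. submodule M N}"
  proof clarify
    fix U
    assume U: "U \<in> upsets (mod_verts M) (mod_edges M)"
    let ?N = "insert (base M) U"
    have sub: "?N \<subseteq> carrier M"
      using upsetsD(1) [OF U] tmodule_simps(1) [OF M] by (auto simp: mod_verts_def)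
    have t: "act M tgen m \<in> ?N" if "m \<in> ?N" for m
    proof (cases "m = base M \<or> act M tgen m = base M")
      case True
      then show ?thesis
        using tmodule_simps(6) [OF M] by auto
    next
      case False
      then have "m \<in> U" "act M tgen m \<in> mod_verts M"
        using that sub tmodule_simps(2) [OF M] by (auto simp: mod_verts_def)
      then show ?thesis
        using upsetsD(2) [OF U, of m "act M tgen m"] by (simp add: mod_edges_def)
    qed
    have pow: "(act M tgen ^^ k) m \<in> ?N" if "m \<in> ?N" for k m
    proof (induction k)
      case (Suc k)
      then have "act M tgen ((act M tgen ^^ k) m) \<in> ?N"
        by (rule t)
      then show ?case
        by (simp only: funpow.simps comp_apply)
    qed (use that in simp)
    have "act M a m \<in> ?N" if "m \<in> ?N" for a m
    proof -
      have m: "m \<in> carrier M"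
        using that sub by blast
      show ?thesis
      proof (cases a)
        case TZero
        then show ?thesis
          by (simp add: tmodule_simps(5) [OF M m])
      next
        case (TPow k)
        then show ?thesis
          unfolding TPow act_power [OF M m] by (intro pow that)
      qed
    qed
    then show "submodule M ?N"
      using sub by (simp add: submodule_def)
  qed
qed

lemma mod_forest_wedge:
  assumes M: "fin_nil_tmodule M" and N: "fin_nil_tmodule N"
  shows "fin_nil_tmodule (wedge_tmod M N)" "mod_forest (wedge_tmod M N) = mod_forest M + mod_forest N"
proof -
  have mod: "tmodule M" "tmodule N"
    using M N by (simp_all add: fin_nil_tmodule_def)
  let ?W = "wedge_tmod M N"
  have base_W: "base ?W = Inl (base M)"
    by (simp add: wedge_tmod_def)
  have act_W: "act ?W a (Inl m) = Inl (act M a m)"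
    "act ?W a (Inr n) = (if act N a n = base N then Inl (base M) else Inr (act N a n))" for a m n
    by (simp_all add: wedge_tmod_def)
  have carrier_W: "carrier ?W = Inl ` carrier M \<union> Inr ` (carrier N - {base N})"
    by (simp add: wedge_tmod_def)
  have mod': "tmodule ?W"
    unfolding tmodule_def
  proof (intro conjI allI ballI)
    show "base ?W \<in> carrier ?W"
      using tmodule_simps(1) [OF mod(1)] by (simp add: base_W carrier_W)
    fix a b x
    assume x: "x \<in> carrier ?W"
    show "act ?W a x \<in> carrier ?W"
      using x tmodule_simps(1,2) [OF mod(1)] tmodule_simps(2) [OF mod(2)] by (auto simp: carrier_W act_W split: if_splits)
    show "act ?W (a * b) x = act ?W a (act ?W b x)"
      using x tmodule_simps(3,6) [OF mod(1)] tmodule_simps(3,6) [OF mod(2)]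
      by (auto simp: carrier_W act_W split: if_splits)
    show "act ?W 1 x = x"
      using x tmodule_simps(4) [OF mod(1)] tmodule_simps(4) [OF mod(2)] by (auto simp: carrier_W act_W split: if_splits)
    show "act ?W 0 x = base ?W"
      using x tmodule_simps(5) [OF mod(1)] tmodule_simps(5) [OF mod(2)]
      by (auto simp: carrier_W act_W base_W zero_tmonoid_def split: if_splits)
  qed
  have "nilpotent ?W"
  proof -
    obtain k where k: "\<forall>m\<in>carrier M. act M (tgen ^ k) m = base M"
      using M by (auto simp: fin_nil_tmodule_def nilpotent_def)
    obtain l where l: "\<forall>n\<in>carrier N. act N (tgen ^ l) n = base N"
      using N by (auto simp: fin_nil_tmodule_def nilpotent_def)
    have "act M (tgen ^ (k + l)) m = base M" if "m \<in> carrier M" for m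
      using that k tmodule_simps(2) [OF mod(1)] by (simp add: power_add tmodule_simps(3) [OF mod(1)])
    moreover have "act N (tgen ^ (k + l)) n = base N" if "n \<in> carrier N" for n
      using that l tmodule_simps(6) [OF mod(2)] by (simp add: power_add tmodule_simps(3) [OF mod(2)])
    ultimately have "\<forall>x\<in>carrier ?W. act ?W (tgen ^ (k + l)) x = base ?W"
      by (auto simp: carrier_W act_W base_W)
    then show ?thesis
      unfolding nilpotent_def by (rule exI)
  qed
  then show "fin_nil_tmodule ?W"
    using mod' M N by (simp add: fin_nil_tmodule_def carrier_W)
  have fin: "finite (mod_verts M)" "finite (mod_verts N)"
    using M N by (simp_all add: mod_verts_def fin_nil_tmodule_def)
  have V: "mod_verts ?W = mod_verts M <+> mod_verts N"
    by (auto simp: mod_verts_def carrier_W base_W)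
  have E: "restr (mod_edges ?W) (mod_verts M <+> mod_verts N) =
      restr (sum_edges (mod_edges M) (mod_edges N)) (mod_verts M <+> mod_verts N)"
  proof -
    have "(x, y) \<in> mod_edges ?W \<longleftrightarrow> (x, y) \<in> sum_edges (mod_edges M) (mod_edges N)"
      if "x \<in> mod_verts M <+> mod_verts N" "y \<in> mod_verts M <+> mod_verts N" for x y
      using that by (cases x; cases y) (auto simp: mod_edges_def act_W mod_verts_def)
    then show ?thesis
      by auto
  qed
  show "mod_forest ?W = mod_forest M + mod_forest N"
    unfolding mod_forest_def V forest_of_cong [OF E] by (rule forest_of_sum [OF fin])
qed

lemma mod_forest_zero: "fin_nil_tmodule zero_tmod" "mod_forest zero_tmod = {#}"
  by (simp_all add: fin_nil_tmodule_def tmodule_def nilpotent_def zero_tmod_def mod_forest_def mod_verts_def)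

section \<open>The Hall algebra\<close>

text \<open>
  For the submodule \<open>N\<close> with vertices \<open>U\<close>, the quotient has the forest on the complement of \<open>U\<close> and the
  submodule has the forest on \<open>U\<close>: the pairs in the Hall product are the terms of \<open>forest_cop\<close>.
\<close>

lemma hall_mul_eq:
  "hall_mul f g c = forests.conv (f \<circ> forest_class) (g \<circ> forest_class) (class_forest c)"
proof -
  let ?M = "tmod_rep c"
  let ?V = "mod_verts ?M" and ?E = "mod_edges ?M"
  have M: "fin_nil_tmodule ?M"
    by (rule fin_nil_tmod_rep)
  then have mod: "tmodule ?M"
    by (simp add: fin_nil_tmodule_def)
  let ?h = "\<lambda>U. f (forest_class (forest_of (?V - U) ?E)) * g (forest_class (forest_of U ?E))"
  have "hall_mul f g c = (\<Sum>N | submodule ?M N. ?h (N - {base ?M}))"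
    unfolding hall_mul_def Let_def
    by (intro sum.cong refl) (simp add: tmod_class_eq_forest_class submodule_quotient [OF M] submodule_restrict [OF M])
  also have "\<dots> = (\<Sum>U\<in>upsets ?V ?E. ?h U)"
    by (rule sum.reindex_bij_betw [OF bij_submodules_upsets [OF mod]])
  also have "\<dots> = (\<Sum>p\<in>#graph_cop ?V ?E. f (forest_class (fst p)) * g (forest_class (snd p)))"
    by (simp add: graph_cop_def image_mset.compositionality o_def sum_unfold_sum_mset)
  also have "graph_cop ?V ?E = forest_cop (class_forest c)"
    using forest_cop_forest_of [OF forest_graph_mod [OF M]] by (simp add: class_forest_def mod_forest_def)
  finally show ?thesis
    by (simp add: forests.conv_def)
qed

lemma tmod_class_zero: "tmod_class zero_tmod = forest_class 0"
  using tmod_class_eq_forest_class [OF mod_forest_zero(1)] mod_forest_zero(2) by simp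

lemma class_forest_eq_zero_iff: "class_forest c = 0 \<longleftrightarrow> c = forest_class 0"
proof
  assume "class_forest c = 0"
  then have "forest_class (class_forest c) = forest_class 0"
    by (rule arg_cong)
  then show "c = forest_class 0"
    by simp
qed simp

text \<open>
  Here \<open>forest_class\<close> is a bijection, so each class has a single coordinate.
\<close>

lemma hall_algebra_realisation:
  "dual_realisation forest_cop forest_size hall_algebra forest_class
     (\<lambda>c. Poly_Mapping.single (class_forest c) 1)"
proof
  fix F
  show "Poly_Mapping.single (class_forest (forest_class F)) 1 = Poly_Mapping.single F (1 :: rat)"
    by simp
next
  show "space hall_algebra = {a. (\<forall>c. a c = linext (a \<circ> forest_class) (Poly_Mapping.single (class_forest c) 1)) \<and>
      finite {F. a (forest_class F) \<noteq> 0}}" (is "_ = ?R")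
  proof (rule set_eqI)
    fix a :: "tmod_class \<Rightarrow> rat"
    have "finite {F. a (forest_class F) \<noteq> 0} \<longleftrightarrow> finite {c. a c \<noteq> 0}"
    proof
      have "inj forest_class"
        by (rule inj_on_inverseI [of _ class_forest]) simp
      then show "finite {F. a (forest_class F) \<noteq> 0}" if "finite {c. a c \<noteq> 0}"
        using finite_vimageI [OF that, of forest_class] by (simp add: vimage_def)
      have "inj class_forest"
        by (rule inj_on_inverseI [of _ forest_class]) simp
      then show "finite {c. a c \<noteq> 0}" if "finite {F. a (forest_class F) \<noteq> 0}"
        using finite_vimageI [OF that, of class_forest] by (simp add: vimage_def)
    qed
    moreover have "a \<in> space hall_algebra \<longleftrightarrow> finite {c. a c \<noteq> 0}"
      by (simp add: hall_algebra_def)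
    ultimately show "a \<in> space hall_algebra \<longleftrightarrow> a \<in> ?R"
      by simp
  qed
next
  fix a b
  show "mul hall_algebra a b = (\<lambda>c. linext (forests.conv (a \<circ> forest_class) (b \<circ> forest_class))
      (Poly_Mapping.single (class_forest c) 1))"
    by (rule ext) (simp add: hall_algebra_def hall_mul_eq)
next
  have "forests.delta (class_forest c) = (if c = tmod_class zero_tmod then 1 else (0 :: rat))" for c
    by (simp add: forests.delta_def class_forest_eq_zero_iff tmod_class_zero)
  then show "bialgebra_data.unit hall_algebra = (\<lambda>c. linext forests.delta (Poly_Mapping.single (class_forest c) 1))"
    by (simp add: hall_algebra_def)
next
  fix a :: "tmod_class \<Rightarrow> rat"
  have "tmod_class (wedge_tmod (tmod_rep c) (tmod_rep d)) = forest_class (class_forest c + class_forest d)" for c d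
    using tmod_class_eq_forest_class [OF mod_forest_wedge(1) [OF fin_nil_tmod_rep [of c] fin_nil_tmod_rep [of d]]]
      mod_forest_wedge(2) [OF fin_nil_tmod_rep [of c] fin_nil_tmod_rep [of d]]
    unfolding class_forest_def by simp
  then show "comul hall_algebra a = (\<lambda>(c, d). linext (\<lambda>F. linext (\<lambda>G. a (forest_class (F + G)))
      (Poly_Mapping.single (class_forest d) 1)) (Poly_Mapping.single (class_forest c) 1))"
    by (simp add: hall_algebra_def hall_comul_def)
next
  fix a :: "tmod_class \<Rightarrow> rat"
  show "counit hall_algebra a = a (forest_class 0)"
    by (simp add: hall_algebra_def tmod_class_zero)
qed

theorem theorem2:
  shows "hopf_isomorphic kreimer_dual hall_algebra"
  by (rule hopf_isomorphic_realisations [OF kreimer_dual_realisation hall_algebra_realisation])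

end
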